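(* Let $\Phi:\mathcal{L}(\mathcal{H})\to\mathcal{L}(\mathcal{K})$ be a quantum channel, and let $\mathscr{G}_1,\ldots,\mathscr{G}_R$ be $C^*$-algebras and $\ell_1,\ldots,\ell_R\ge1$ integers such that each $\mathscr{G}_j$ is a maximal transmittable algebra for $\Phi^{\otimes\ell_j}$. Suppose that for every $n\geq1$, every maximal transmittable algebra $\mathscr{C}$ for $\Phi^{\otimes n}$ satisfies $$\mathscr{C}\leq\bigotimes_{j=1}^R\mathscr{G}_j^{\otimes a_j}$$ for some $a_1,\ldots,a_R\in\mathbb{N}_0$ (depending on $\mathscr{C}$) with $\sum_{j=1}^Ra_j\ell_j=n$. Then, for every $n\ge1$, $$w_n(\Phi)\leq\binom{n+R}{R}=O(n^R).$$
   Context: All Hilbert spaces are finite-dimensional and complex; all $C^*$-algebras are finite-dimensional and nonzero. $\mathcal{L}(\mathcal{H})$ is the algebra of linear operators on $\mathcal{H}$. A quantum channel is a linear, completely positive, trace-preserving map $\Phi:\mathcal{L}(\mathcal{H})\to\mathcal{L}(\mathcal{K})$; its adjoint $\Phi^*$ is defined by $\mathrm{Tr}(Y\Phi(X))=\mathrm{Tr}(\Phi^*(Y)X)$. $\mathbb{N}_0=\{0,1,2,\ldots\}$; a zeroth tensor power of an algebra is $\mathbb{C}$. Embedding: $\mathscr{A}\leq\mathscr{B}$ means there is an injective (not necessarily unital) $*$-homomorphism $\mathscr{A}\to\mathscr{B}$. Correctability: a $*$-subalgebra $\mathscr{A}\subseteq\mathcal{L}(\mathcal{H})$ with unit projection $P$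 (possibly $P\neq 1_{\mathcal{H}}$) is correctable for $\Phi$ if, with $C=P\mathcal{H}$, $V:C\to\mathcal{H}$ the inclusion and $\Phi|_C(Y)=\Phi(VYV^* )$, there is a channel $\mathcal{D}:\mathcal{L}(\mathcal{K})\to\mathcal{L}(C)$ with $(\mathcal{D}\circ\Phi|_C)^*(X)=X$ for all $X\in V^*\mathscr{A}V$. $\mathscr{A}$ is transmittable via $\Phi$ if there is an injective $*$-homomorphism $\pi:\mathscr{A}\to\mathcal{L}(\mathcal{H})$ whose image is correctable for $\Phi$; $\mathscr{T}(\Phi)$ is the set of transmittable algebras up to $*$-isomorphism. $\mathscr{A}\in\mathscr{T}(\Phi)$ is a maximal transmittable algebra for $\Phi$ if $\mathscr{B}\in\mathscr{T}(\Phi)$, $\mathscr{A}\leq\mathscr{B}$ imply $\mathscr{A}\cong\mathscr{B}$; $\max(\mathscr{T}(\Phi))$ is the set of these up to $*$-isomorphism. Width: $w_n(\Phi)=|\max(\mathscr{T}(\Phi^{\otimes n}))|$, the number of $*$-isomorphism classes of maximal transmittable algebras for $\Phi^{\otimes n}$. *)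

theory Defs
  imports
    "Jordan_Normal_Form.Schur_Decomposition"
    "HOL-Library.FuncSet"
    "HOL-Library.Landau_Symbols"
begin

section \<open>Finite-dimensional C*-algebras\<close>

record 'a star_algebra = "'a partial_object" +
  azero :: 'a
  aadd :: "'a \<Rightarrow> 'a \<Rightarrow> 'a"
  ascale :: "complex \<Rightarrow> 'a \<Rightarrow> 'a"
  amult :: "'a \<Rightarrow> 'a \<Rightarrow> 'a"
  astar :: "'a \<Rightarrow> 'a"

locale star_algebra =
  fixes A :: "('a, 'm) star_algebra_scheme"
  assumes zero_closed: "azero A \<in> carrier A"
    and add_closed: "\<lbrakk>x \<in> carrier A; y \<in> carrier A\<rbrakk> \<Longrightarrow> aadd A x y \<in> carrier A"
    and scale_closed: "x \<in> carrier A \<Longrightarrow> ascale A c x \<in> carrier A"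
    and mult_closed: "\<lbrakk>x \<in> carrier A; y \<in> carrier A\<rbrakk> \<Longrightarrow> amult A x y \<in> carrier A"
    and star_closed: "x \<in> carrier A \<Longrightarrow> astar A x \<in> carrier A"
    and add_assoc: "\<lbrakk>x \<in> carrier A; y \<in> carrier A; z \<in> carrier A\<rbrakk>
      \<Longrightarrow> aadd A (aadd A x y) z = aadd A x (aadd A y z)"
    and add_comm: "\<lbrakk>x \<in> carrier A; y \<in> carrier A\<rbrakk> \<Longrightarrow> aadd A x y = aadd A y x"
    and add_zero: "x \<in> carrier A \<Longrightarrow> aadd A (azero A) x = x"
    and add_neg: "x \<in> carrier A \<Longrightarrow> aadd A (ascale A (- 1) x) x = azero A"
    and scale_one: "x \<in> carrier A \<Longrightarrow> ascale A 1 x = x"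
    and scale_scale: "x \<in> carrier A \<Longrightarrow> ascale A b (ascale A c x) = ascale A (b * c) x"
    and scale_add_left: "x \<in> carrier A \<Longrightarrow> ascale A (b + c) x = aadd A (ascale A b x) (ascale A c x)"
    and scale_add_right: "\<lbrakk>x \<in> carrier A; y \<in> carrier A\<rbrakk>
      \<Longrightarrow> ascale A c (aadd A x y) = aadd A (ascale A c x) (ascale A c y)"
    and mult_assoc: "\<lbrakk>x \<in> carrier A; y \<in> carrier A; z \<in> carrier A\<rbrakk>
      \<Longrightarrow> amult A (amult A x y) z = amult A x (amult A y z)"
    and mult_add_left: "\<lbrakk>x \<in> carrier A; y \<in> carrier A; z \<in> carrier A\<rbrakk>
      \<Longrightarrow> amult A (aadd A x y) z = aadd A (amult A x z) (amult A y z)"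
    and mult_add_right: "\<lbrakk>x \<in> carrier A; y \<in> carrier A; z \<in> carrier A\<rbrakk>
      \<Longrightarrow> amult A x (aadd A y z) = aadd A (amult A x y) (amult A x z)"
    and mult_scale_left: "\<lbrakk>x \<in> carrier A; y \<in> carrier A\<rbrakk>
      \<Longrightarrow> amult A (ascale A c x) y = ascale A c (amult A x y)"
    and mult_scale_right: "\<lbrakk>x \<in> carrier A; y \<in> carrier A\<rbrakk>
      \<Longrightarrow> amult A x (ascale A c y) = ascale A c (amult A x y)"
    and star_star: "x \<in> carrier A \<Longrightarrow> astar A (astar A x) = x"
    and star_add: "\<lbrakk>x \<in> carrier A; y \<in> carrier A\<rbrakk>
      \<Longrightarrow> astar A (aadd A x y) = aadd A (astar A x) (astar A y)"
    and star_scale: "x \<in> carrier A \<Longrightarrow> astar A (ascale A c x) = ascale A (cnj c) (astar A x)"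
    and star_mult: "\<lbrakk>x \<in> carrier A; y \<in> carrier A\<rbrakk>
      \<Longrightarrow> astar A (amult A x y) = amult A (astar A y) (astar A x)"

inductive_set lin_span :: "('a, 'm) star_algebra_scheme \<Rightarrow> 'a set \<Rightarrow> 'a set"
  for A :: "('a, 'm) star_algebra_scheme" and B :: "'a set" where
  span_zero: "azero A \<in> lin_span A B"
| span_step: "x \<in> B \<Longrightarrow> y \<in> lin_span A B \<Longrightarrow> aadd A (ascale A c x) y \<in> lin_span A B"

definition cstar_norm :: "('a, 'm) star_algebra_scheme \<Rightarrow> ('a \<Rightarrow> real) \<Rightarrow> bool" where
  "cstar_norm A N \<longleftrightarrow>
     (\<forall>x\<in>carrier A. 0 \<le> N x \<and> (N x = 0 \<longleftrightarrow> x = azero A)) \<and>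
     (\<forall>x\<in>carrier A. \<forall>c. N (ascale A c x) = cmod c * N x) \<and>
     (\<forall>x\<in>carrier A. \<forall>y\<in>carrier A. N (aadd A x y) \<le> N x + N y) \<and>
     (\<forall>x\<in>carrier A. \<forall>y\<in>carrier A. N (amult A x y) \<le> N x * N y) \<and>
     (\<forall>x\<in>carrier A. N (amult A (astar A x) x) = (N x)\<^sup>2)"

text \<open>The C*-norm is determined by the *-algebra structure, so it is not carried in the record, and
  it is complete because the dimension is finite. No unit is required. The zero algebra is excluded.\<close>

locale fd_cstar_algebra = star_algebra +
  assumes finite_dim: "\<exists>B. finite B \<and> B \<subseteq> carrier A \<and> carrier A = lin_span A B"
    and nonzero: "carrier A \<noteq> {azero A}"
    and cstar: "\<exists>N. cstar_norm A N"

definition star_hom :: "'a star_algebra \<Rightarrow> 'b star_algebra \<Rightarrow> ('a \<Rightarrow> 'b) \<Rightarrow> bool" where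
  "star_hom A B \<pi> \<longleftrightarrow>
     \<pi> \<in> carrier A \<rightarrow> carrier B \<and>
     (\<forall>x\<in>carrier A. \<forall>y\<in>carrier A. \<pi> (aadd A x y) = aadd B (\<pi> x) (\<pi> y)) \<and>
     (\<forall>x\<in>carrier A. \<forall>c. \<pi> (ascale A c x) = ascale B c (\<pi> x)) \<and>
     (\<forall>x\<in>carrier A. \<forall>y\<in>carrier A. \<pi> (amult A x y) = amult B (\<pi> x) (\<pi> y)) \<and>
     (\<forall>x\<in>carrier A. \<pi> (astar A x) = astar B (\<pi> x))"

definition star_embeds :: "'a star_algebra \<Rightarrow> 'b star_algebra \<Rightarrow> bool" where
  "star_embeds A B \<longleftrightarrow> (\<exists>\<pi>. star_hom A B \<pi> \<and> inj_on \<pi> (carrier A))"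

definition star_iso :: "'a star_algebra \<Rightarrow> 'b star_algebra \<Rightarrow> bool" where
  "star_iso A B \<longleftrightarrow> (\<exists>\<pi>. star_hom A B \<pi> \<and> bij_betw \<pi> (carrier A) (carrier B))"


section \<open>Tensor products of *-algebras\<close>

text \<open>The tensor product of \<open>A 0, \<dots>, A (N - 1)\<close> is realised inside the dual of the space of
  multilinear forms on their product, as the span of the elementary tensors, i.e. of the evaluations
  at tuples. Product and star are the bilinear and antilinear operations determined by
  \<open>(\<Otimes> x\<^sub>i) (\<Otimes> y\<^sub>i) = \<Otimes> x\<^sub>i y\<^sub>i\<close> and \<open>(\<Otimes> x\<^sub>i)\<^sup>* = \<Otimes> x\<^sub>i\<^sup>*\<close>
  (see \<open>tensor_mult_elem\<close> and \<open>tensor_star_elem\<close> below). Functionals are set to 0 off the multilinear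
  forms, so that equality of functions is equality of tensors. For \<open>N = 0\<close> the only tuple is the empty
  one, and the tensor product is a copy of the complex numbers.\<close>

definition tuples :: "nat \<Rightarrow> (nat \<Rightarrow> 'a star_algebra) \<Rightarrow> (nat \<Rightarrow> 'a) set" where
  "tuples N A = (\<Pi>\<^sub>E i\<in>{..<N}. carrier (A i))"

definition multilinear_form :: "nat \<Rightarrow> (nat \<Rightarrow> 'a star_algebra) \<Rightarrow> ((nat \<Rightarrow> 'a) \<Rightarrow> complex) \<Rightarrow> bool"
  where "multilinear_form N A \<beta> \<longleftrightarrow>
     (\<forall>x\<in>tuples N A. \<forall>i<N. \<forall>u\<in>carrier (A i). \<forall>v\<in>carrier (A i).
        \<beta> (x(i := aadd (A i) u v)) = \<beta> (x(i := u)) + \<beta> (x(i := v))) \<and>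
     (\<forall>x\<in>tuples N A. \<forall>i<N. \<forall>u\<in>carrier (A i). \<forall>c.
        \<beta> (x(i := ascale (A i) c u)) = c * \<beta> (x(i := u)))"

definition elem_tensor ::
    "nat \<Rightarrow> (nat \<Rightarrow> 'a star_algebra) \<Rightarrow> (nat \<Rightarrow> 'a) \<Rightarrow> ((nat \<Rightarrow> 'a) \<Rightarrow> complex) \<Rightarrow> complex" where
  "elem_tensor N A x = (\<lambda>\<beta>. if multilinear_form N A \<beta> then \<beta> x else 0)"

definition tensor_algebra ::
    "nat \<Rightarrow> (nat \<Rightarrow> 'a star_algebra) \<Rightarrow> (((nat \<Rightarrow> 'a) \<Rightarrow> complex) \<Rightarrow> complex) star_algebra" where
  "tensor_algebra N A = \<lparr>
     carrier = {T. \<exists>F c. finite F \<and> F \<subseteq> tuples N A \<and> T = (\<lambda>\<beta>. \<Sum>x\<in>F. c x * elem_tensor N A x \<beta>)},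
     azero = (\<lambda>\<beta>. 0),
     aadd = (\<lambda>S T \<beta>. S \<beta> + T \<beta>),
     ascale = (\<lambda>c T \<beta>. c * T \<beta>),
     amult = (\<lambda>S T \<beta>. if multilinear_form N A \<beta>
        then S (\<lambda>x. T (\<lambda>y. \<beta> (\<lambda>i\<in>{..<N}. amult (A i) (x i) (y i)))) else 0),
     astar = (\<lambda>T \<beta>. if multilinear_form N A \<beta>
        then cnj (T (\<lambda>x. cnj (\<beta> (\<lambda>i\<in>{..<N}. astar (A i) (x i))))) else 0) \<rparr>"

lemma tuples_upd:
  "x \<in> tuples N A \<Longrightarrow> i < N \<Longrightarrow> u \<in> carrier (A i) \<Longrightarrow> x(i := u) \<in> tuples N A"
  by (auto simp: tuples_def PiE_iff extensional_def)

lemma restrict_upd: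
  fixes N i :: nat
  assumes "i < N"
  shows "(\<lambda>j\<in>{..<N}. f j ((x(i := u)) j)) = (\<lambda>j\<in>{..<N}. f j (x j))(i := f i u)"
  using assms by (auto simp: fun_eq_iff restrict_def)

lemma tensor_mult_elem:
  assumes A: "\<And>i. i < N \<Longrightarrow> star_algebra (A i)"
    and x: "x \<in> tuples N A" and y: "y \<in> tuples N A"
  shows "amult (tensor_algebra N A) (elem_tensor N A x) (elem_tensor N A y)
    = elem_tensor N A (\<lambda>i\<in>{..<N}. amult (A i) (x i) (y i))"
proof
  fix \<beta> :: "(nat \<Rightarrow> 'a) \<Rightarrow> complex"
  let ?m = "\<lambda>x y. \<lambda>i\<in>{..<N}. amult (A i) (x i) (y i)"
  have mem: "z i \<in> carrier (A i)" if "z \<in> tuples N A" "i < N" for z i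
    using that by (auto simp: tuples_def)
  have m: "?m z w \<in> tuples N A" if "z \<in> tuples N A" "w \<in> tuples N A" for z w
    using that A by (auto simp: tuples_def PiE_iff star_algebra.mult_closed)
  show "amult (tensor_algebra N A) (elem_tensor N A x) (elem_tensor N A y) \<beta>
    = elem_tensor N A (?m x y) \<beta>"
  proof (cases "multilinear_form N A \<beta>")
    case True
    have add: "\<beta> (z(i := aadd (A i) u v)) = \<beta> (z(i := u)) + \<beta> (z(i := v))"
      if "z \<in> tuples N A" "i < N" "u \<in> carrier (A i)" "v \<in> carrier (A i)" for z i u v
      using True that by (auto simp: multilinear_form_def)
    have scale: "\<beta> (z(i := ascale (A i) c u)) = c * \<beta> (z(i := u))"
      if "z \<in> tuples N A" "i < N" "u \<in> carrier (A i)" for z i u c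
      using True that by (auto simp: multilinear_form_def)
    have R: "multilinear_form N A (\<lambda>w. \<beta> (?m z w))" if z: "z \<in> tuples N A" for z
      unfolding multilinear_form_def
      using z A m[OF z] mem
      by (auto simp del: fun_upd_apply simp: restrict_upd[where f = "\<lambda>j. amult (A j) (z j)"] add scale
          star_algebra.mult_add_right star_algebra.mult_scale_right star_algebra.mult_closed)
    have E: "elem_tensor N A y (\<lambda>w. \<beta> (?m z w)) = \<beta> (?m z y)" if "z \<in> tuples N A" for z
      using R[OF that] by (simp add: elem_tensor_def)
    have L: "multilinear_form N A (\<lambda>z. elem_tensor N A y (\<lambda>w. \<beta> (?m z w)))"
      unfolding multilinear_form_def
      using y A m[OF _ y] mem
      by (auto simp del: fun_upd_apply simp: restrict_upd[where f = "\<lambda>j s. amult (A j) s (y j)"] add scale E tuples_upd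
          star_algebra.add_closed star_algebra.scale_closed
          star_algebra.mult_add_left star_algebra.mult_scale_left star_algebra.mult_closed)
    have "elem_tensor N A x (\<lambda>z. elem_tensor N A y (\<lambda>w. \<beta> (?m z w))) = \<beta> (?m x y)"
      using L E[OF x] by (simp add: elem_tensor_def)
    then show ?thesis
      using True by (simp add: tensor_algebra_def elem_tensor_def[of N A "?m x y"])
  qed (simp add: tensor_algebra_def elem_tensor_def)
qed

lemma tensor_star_elem:
  assumes A: "\<And>i. i < N \<Longrightarrow> star_algebra (A i)" and x: "x \<in> tuples N A"
  shows "astar (tensor_algebra N A) (elem_tensor N A x)
    = elem_tensor N A (\<lambda>i\<in>{..<N}. astar (A i) (x i))"
proof
  fix \<beta> :: "(nat \<Rightarrow> 'a) \<Rightarrow> complex"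
  let ?s = "\<lambda>x. \<lambda>i\<in>{..<N}. astar (A i) (x i)"
  have s: "?s z \<in> tuples N A" if "z \<in> tuples N A" for z
    using that A by (auto simp: tuples_def PiE_iff star_algebra.star_closed)
  show "astar (tensor_algebra N A) (elem_tensor N A x) \<beta> = elem_tensor N A (?s x) \<beta>"
  proof (cases "multilinear_form N A \<beta>")
    case True
    have add: "\<beta> (z(i := aadd (A i) u v)) = \<beta> (z(i := u)) + \<beta> (z(i := v))"
      if "z \<in> tuples N A" "i < N" "u \<in> carrier (A i)" "v \<in> carrier (A i)" for z i u v
      using True that by (auto simp: multilinear_form_def)
    have scale: "\<beta> (z(i := ascale (A i) c u)) = c * \<beta> (z(i := u))"
      if "z \<in> tuples N A" "i < N" "u \<in> carrier (A i)" for z i u c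
      using True that by (auto simp: multilinear_form_def)
    have "multilinear_form N A (\<lambda>z. cnj (\<beta> (?s z)))"
      unfolding multilinear_form_def
      using A s
      by (auto simp del: fun_upd_apply simp: restrict_upd[where f = "\<lambda>j. astar (A j)"] add scale
          star_algebra.star_add star_algebra.star_scale star_algebra.star_closed)
    then show ?thesis
      using True by (simp add: tensor_algebra_def elem_tensor_def)
  qed (simp add: tensor_algebra_def elem_tensor_def)
qed

abbreviation tensor_power ::
    "'a star_algebra \<Rightarrow> nat \<Rightarrow> (((nat \<Rightarrow> 'a) \<Rightarrow> complex) \<Rightarrow> complex) star_algebra" where
  "tensor_power A m \<equiv> tensor_algebra m (\<lambda>_. A)"


section \<open>Quantum channels\<close>

text \<open>A finite-dimensional Hilbert space is identified with \<open>\<complex>\<^sup>d\<close> through an orthonormal basis;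
  maps between operator algebras are functions on matrices of which only the values on
  \<open>carrier_mat d d\<close> matter.\<close>

definition mtrace :: "complex mat \<Rightarrow> complex" where
  "mtrace X = (\<Sum>i<dim_row X. X $$ (i, i))"

definition psd :: "nat \<Rightarrow> complex mat \<Rightarrow> bool" where
  "psd d X \<longleftrightarrow> X \<in> carrier_mat d d \<and> (\<forall>v\<in>carrier_vec d. 0 \<le> (X *\<^sub>v v) \<bullet>c v)"

definition mat_unit :: "nat \<Rightarrow> nat \<Rightarrow> nat \<Rightarrow> complex mat" where
  "mat_unit d a b = mat d d (\<lambda>(i, j). if i = a \<and> j = b then 1 else 0)"

definition kron :: "complex mat \<Rightarrow> complex mat \<Rightarrow> complex mat" where
  "kron X Y = mat (dim_row X * dim_row Y) (dim_col X * dim_col Y)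
     (\<lambda>(i, j). X $$ (i div dim_row Y, j div dim_col Y) * Y $$ (i mod dim_row Y, j mod dim_col Y))"

definition linear_map :: "nat \<Rightarrow> nat \<Rightarrow> (complex mat \<Rightarrow> complex mat) \<Rightarrow> bool" where
  "linear_map d k \<Phi> \<longleftrightarrow>
     \<Phi> \<in> carrier_mat d d \<rightarrow> carrier_mat k k \<and>
     (\<forall>X\<in>carrier_mat d d. \<forall>Y\<in>carrier_mat d d. \<Phi> (X + Y) = \<Phi> X + \<Phi> Y) \<and>
     (\<forall>X\<in>carrier_mat d d. \<forall>c. \<Phi> (c \<cdot>\<^sub>m X) = c \<cdot>\<^sub>m \<Phi> X)"

text \<open>Linear extension of \<open>kron X Y \<mapsto> kron (\<Phi> X) (\<Psi> Y)\<close>: the coefficient of \<open>Z\<close> at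
  \<open>kron (mat_unit d\<^sub>1 a b) (mat_unit d\<^sub>2 c e)\<close> is \<open>Z $$ (a * d\<^sub>2 + c, b * d\<^sub>2 + e)\<close>.\<close>

definition tensor_map ::
    "nat \<Rightarrow> nat \<Rightarrow> (complex mat \<Rightarrow> complex mat) \<Rightarrow> nat \<Rightarrow> nat \<Rightarrow> (complex mat \<Rightarrow> complex mat)
      \<Rightarrow> complex mat \<Rightarrow> complex mat" where
  "tensor_map d\<^sub>1 k\<^sub>1 \<Phi> d\<^sub>2 k\<^sub>2 \<Psi> Z = mat (k\<^sub>1 * k\<^sub>2) (k\<^sub>1 * k\<^sub>2) (\<lambda>ij.
     \<Sum>a<d\<^sub>1. \<Sum>b<d\<^sub>1. \<Sum>c<d\<^sub>2. \<Sum>e<d\<^sub>2.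
       Z $$ (a * d\<^sub>2 + c, b * d\<^sub>2 + e) * kron (\<Phi> (mat_unit d\<^sub>1 a b)) (\<Psi> (mat_unit d\<^sub>2 c e)) $$ ij)"

lemma linear_map_expand:
  assumes L: "linear_map d k \<Phi>" and X: "X \<in> carrier_mat d d" and ij: "i < k" "j < k"
  shows "\<Phi> X $$ (i, j) = (\<Sum>a<d. \<Sum>b<d. X $$ (a, b) * \<Phi> (mat_unit d a b) $$ (i, j))"
proof -
  have carr: "\<Phi> Y \<in> carrier_mat k k" if "Y \<in> carrier_mat d d" for Y
    using L that by (auto simp: linear_map_def)
  have add: "\<Phi> (Y + Z) = \<Phi> Y + \<Phi> Z" if "Y \<in> carrier_mat d d" "Z \<in> carrier_mat d d" for Y Z
    using L that by (auto simp: linear_map_def)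
  have scale: "\<Phi> (c \<cdot>\<^sub>m Y) = c \<cdot>\<^sub>m \<Phi> Y" if "Y \<in> carrier_mat d d" for Y c
    using L that by (auto simp: linear_map_def)
  have U: "mat_unit d a b \<in> carrier_mat d d" for a b
    by (simp add: mat_unit_def)
  let ?R = "\<lambda>S. mat d d (\<lambda>p. if p \<in> S then X $$ p else 0)"
  have "\<Phi> (?R S) $$ (i, j) = (\<Sum>(a, b)\<in>S. X $$ (a, b) * \<Phi> (mat_unit d a b) $$ (i, j))"
    if "finite S" for S
    using that
  proof induction
    case empty
    have "?R {} = 0 \<cdot>\<^sub>m 0\<^sub>m d d"
      by (intro eq_matI) auto
    then have "\<Phi> (?R {}) = 0 \<cdot>\<^sub>m \<Phi> (0\<^sub>m d d)"
      by (simp only: scale zero_carrier_mat)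
    then show ?case
      using carr[of "0\<^sub>m d d"] ij by simp
  next
    case (insert p S)
    obtain a b where p: "p = (a, b)" by fastforce
    have "?R (insert p S) = X $$ p \<cdot>\<^sub>m mat_unit d a b + ?R S"
      using insert.hyps p by (intro eq_matI) (auto simp: mat_unit_def)
    then have "\<Phi> (?R (insert p S)) = X $$ p \<cdot>\<^sub>m \<Phi> (mat_unit d a b) + \<Phi> (?R S)"
      using U by (simp add: add scale)
    then show ?case
      using insert carr[of "?R S"] ij p by (auto simp: carrier_matD[OF carr[OF U]])
  qed
  from this[of "{..<d} \<times> {..<d}"] show ?thesis
  proof -
    assume h: "finite ({..<d} \<times> {..<d}) \<Longrightarrow> \<Phi> (?R ({..<d} \<times> {..<d})) $$ (i, j)
      = (\<Sum>(a, b)\<in>{..<d} \<times> {..<d}. X $$ (a, b) * \<Phi> (mat_unit d a b) $$ (i, j))"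
    have "?R ({..<d} \<times> {..<d}) = X"
      using X by (intro eq_matI) auto
    then show ?thesis using h by (simp add: sum.cartesian_product)
  qed
qed

lemma tensor_map_kron:
  assumes L1: "linear_map d\<^sub>1 k\<^sub>1 \<Phi>" and L2: "linear_map d\<^sub>2 k\<^sub>2 \<Psi>"
    and X: "X \<in> carrier_mat d\<^sub>1 d\<^sub>1" and Y: "Y \<in> carrier_mat d\<^sub>2 d\<^sub>2"
  shows "tensor_map d\<^sub>1 k\<^sub>1 \<Phi> d\<^sub>2 k\<^sub>2 \<Psi> (kron X Y) = kron (\<Phi> X) (\<Psi> Y)"
proof (rule eq_matI)
  have c1: "\<Phi> Z \<in> carrier_mat k\<^sub>1 k\<^sub>1" if "Z \<in> carrier_mat d\<^sub>1 d\<^sub>1" for Z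
    using L1 that by (auto simp: linear_map_def)
  have c2: "\<Psi> Z \<in> carrier_mat k\<^sub>2 k\<^sub>2" if "Z \<in> carrier_mat d\<^sub>2 d\<^sub>2" for Z
    using L2 that by (auto simp: linear_map_def)
  have U: "mat_unit d a b \<in> carrier_mat d d" for d a b
    by (simp add: mat_unit_def)
  note dims = carrier_matD[OF c1[OF X]] carrier_matD[OF c2[OF Y]]
    carrier_matD[OF c1[OF U]] carrier_matD[OF c2[OF U]] carrier_matD[OF X] carrier_matD[OF Y]
  show "dim_row (tensor_map d\<^sub>1 k\<^sub>1 \<Phi> d\<^sub>2 k\<^sub>2 \<Psi> (kron X Y)) = dim_row (kron (\<Phi> X) (\<Psi> Y))"
    and "dim_col (tensor_map d\<^sub>1 k\<^sub>1 \<Phi> d\<^sub>2 k\<^sub>2 \<Psi> (kron X Y)) = dim_col (kron (\<Phi> X) (\<Psi> Y))"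
    by (simp_all add: tensor_map_def kron_def dims)
  fix i j
  assume "i < dim_row (kron (\<Phi> X) (\<Psi> Y))" "j < dim_col (kron (\<Phi> X) (\<Psi> Y))"
  then have ij: "i < k\<^sub>1 * k\<^sub>2" "j < k\<^sub>1 * k\<^sub>2"
    by (simp_all add: kron_def dims)
  then have k2: "k\<^sub>2 > 0" by (cases k\<^sub>2) auto
  have q: "i div k\<^sub>2 < k\<^sub>1" "j div k\<^sub>2 < k\<^sub>1" "i mod k\<^sub>2 < k\<^sub>2" "j mod k\<^sub>2 < k\<^sub>2"
    using ij k2 by (simp_all add: less_mult_imp_div_less)
  have idx: "a * d\<^sub>2 + c < d\<^sub>1 * d\<^sub>2" if "a < d\<^sub>1" "c < d\<^sub>2" for a c
  proof -
    have "a * d\<^sub>2 + c < Suc a * d\<^sub>2" using that by simp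
    also have "\<dots> \<le> d\<^sub>1 * d\<^sub>2" using that by (intro mult_le_mono1) simp
    finally show ?thesis .
  qed
  have K: "kron X Y $$ (a * d\<^sub>2 + c, b * d\<^sub>2 + e) = X $$ (a, b) * Y $$ (c, e)"
    if "a < d\<^sub>1" "b < d\<^sub>1" "c < d\<^sub>2" "e < d\<^sub>2" for a b c e
    using that idx by (simp add: kron_def dims)
  let ?f = "\<lambda>a b. \<Phi> (mat_unit d\<^sub>1 a b) $$ (i div k\<^sub>2, j div k\<^sub>2)"
  let ?g = "\<lambda>c e. \<Psi> (mat_unit d\<^sub>2 c e) $$ (i mod k\<^sub>2, j mod k\<^sub>2)"
  have "tensor_map d\<^sub>1 k\<^sub>1 \<Phi> d\<^sub>2 k\<^sub>2 \<Psi> (kron X Y) $$ (i, j)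
      = (\<Sum>a<d\<^sub>1. \<Sum>b<d\<^sub>1. \<Sum>c<d\<^sub>2. \<Sum>e<d\<^sub>2. (X $$ (a, b) * ?f a b) * (Y $$ (c, e) * ?g c e))"
    using ij unfolding tensor_map_def
    by (auto simp: K kron_def[of "\<Phi> _"] dims intro!: sum.cong)
  also have "\<dots> = (\<Sum>a<d\<^sub>1. \<Sum>b<d\<^sub>1. X $$ (a, b) * ?f a b) * (\<Sum>c<d\<^sub>2. \<Sum>e<d\<^sub>2. Y $$ (c, e) * ?g c e)"
    by (simp only: sum_distrib_right) (simp only: sum_distrib_left)
  also have "\<dots> = kron (\<Phi> X) (\<Psi> Y) $$ (i, j)"
    using ij by (simp add: kron_def dims linear_map_expand[OF L1 X q(1,2)] linear_map_expand[OF L2 Y q(3,4)])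
  finally show "tensor_map d\<^sub>1 k\<^sub>1 \<Phi> d\<^sub>2 k\<^sub>2 \<Psi> (kron X Y) $$ (i, j) = kron (\<Phi> X) (\<Psi> Y) $$ (i, j)" .
qed

fun tensor_power_map ::
    "nat \<Rightarrow> nat \<Rightarrow> (complex mat \<Rightarrow> complex mat) \<Rightarrow> nat \<Rightarrow> complex mat \<Rightarrow> complex mat" where
  "tensor_power_map d k \<Phi> 0 = (\<lambda>X. X)"
| "tensor_power_map d k \<Phi> (Suc n) = tensor_map d k \<Phi> (d ^ n) (k ^ n) (tensor_power_map d k \<Phi> n)"

definition completely_positive :: "nat \<Rightarrow> nat \<Rightarrow> (complex mat \<Rightarrow> complex mat) \<Rightarrow> bool" where
  "completely_positive d k \<Phi> \<longleftrightarrow>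
     (\<forall>m X. psd (m * d) X \<longrightarrow> psd (m * k) (tensor_map m m (\<lambda>Y. Y) d k \<Phi> X))"

definition channel :: "nat \<Rightarrow> nat \<Rightarrow> (complex mat \<Rightarrow> complex mat) \<Rightarrow> bool" where
  "channel d k \<Phi> \<longleftrightarrow> linear_map d k \<Phi> \<and> completely_positive d k \<Phi> \<and>
     (\<forall>X\<in>carrier_mat d d. mtrace (\<Phi> X) = mtrace X)"

definition map_adjoint ::
    "nat \<Rightarrow> (complex mat \<Rightarrow> complex mat) \<Rightarrow> complex mat \<Rightarrow> complex mat" where
  "map_adjoint d \<Phi> Y =
     (THE Z. Z \<in> carrier_mat d d \<and> (\<forall>X\<in>carrier_mat d d. mtrace (Y * \<Phi> X) = mtrace (Z * X)))"


section \<open>Transmittable algebras\<close>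

definition matrix_algebra :: "nat \<Rightarrow> complex mat set \<Rightarrow> complex mat star_algebra" where
  "matrix_algebra d S = \<lparr> carrier = S, azero = 0\<^sub>m d d, aadd = (+), ascale = (\<cdot>\<^sub>m), amult = (*),
     astar = mat_adjoint \<rparr>"

definition star_subalgebra :: "nat \<Rightarrow> complex mat set \<Rightarrow> bool" where
  "star_subalgebra d S \<longleftrightarrow>
     S \<subseteq> carrier_mat d d \<and> 0\<^sub>m d d \<in> S \<and> S \<noteq> {0\<^sub>m d d} \<and>
     (\<forall>X\<in>S. \<forall>Y\<in>S. X + Y \<in> S \<and> X * Y \<in> S) \<and>
     (\<forall>X\<in>S. \<forall>c. c \<cdot>\<^sub>m X \<in> S) \<and>
     (\<forall>X\<in>S. mat_adjoint X \<in> S)"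

text \<open>The columns of \<open>V\<close> form an orthonormal basis of the code space \<open>C\<close>, the range of the unit \<open>P\<close>
  of \<open>S\<close>. In this basis \<open>V\<close> is the matrix of the inclusion of \<open>C\<close>, and the operators on \<open>C\<close>
  are the \<open>r \<times> r\<close> matrices. A different basis conjugates \<open>D\<close> by a unitary.\<close>

definition correctable :: "nat \<Rightarrow> nat \<Rightarrow> (complex mat \<Rightarrow> complex mat) \<Rightarrow> complex mat set \<Rightarrow> bool" where
  "correctable d k \<Phi> S \<longleftrightarrow> star_subalgebra d S \<and>
     (\<exists>P\<in>S. (\<forall>X\<in>S. P * X = X \<and> X * P = X) \<and>
       (\<exists>r. \<exists>V\<in>carrier_mat d r. mat_adjoint V * V = 1\<^sub>m r \<and> V * mat_adjoint V = P \<and>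
         (\<exists>D. channel k r D \<and>
           (\<forall>X\<in>S. map_adjoint r (\<lambda>Y. D (\<Phi> (V * Y * mat_adjoint V))) (mat_adjoint V * X * V)
             = mat_adjoint V * X * V))))"

definition transmittable ::
    "nat \<Rightarrow> nat \<Rightarrow> (complex mat \<Rightarrow> complex mat) \<Rightarrow> 'a star_algebra \<Rightarrow> bool" where
  "transmittable d k \<Phi> A \<longleftrightarrow> fd_cstar_algebra A \<and>
     (\<exists>\<pi>. star_hom A (matrix_algebra d (carrier_mat d d)) \<pi> \<and> inj_on \<pi> (carrier A) \<and>
       correctable d k \<Phi> (\<pi> ` carrier A))"

text \<open>HOL cannot quantify over all types of elements of an algebra. Algebras whose elements are
  matrices suffice, since a transmittable algebra is *-isomorphic to its image under \<open>\<pi>\<close>.\<close>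

definition maximal_transmittable ::
    "nat \<Rightarrow> nat \<Rightarrow> (complex mat \<Rightarrow> complex mat) \<Rightarrow> 'a star_algebra \<Rightarrow> bool" where
  "maximal_transmittable d k \<Phi> A \<longleftrightarrow> transmittable d k \<Phi> A \<and>
     (\<forall>B :: complex mat star_algebra. transmittable d k \<Phi> B \<longrightarrow> star_embeds A B \<longrightarrow> star_iso A B)"

definition max_classes ::
    "nat \<Rightarrow> nat \<Rightarrow> (complex mat \<Rightarrow> complex mat) \<Rightarrow> complex mat star_algebra set set" where
  "max_classes d k \<Phi> = {A. maximal_transmittable d k \<Phi> A} // {(A, B). star_iso A B}"

definition width :: "nat \<Rightarrow> nat \<Rightarrow> (complex mat \<Rightarrow> complex mat) \<Rightarrow> nat \<Rightarrow> nat" where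
  "width d k \<Phi> n = card (max_classes (d ^ n) (k ^ n) (tensor_power_map d k \<Phi> n))"

end

theory Submission
  imports Defs "HOL-Analysis.L2_Norm"
begin

text \<open>Correctability is stable under tensor products: the tensor products of the codes and of the
  decoders correct the span of the elementary tensors. Hence, if \<open>\<Sum> a\<^sub>j l\<^sub>j = n\<close>, the algebra
  \<open>\<Otimes> G\<^sub>j\<^bsup>\<otimes>a\<^sub>j\<^esup>\<close> embeds into a *-algebra of matrices that is transmittable for the \<open>n\<close>-th power
  of the channel. A maximal transmittable algebra embedded into it is isomorphic to that matrix algebra
  by maximality, so its class is determined by the exponents \<open>a\<close>. As all \<open>l\<^sub>j\<close> are positive,
  there are at most \<open>(n + R) choose R\<close> such exponents.\<close>

section \<open>Matrices and Kronecker products\<close>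

text \<open>The abstract tensor product need not be identified with the matrix algebra that
  represents it: an injective *-homomorphism into a correctable algebra is enough, because
  maximality turns the composite embedding of \<open>C\<close> into an isomorphism. The hard point
  is injectivity. A tensor is a functional on all multilinear forms, whereas its matrix records only
  the values at coordinate forms, so these must span the multilinear forms. Passing to matrices is
  also forced by types: maximality compares only with algebras of matrices, while the elements of a
  tensor product are functionals, and those of a product of tensor powers are functionals over
  functionals. Statements about tensor products are therefore polymorphic in the factors and used at
  two levels, for the powers of one \<open>G j\<close> and for the product over \<open>j\<close>.
  Two definitions are reshaped before tensoring. Complete positivity is stated with the ancilla
  \<open>{..<m}\<close>, but the other tensor factor has to become part of the ancilla; and the
  adjoint is a definite description, which is replaced by an identity between traces.\<close>

lemma dim_row_mat_adjoint [simp]: "dim_row (mat_adjoint A) = dim_col A"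
  and dim_col_mat_adjoint [simp]: "dim_col (mat_adjoint A) = dim_row A"
  by (simp_all add: mat_adjoint_def)

lemma index_mat_adjoint [simp]:
  fixes A :: "complex mat"
  assumes "i < dim_col A" "j < dim_row A"
  shows "mat_adjoint A $$ (i, j) = cnj (A $$ (j, i))"
  using assms by (simp add: mat_adjoint_def mat_of_rows_def)

lemma mat_adjoint_carrier [simp, intro]:
  "A \<in> carrier_mat m n \<Longrightarrow> mat_adjoint A \<in> carrier_mat n m"
  by auto

text \<open>The sum runs over \<open>{..<n}\<close>, the form that \<open>sum_pair_index\<close> can
  split; proofs that rely on it remove \<open>index_mult_mat(1)\<close> from the simpset.\<close>

lemma index_mult_mat_sum:
  assumes "A \<in> carrier_mat m n" "B \<in> carrier_mat n p" "i < m" "j < p"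
  shows "(A * B) $$ (i, j) = (\<Sum>t<n. A $$ (i, t) * B $$ (t, j))"
  using assms by (simp add: scalar_prod_def atLeast0LessThan)

lemma mat_adjoint_adjoint [simp]:
  fixes A :: "complex mat" shows "mat_adjoint (mat_adjoint A) = A"
  by (intro eq_matI) auto

lemma mat_adjoint_add:
  fixes A B :: "complex mat"
  assumes "A \<in> carrier_mat m n" "B \<in> carrier_mat m n"
  shows "mat_adjoint (A + B) = mat_adjoint A + mat_adjoint B"
  using assms by (intro eq_matI) auto

lemma mat_adjoint_smult:
  fixes A :: "complex mat"
  shows "mat_adjoint (c \<cdot>\<^sub>m A) = cnj c \<cdot>\<^sub>m mat_adjoint A"
  by (intro eq_matI) auto

lemma mat_adjoint_zero [simp]: "mat_adjoint (0\<^sub>m m n :: complex mat) = 0\<^sub>m n m"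
  by (intro eq_matI) auto

lemma mat_adjoint_one [simp]: "mat_adjoint (1\<^sub>m n :: complex mat) = 1\<^sub>m n"
  by (intro eq_matI) auto

lemma mat_adjoint_mult:
  fixes A B :: "complex mat"
  assumes A: "A \<in> carrier_mat m n" and B: "B \<in> carrier_mat n p"
  shows "mat_adjoint (A * B) = mat_adjoint B * mat_adjoint A"
proof (rule eq_matI)
  fix i j
  assume "i < dim_row (mat_adjoint B * mat_adjoint A)" "j < dim_col (mat_adjoint B * mat_adjoint A)"
  then have ij: "i < p" "j < m" using A B by auto
  have "mat_adjoint (A * B) $$ (i, j) = cnj (\<Sum>t<n. A $$ (j, t) * B $$ (t, i))"
    using ij A B by (subst index_mat_adjoint) (auto simp del: index_mult_mat(1) simp: index_mult_mat_sum[OF A B])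
  also have "\<dots> = (mat_adjoint B * mat_adjoint A) $$ (i, j)"
    using ij A B by (subst index_mult_mat_sum[of _ p n _ m]) (auto simp: mult.commute)
  finally show "mat_adjoint (A * B) $$ (i, j) = (mat_adjoint B * mat_adjoint A) $$ (i, j)" .
qed (use A B in auto)

lemma mat_unit_carrier [simp, intro]: "mat_unit d a b \<in> carrier_mat d d"
  by (simp add: mat_unit_def)

lemma dim_mat_unit [simp]: "dim_row (mat_unit d a b) = d" "dim_col (mat_unit d a b) = d"
  by (simp_all add: mat_unit_def)

lemma index_mat_unit [simp]:
  "i < d \<Longrightarrow> j < d \<Longrightarrow> mat_unit d a b $$ (i, j) = (if i = a \<and> j = b then 1 else 0)"
  by (simp add: mat_unit_def)

lemma dim_kron [simp]: "dim_row (kron X Y) = dim_row X * dim_row Y"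
  "dim_col (kron X Y) = dim_col X * dim_col Y"
  by (simp_all add: kron_def)

lemma kron_carrier [intro]:
  "X \<in> carrier_mat m n \<Longrightarrow> Y \<in> carrier_mat p q \<Longrightarrow> kron X Y \<in> carrier_mat (m * p) (n * q)"
  by auto

lemma pair_index_less: "a < d1 \<Longrightarrow> c < d2 \<Longrightarrow> a * d2 + c < d1 * (d2::nat)"
  using mult_le_mono1[of "Suc a" d1 d2] by simp

lemma pair_index_eq_iff:
  assumes "c < n" "c' < (n::nat)"
  shows "a * n + c = a' * n + c' \<longleftrightarrow> a = a' \<and> c = c'"
proof
  assume "a * n + c = a' * n + c'"
  then have "(a * n + c) div n = (a' * n + c') div n" "(a * n + c) mod n = (a' * n + c') mod n"
    by simp_all
  then show "a = a' \<and> c = c'" using assms by simp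
qed simp

text \<open>Division with remainder by \<open>n\<close> is the inverse. Along this bijection, sums
  and entries over a product dimension become sums and entries over pairs.\<close>

lemma bij_betw_pair_index:
  "bij_betw (\<lambda>(a, c). a * n + c) ({..<m} \<times> {..<n}) {..<m * (n::nat)}"
proof (rule bij_betwI[where g = "\<lambda>p. (p div n, p mod n)"], goal_cases)
  case 1 then show ?case by (auto intro: pair_index_less)
next
  case 2
  show ?case
  proof
    fix p assume "p \<in> {..<m * n}"
    then have "p < m * n" by simp
    moreover from this have "n > 0" by (cases n) auto
    ultimately show "(p div n, p mod n) \<in> {..<m} \<times> {..<n}"
      by (auto intro: less_mult_imp_div_less)
  qed
qed auto

text \<open>The definition decodes indices by div and mod. At an index already written as a pair the
  decoding disappears; with \<open>eq_mat_pairI\<close> this is how most identities for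
  \<open>kron\<close> are checked.\<close>

lemma index_kron:
  assumes "X \<in> carrier_mat m n" "Y \<in> carrier_mat p q" "i < m" "i' < p" "j < n" "j' < q"
  shows "kron X Y $$ (i * p + i', j * q + j') = X $$ (i, j) * Y $$ (i', j')"
  using assms pair_index_less[of i m i' p] pair_index_less[of j n j' q] by (simp add: kron_def)

lemma pair_index_cases:
  assumes "p < m * n"
  obtains a c where "a < m" "c < (n::nat)" "p = a * n + c"
proof -
  from assms have "p \<in> (\<lambda>(a, c). a * n + c) ` ({..<m} \<times> {..<n})"
    using bij_betw_pair_index[of n m] by (simp add: bij_betw_def)
  then show thesis using that by auto
qed

lemma sum_pair_index: "(\<Sum>t<m * n. f t) = (\<Sum>a<m. \<Sum>c<n. f (a * n + c))" for f :: "nat \<Rightarrow> 'b::comm_monoid_add"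
  using sum.reindex_bij_betw[OF bij_betw_pair_index[of n m], of f]
  by (simp add: sum.cartesian_product case_prod_unfold)

lemma eq_mat_pairI:
  assumes "A \<in> carrier_mat (m * p) (n * q)" "B \<in> carrier_mat (m * p) (n * q)"
    and "\<And>i i' j j'. i < m \<Longrightarrow> i' < p \<Longrightarrow> j < n \<Longrightarrow> j' < q \<Longrightarrow>
      A $$ (i * p + i', j * q + j') = B $$ (i * p + i', j * q + j')"
  shows "A = B"
proof (rule eq_matI)
  fix i j assume "i < dim_row B" "j < dim_col B"
  then have "i < m * p" "j < n * q" using assms(2) by auto
  then show "A $$ (i, j) = B $$ (i, j)"
    by (elim pair_index_cases) (simp add: assms(3))
qed (use assms in auto)

text \<open>Mixed-product rule: the inner sum over \<open>n * q\<close> indices is a double sum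
  whose summand factors, hence a product of two sums.\<close>

lemma kron_mult:
  assumes A: "A \<in> carrier_mat m n" and C: "C \<in> carrier_mat n l"
    and B: "B \<in> carrier_mat p q" and D: "D \<in> carrier_mat q r"
  shows "kron (A * C) (B * D) = kron A B * kron C D"
proof (rule eq_mat_pairI)
  show "kron (A * C) (B * D) \<in> carrier_mat (m * p) (l * r)"
    "kron A B * kron C D \<in> carrier_mat (m * p) (l * r)"
    using assms by auto
  fix i i' j j' assume ij: "i < m" "i' < p" "j < l" "j' < r"
  have "(kron A B * kron C D) $$ (i * p + i', j * r + j')
      = (\<Sum>a<n. \<Sum>c<q. (A $$ (i, a) * B $$ (i', c)) * (C $$ (a, j) * D $$ (c, j')))"
    using ij
    by (simp add: index_mult_mat_sum[OF kron_carrier[OF A B] kron_carrier[OF C D]] pair_index_less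
        sum_pair_index index_kron[OF A B] index_kron[OF C D])
  also have "\<dots> = (A * C) $$ (i, j) * (B * D) $$ (i', j')"
    using ij by (simp add: index_mult_mat_sum[OF A C] index_mult_mat_sum[OF B D] sum_product algebra_simps
        del: index_mult_mat(1))
  finally show "kron (A * C) (B * D) $$ (i * p + i', j * r + j')
      = (kron A B * kron C D) $$ (i * p + i', j * r + j')"
    using ij assms by (simp add: index_kron[of _ m l _ p r] del: index_mult_mat(1))
qed

lemma kron_adjoint: "mat_adjoint (kron A B) = kron (mat_adjoint A) (mat_adjoint B)"
proof (rule eq_mat_pairI)
  show "mat_adjoint (kron A B) \<in> carrier_mat (dim_col A * dim_col B) (dim_row A * dim_row B)"
    "kron (mat_adjoint A) (mat_adjoint B) \<in> carrier_mat (dim_col A * dim_col B) (dim_row A * dim_row B)"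
    by auto
qed (simp add: pair_index_less index_kron[of _ "dim_row A" "dim_col A" _ "dim_row B" "dim_col B"]
  index_kron[of _ "dim_col A" "dim_row A" _ "dim_col B" "dim_row B"])

lemma kron_one: "kron (1\<^sub>m m) (1\<^sub>m n) = 1\<^sub>m (m * n)"
proof (rule eq_mat_pairI[of _ m n m n])
  fix i i' j j' assume "i < m" "i' < n" "j < m" "j' < n"
  then show "kron (1\<^sub>m m) (1\<^sub>m n) $$ (i * n + i', j * n + j') = 1\<^sub>m (m * n) $$ (i * n + i', j * n + j')"
    by (subst index_kron[of _ m m _ n n]) (simp_all add: pair_index_less pair_index_eq_iff)
qed auto

lemma kron_add_left:
  assumes "A \<in> carrier_mat m n" "B \<in> carrier_mat m n" "C \<in> carrier_mat p q"
  shows "kron (A + B) C = kron A C + kron B C"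
  using assms by (intro eq_mat_pairI[of _ m p n q])
    (simp_all add: index_kron[of _ m n _ p q] kron_carrier pair_index_less ring_distribs)

lemma kron_add_right:
  assumes "A \<in> carrier_mat m n" "B \<in> carrier_mat p q" "C \<in> carrier_mat p q"
  shows "kron A (B + C) = kron A B + kron A C"
  using assms by (intro eq_mat_pairI[of _ m p n q])
    (simp_all add: index_kron[of _ m n _ p q] kron_carrier pair_index_less ring_distribs)

lemma kron_smult_left: "kron (c \<cdot>\<^sub>m A) B = c \<cdot>\<^sub>m kron A B"
  and kron_smult_right: "kron A (c \<cdot>\<^sub>m B) = c \<cdot>\<^sub>m kron A B"
  by (auto intro!: eq_mat_pairI[of _ "dim_row A" "dim_row B" "dim_col A" "dim_col B"]
    simp: index_kron[of _ "dim_row A" "dim_col A" _ "dim_row B" "dim_col B"] pair_index_less)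

lemma kron_zero_left: "B \<in> carrier_mat p q \<Longrightarrow> kron (0\<^sub>m m n) B = 0\<^sub>m (m * p) (n * q)"
  by (auto intro!: eq_mat_pairI[of _ m p n q] simp: index_kron[of _ m n _ p q] pair_index_less)

lemma kron_assoc: "kron X (kron Y Z) = kron (kron X Y) Z"
proof -
  define m n p q r t where "m = dim_row X" "n = dim_col X" "p = dim_row Y" "q = dim_col Y"
    "r = dim_row Z" "t = dim_col Z"
  then have X: "X \<in> carrier_mat m n" and Y: "Y \<in> carrier_mat p q" and Z: "Z \<in> carrier_mat r t"
    by auto
  \<comment> \<open>Both nestings give a triple of indices the same number, so associativity is an
    equality and no permutation of the basis intervenes.\<close>
  have split: "(a * p + b) * r + c = a * (p * r) + (b * r + c)" for a b c p r :: nat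
    by (simp add: algebra_simps)
  show ?thesis
  proof (rule eq_mat_pairI[of _ "m * p" r "n * q" t])
    show "kron X (kron Y Z) \<in> carrier_mat (m * p * r) (n * q * t)"
      using kron_carrier[OF X kron_carrier[OF Y Z]] by (simp add: mult.assoc)
    show "kron (kron X Y) Z \<in> carrier_mat (m * p * r) (n * q * t)"
      using X Y Z by (intro kron_carrier)
    fix i i' j j' assume ij: "i < m * p" "i' < r" "j < n * q" "j' < t"
    from ij(1) obtain a b where a: "a < m" "b < p" "i = a * p + b" by (rule pair_index_cases)
    from ij(3) obtain c e where c: "c < n" "e < q" "j = c * q + e" by (rule pair_index_cases)
    have "kron X (kron Y Z) $$ (i * r + i', j * t + j') = X $$ (a, c) * (Y $$ (b, e) * Z $$ (i', j'))"
      using a c ij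
      by (simp add: split index_kron[OF X kron_carrier[OF Y Z]] index_kron[OF Y Z] pair_index_less)
    also have "\<dots> = kron (kron X Y) Z $$ (i * r + i', j * t + j')"
      using a c ij by (simp add: index_kron[OF kron_carrier[OF X Y] Z] index_kron[OF X Y] pair_index_less)
    finally show "kron X (kron Y Z) $$ (i * r + i', j * t + j') = kron (kron X Y) Z $$ (i * r + i', j * t + j')" .
  qed
qed

lemma kron_one_left: "kron (1\<^sub>m 1) X = X"
  by (intro eq_matI) (auto simp: kron_def)

lemma mat_unit_kron:
  assumes "a < m" "c < n" "b < m" "e < n"
  shows "mat_unit (m * n) (a * n + c) (b * n + e) = kron (mat_unit m a b) (mat_unit n c e)"
proof (rule eq_mat_pairI[of _ m n m n])
  fix i i' j j' assume ij: "i < m" "i' < n" "j < m" "j' < n"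
  then show "mat_unit (m * n) (a * n + c) (b * n + e) $$ (i * n + i', j * n + j')
      = kron (mat_unit m a b) (mat_unit n c e) $$ (i * n + i', j * n + j')"
    using assms by (subst index_kron[of _ m m _ n n]) (simp_all add: pair_index_less pair_index_eq_iff)
qed auto

section \<open>Induction over matrix units and over elementary tensors\<close>

lemma mat_unit_induct [consumes 1, case_names zero add smult unit]:
  fixes X :: "complex mat"
  assumes X: "X \<in> carrier_mat d d"
    and zero: "P (0\<^sub>m d d)"
    and add: "\<And>Y Z. Y \<in> carrier_mat d d \<Longrightarrow> Z \<in> carrier_mat d d \<Longrightarrow> P Y \<Longrightarrow> P Z \<Longrightarrow> P (Y + Z)"
    and smult: "\<And>c Y. Y \<in> carrier_mat d d \<Longrightarrow> P Y \<Longrightarrow> P (c \<cdot>\<^sub>m Y)"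
    and unit: "\<And>a b. a < d \<Longrightarrow> b < d \<Longrightarrow> P (mat_unit d a b)"
  shows "P X"
proof -
  \<comment> \<open>\<open>?R S\<close> keeps the entries of \<open>X\<close> at the positions in
    \<open>S\<close>; inserting a position adds one multiple of a matrix unit.\<close>
  let ?R = "\<lambda>S. mat d d (\<lambda>p. if p \<in> S then X $$ p else 0)"
  have "P (?R S)" if "finite S" "S \<subseteq> {..<d} \<times> {..<d}" for S
    using that
  proof induction
    case empty
    have "?R {} = 0\<^sub>m d d" by (intro eq_matI) auto
    then show ?case using zero by simp
  next
    case (insert p S)
    obtain a b where p: "p = (a, b)" by fastforce
    have "?R (insert p S) = X $$ p \<cdot>\<^sub>m mat_unit d a b + ?R S"
      using insert.hyps p by (intro eq_matI) auto
    then show ?case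
      using insert p by (auto intro!: add smult unit)
  qed
  moreover have "?R ({..<d} \<times> {..<d}) = X"
    using X by (intro eq_matI) auto
  ultimately show ?thesis by (metis finite_SigmaI finite_lessThan order_refl)
qed

text \<open>A matrix unit of the product space is the Kronecker product of two matrix units. Linear
  statements therefore reduce to elementary tensors.\<close>

lemma kron_induct [consumes 1, case_names zero add smult kron]:
  fixes X :: "complex mat"
  assumes X: "X \<in> carrier_mat (m * n) (m * n)"
    and zero: "P (0\<^sub>m (m * n) (m * n))"
    and add: "\<And>Y Z. Y \<in> carrier_mat (m * n) (m * n) \<Longrightarrow> Z \<in> carrier_mat (m * n) (m * n) \<Longrightarrow>
      P Y \<Longrightarrow> P Z \<Longrightarrow> P (Y + Z)"
    and smult: "\<And>c Y. Y \<in> carrier_mat (m * n) (m * n) \<Longrightarrow> P Y \<Longrightarrow> P (c \<cdot>\<^sub>m Y)"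
    and kron: "\<And>A B. A \<in> carrier_mat m m \<Longrightarrow> B \<in> carrier_mat n n \<Longrightarrow> P (kron A B)"
  shows "P X"
  using X
proof (induction rule: mat_unit_induct)
  case (unit a b)
  then show ?case
    by (elim pair_index_cases) (auto simp: mat_unit_kron intro!: kron)
qed (auto intro: zero add smult)

section \<open>Traces\<close>

lemma mtrace_carrier: "X \<in> carrier_mat d d \<Longrightarrow> mtrace X = (\<Sum>i<d. X $$ (i, i))"
  by (auto simp: mtrace_def)

lemma mtrace_add: "X \<in> carrier_mat d d \<Longrightarrow> Y \<in> carrier_mat d d \<Longrightarrow> mtrace (X + Y) = mtrace X + mtrace Y"
  by (simp add: mtrace_carrier[of _ d] sum.distrib)

lemma mtrace_smult: "X \<in> carrier_mat d d \<Longrightarrow> mtrace (c \<cdot>\<^sub>m X) = c * mtrace X"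
  by (simp add: mtrace_carrier[of _ d] sum_distrib_left)

lemma mtrace_zero [simp]: "mtrace (0\<^sub>m d d) = 0"
  by (simp add: mtrace_def)

lemma mtrace_kron:
  "X \<in> carrier_mat m m \<Longrightarrow> Y \<in> carrier_mat n n \<Longrightarrow> mtrace (kron X Y) = mtrace X * mtrace Y"
  by (simp add: mtrace_carrier[of _ "m * n"] mtrace_carrier[of _ m] mtrace_carrier[of _ n]
      kron_carrier sum_pair_index index_kron[of _ m m _ n n] sum_product)

text \<open>This makes the trace pairing nondegenerate, which is the source of existence and
  uniqueness of the adjoint map.\<close>

lemma mtrace_mult_unit:
  assumes "X \<in> carrier_mat d d" "a < d" "b < d"
  shows "mtrace (X * mat_unit d a b) = X $$ (b, a)"
proof -
  have "(\<Sum>t<d. X $$ (i, t) * mat_unit d a b $$ (t, i)) = (if i = b then X $$ (b, a) else 0)" if "i < d" for i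
    using that assms by (cases "i = b") (simp_all add: if_distrib[of "(*) _"] cong: if_cong)
  then have "mtrace (X * mat_unit d a b) = (\<Sum>i<d. if i = b then X $$ (b, a) else 0)"
    using assms by (simp add: mtrace_carrier[of _ d] index_mult_mat_sum[of _ d d _ d] del: index_mult_mat(1))
  then show ?thesis using assms by simp
qed

section \<open>Matrix *-algebras are C*-algebras\<close>

definition vnorm :: "complex vec \<Rightarrow> real" where
  "vnorm v = L2_set (\<lambda>i. cmod (v $ i)) {..<dim_vec v}"

text \<open>The unit ball replaces the unit sphere so that the supremum is over a nonempty set also
  in dimension 0.\<close>

definition opnorm :: "complex mat \<Rightarrow> real" where
  "opnorm X = (SUP v\<in>{v \<in> carrier_vec (dim_col X). vnorm v \<le> 1}. vnorm (X *\<^sub>v v))"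

lemma vnorm_nonneg [simp]: "0 \<le> vnorm v"
  by (simp add: vnorm_def L2_set_nonneg)

lemma vnorm_smult: "vnorm (c \<cdot>\<^sub>v v) = cmod c * vnorm v"
  by (simp add: vnorm_def L2_set_def norm_mult power_mult_distrib real_sqrt_mult flip: sum_distrib_left)

lemma vnorm_zero [simp]: "vnorm (0\<^sub>v n) = 0"
  by (simp add: vnorm_def L2_set_def)

lemma vnorm_eq_0: "vnorm v = 0 \<Longrightarrow> v = 0\<^sub>v (dim_vec v)"
  by (auto simp: vnorm_def L2_set_eq_0_iff)

lemma vnorm_triangle:
  assumes "dim_vec v = dim_vec w"
  shows "vnorm (v + w) \<le> vnorm v + vnorm w"
proof -
  have "vnorm (v + w) \<le> L2_set (\<lambda>i. cmod (v $ i) + cmod (w $ i)) {..<dim_vec w}"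
    by (auto simp: vnorm_def intro!: L2_set_mono norm_triangle_ineq)
  also have "\<dots> \<le> vnorm v + vnorm w"
    by (simp add: vnorm_def assms L2_set_triangle_ineq)
  finally show ?thesis .
qed

lemma cscalar_prod_sum:
  fixes v w :: "complex vec"
  shows "v \<bullet>c w = (\<Sum>i<dim_vec w. v $ i * cnj (w $ i))"
  by (simp add: scalar_prod_def atLeast0LessThan)

lemma cscalar_prod_self:
  fixes v :: "complex vec"
  shows "v \<bullet>c v = of_real ((vnorm v)\<^sup>2)"
  by (simp add: cscalar_prod_sum vnorm_def L2_set_def sum_nonneg complex_norm_square[symmetric])

lemma cscalar_prod_le:
  fixes v w :: "complex vec"
  assumes "dim_vec v = dim_vec w"
  shows "cmod (v \<bullet>c w) \<le> vnorm v * vnorm w"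
proof -
  have "cmod (v \<bullet>c w) \<le> (\<Sum>i<dim_vec w. \<bar>cmod (v $ i)\<bar> * \<bar>cmod (w $ i)\<bar>)"
    by (auto simp: cscalar_prod_sum norm_mult intro!: sum_norm_le)
  also have "\<dots> \<le> vnorm v * vnorm w"
    by (simp only: vnorm_def assms L2_set_mult_ineq)
  finally show ?thesis .
qed

text \<open>A crude bound by the sum of all entries; it serves to show that the supremum in
  \<open>opnorm\<close> is finite.\<close>

lemma vnorm_mult_bounded:
  "v \<in> carrier_vec (dim_col X) \<Longrightarrow> vnorm v \<le> 1 \<Longrightarrow>
    vnorm (X *\<^sub>v v) \<le> (\<Sum>i<dim_row X. \<Sum>j<dim_col X. cmod (X $$ (i, j)))"
proof -
  assume v: "v \<in> carrier_vec (dim_col X)" "vnorm v \<le> 1"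
  have 1: "cmod (v $ j) \<le> 1" if "j < dim_col X" for j
  proof -
    have "cmod (v $ j) \<le> vnorm v"
      unfolding vnorm_def by (rule member_le_L2_set) (use that v in auto)
    then show ?thesis using v by simp
  qed
  have "vnorm (X *\<^sub>v v) \<le> (\<Sum>i<dim_row X. cmod ((X *\<^sub>v v) $ i))"
    unfolding vnorm_def using L2_set_le_sum[of "{..<dim_vec (X *\<^sub>v v)}" "\<lambda>i. cmod ((X *\<^sub>v v) $ i)"] by simp
  also have "\<dots> \<le> (\<Sum>i<dim_row X. \<Sum>j<dim_col X. cmod (X $$ (i, j)))"
  proof (intro sum_mono)
    fix i assume i: "i \<in> {..<dim_row X}"
    then have "cmod ((X *\<^sub>v v) $ i) = cmod (\<Sum>j<dim_col X. X $$ (i, j) * v $ j)"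
      using v by (simp add: scalar_prod_def atLeast0LessThan)
    also have "\<dots> \<le> (\<Sum>j<dim_col X. cmod (X $$ (i, j)))"
      using 1 i by (intro sum_norm_le) (auto simp: norm_mult mult_left_le)
    finally show "cmod ((X *\<^sub>v v) $ i) \<le> (\<Sum>j<dim_col X. cmod (X $$ (i, j)))" .
  qed
  finally show ?thesis .
qed

lemma opnorm_bdd: "bdd_above ((\<lambda>v. vnorm (X *\<^sub>v v)) ` {v \<in> carrier_vec (dim_col X). vnorm v \<le> 1})"
  by (rule bdd_aboveI2) (auto intro: vnorm_mult_bounded)

lemma vnorm_mult_le:
  assumes "v \<in> carrier_vec (dim_col X)"
  shows "vnorm (X *\<^sub>v v) \<le> opnorm X * vnorm v"
proof (cases "vnorm v = 0")
  case True
  then have "v = 0\<^sub>v (dim_col X)" using vnorm_eq_0[of v] assms by auto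
  moreover have "X *\<^sub>v 0\<^sub>v (dim_col X) = 0\<^sub>v (dim_row X)" by (intro eq_vecI) auto
  ultimately show ?thesis by simp
next
  case False
  let ?c = "complex_of_real (inverse (vnorm v))"
  have c: "cmod ?c = inverse (vnorm v)"
    by (simp only: norm_of_real) simp
  have "vnorm (X *\<^sub>v (?c \<cdot>\<^sub>v v)) \<le> opnorm X"
    unfolding opnorm_def using assms False
    by (intro cSUP_upper opnorm_bdd) (auto simp: vnorm_smult c simp del: of_real_inverse)
  moreover have "X *\<^sub>v (?c \<cdot>\<^sub>v v) = ?c \<cdot>\<^sub>v (X *\<^sub>v v)"
    using assms by (intro mult_mat_vec) auto
  ultimately have "inverse (vnorm v) * vnorm (X *\<^sub>v v) \<le> opnorm X"
    by (simp only: vnorm_smult c)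
  then show ?thesis
    using False vnorm_nonneg[of v] by (simp add: field_simps)
qed

lemma opnorm_le:
  assumes "\<And>v. v \<in> carrier_vec (dim_col X) \<Longrightarrow> vnorm (X *\<^sub>v v) \<le> c * vnorm v" "0 \<le> c"
  shows "opnorm X \<le> c"
  unfolding opnorm_def
proof (rule cSUP_least)
  have "0\<^sub>v (dim_col X) \<in> {v \<in> carrier_vec (dim_col X). vnorm v \<le> 1}"
    by simp
  then show "{v \<in> carrier_vec (dim_col X). vnorm v \<le> 1} \<noteq> {}" by blast
  fix v assume v: "v \<in> {v \<in> carrier_vec (dim_col X). vnorm v \<le> 1}"
  then have "vnorm (X *\<^sub>v v) \<le> c * vnorm v" using assms(1) by auto
  also have "\<dots> \<le> c" using v assms(2) by (auto intro: mult_left_le)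
  finally show "vnorm (X *\<^sub>v v) \<le> c" .
qed

lemma opnorm_nonneg: "0 \<le> opnorm X"
proof -
  have "vnorm (X *\<^sub>v 0\<^sub>v (dim_col X)) \<le> opnorm X"
    unfolding opnorm_def by (intro cSUP_upper opnorm_bdd) auto
  then show ?thesis using vnorm_nonneg order_trans by blast
qed

lemma opnorm_eq_0_iff:
  assumes "X \<in> carrier_mat d d"
  shows "opnorm X = 0 \<longleftrightarrow> X = 0\<^sub>m d d"
proof
  assume "opnorm X = 0"
  show "X = 0\<^sub>m d d"
  proof (rule eq_matI)
    fix i j assume "i < dim_row (0\<^sub>m d d)" "j < dim_col (0\<^sub>m d d)"
    then have ij: "i < d" "j < d" by auto
    have "vnorm (X *\<^sub>v unit_vec d j) \<le> 0"
      using vnorm_mult_le[of "unit_vec d j" X] \<open>opnorm X = 0\<close> assms by simp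
    then have "vnorm (X *\<^sub>v unit_vec d j) = 0" using vnorm_nonneg by (simp add: order_antisym)
    then have "X *\<^sub>v unit_vec d j = 0\<^sub>v d"
      using vnorm_eq_0[of "X *\<^sub>v unit_vec d j"] assms by simp
    then have "(X *\<^sub>v unit_vec d j) $ i = 0" using ij by simp
    then show "X $$ (i, j) = 0\<^sub>m d d $$ (i, j)"
      using ij assms by simp
  qed (use assms in auto)
next
  assume "X = 0\<^sub>m d d"
  moreover have "(0\<^sub>m d d :: complex mat) *\<^sub>v v = 0\<^sub>v d" if "v \<in> carrier_vec d" for v
    using that by (intro eq_vecI) auto
  ultimately have "opnorm X \<le> 0"
    by (intro opnorm_le) auto
  then show "opnorm X = 0" using opnorm_nonneg[of X] by simp
qed

lemma opnorm_triangle: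
  assumes "X \<in> carrier_mat d d" "Y \<in> carrier_mat d d"
  shows "opnorm (X + Y) \<le> opnorm X + opnorm Y"
proof (rule opnorm_le)
  fix v :: "complex vec" assume "v \<in> carrier_vec (dim_col (X + Y))"
  then have v: "v \<in> carrier_vec d" using assms by simp
  have "vnorm ((X + Y) *\<^sub>v v) \<le> vnorm (X *\<^sub>v v) + vnorm (Y *\<^sub>v v)"
    using assms v by (subst add_mult_distrib_mat_vec[OF assms v]) (rule vnorm_triangle, simp)
  also have "\<dots> \<le> opnorm X * vnorm v + opnorm Y * vnorm v"
    using assms v by (intro add_mono vnorm_mult_le) auto
  finally show "vnorm ((X + Y) *\<^sub>v v) \<le> (opnorm X + opnorm Y) * vnorm v"
    by (simp add: algebra_simps)
qed (simp add: opnorm_nonneg)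

lemma opnorm_smult:
  assumes "X \<in> carrier_mat d d"
  shows "opnorm (c \<cdot>\<^sub>m X) = cmod c * opnorm X"
proof -
  \<comment> \<open>The inequality for every scalar and every matrix suffices: applied to
    \<open>c \<cdot>\<^sub>m X\<close> with the scalar \<open>inverse c\<close> it yields the
    converse.\<close>
  have le: "opnorm (c \<cdot>\<^sub>m X) \<le> cmod c * opnorm X" if "X \<in> carrier_mat d d" for c X
  proof (rule opnorm_le)
    fix v :: "complex vec" assume "v \<in> carrier_vec (dim_col (c \<cdot>\<^sub>m X))"
    then have v: "v \<in> carrier_vec d" using that by simp
    have "(c \<cdot>\<^sub>m X) *\<^sub>v v = c \<cdot>\<^sub>v (X *\<^sub>v v)"
      using that v by (intro eq_vecI) auto
    then have "vnorm ((c \<cdot>\<^sub>m X) *\<^sub>v v) = cmod c * vnorm (X *\<^sub>v v)"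
      by (simp add: vnorm_smult)
    also have "\<dots> \<le> cmod c * (opnorm X * vnorm v)"
      using v that by (intro mult_left_mono vnorm_mult_le) auto
    finally show "vnorm ((c \<cdot>\<^sub>m X) *\<^sub>v v) \<le> cmod c * opnorm X * vnorm v" by simp
  qed (simp add: opnorm_nonneg)
  show ?thesis
  proof (cases "c = 0")
    case True
    then show ?thesis using le[OF assms, of 0] opnorm_nonneg[of "0 \<cdot>\<^sub>m X"] by simp
  next
    case False
    have "inverse c \<cdot>\<^sub>m (c \<cdot>\<^sub>m X) = X" using assms False by (intro eq_matI) auto
    then have "opnorm X \<le> inverse (cmod c) * opnorm (c \<cdot>\<^sub>m X)"
      using le[of "c \<cdot>\<^sub>m X" "inverse c"] assms by (simp add: norm_inverse)
    then show ?thesis using le[OF assms, of c] False by (simp add: field_simps)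
  qed
qed

lemma opnorm_mult:
  assumes "X \<in> carrier_mat d d" "Y \<in> carrier_mat d d"
  shows "opnorm (X * Y) \<le> opnorm X * opnorm Y"
proof (rule opnorm_le)
  fix v :: "complex vec" assume "v \<in> carrier_vec (dim_col (X * Y))"
  then have v: "v \<in> carrier_vec d" using assms by simp
  have "vnorm ((X * Y) *\<^sub>v v) \<le> opnorm X * vnorm (Y *\<^sub>v v)"
    using assms v by (subst assoc_mult_mat_vec[OF assms v]) (rule vnorm_mult_le, auto)
  also have "\<dots> \<le> opnorm X * (opnorm Y * vnorm v)"
    using assms v by (intro mult_left_mono vnorm_mult_le opnorm_nonneg) auto
  finally show "vnorm ((X * Y) *\<^sub>v v) \<le> opnorm X * opnorm Y * vnorm v" by simp
qed (simp add: opnorm_nonneg)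

lemma cscalar_prod_adjoint:
  fixes X :: "complex mat"
  assumes X: "X \<in> carrier_mat m n" and v: "v \<in> carrier_vec m" and w: "w \<in> carrier_vec n"
  shows "(mat_adjoint X *\<^sub>v v) \<bullet>c w = v \<bullet>c (X *\<^sub>v w)"
proof -
  have "(mat_adjoint X *\<^sub>v v) \<bullet>c w = (\<Sum>i<n. \<Sum>j<m. cnj (X $$ (j, i)) * v $ j * cnj (w $ i))"
    using assms by (simp add: cscalar_prod_sum) (simp add: scalar_prod_def atLeast0LessThan sum_distrib_right)
  also have "\<dots> = (\<Sum>j<m. \<Sum>i<n. cnj (X $$ (j, i)) * v $ j * cnj (w $ i))"
    by (rule sum.swap)
  also have "\<dots> = v \<bullet>c (X *\<^sub>v w)"
    using assms by (simp add: cscalar_prod_sum)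
      (simp add: scalar_prod_def atLeast0LessThan sum_distrib_left algebra_simps)
  finally show ?thesis .
qed

text \<open>Cauchy-Schwarz for the inner product of \<open>(mat_adjoint Y * Y) *\<^sub>v v\<close>
  with \<open>v\<close> gives \<open>ge\<close>. Together with submultiplicativity it bounds the
  norm of \<open>Y\<close> by that of its adjoint; exchanging the two shows that both norms agree,
  and submultiplicativity then gives the other inequality.\<close>

lemma opnorm_cstar:
  assumes X: "X \<in> carrier_mat d d"
  shows "opnorm (mat_adjoint X * X) = (opnorm X)\<^sup>2"
proof -
  have ge: "(opnorm Y)\<^sup>2 \<le> opnorm (mat_adjoint Y * Y)" if Y: "Y \<in> carrier_mat d d" for Y
  proof -
    have "opnorm Y \<le> sqrt (opnorm (mat_adjoint Y * Y))"
    proof (rule opnorm_le)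
      fix v :: "complex vec" assume "v \<in> carrier_vec (dim_col Y)"
      then have v: "v \<in> carrier_vec d" using Y by simp
      have "complex_of_real ((vnorm (Y *\<^sub>v v))\<^sup>2) = ((mat_adjoint Y * Y) *\<^sub>v v) \<bullet>c v"
        using Y v by (subst assoc_mult_mat_vec[of _ d d _ d])
          (auto simp: cscalar_prod_self cscalar_prod_adjoint[OF Y _ v])
      then have "(vnorm (Y *\<^sub>v v))\<^sup>2 = cmod (((mat_adjoint Y * Y) *\<^sub>v v) \<bullet>c v)"
        by (metis norm_of_real abs_power2)
      also have "\<dots> \<le> vnorm ((mat_adjoint Y * Y) *\<^sub>v v) * vnorm v"
        using Y v by (intro cscalar_prod_le) auto
      also have "\<dots> \<le> (opnorm (mat_adjoint Y * Y) * vnorm v) * vnorm v"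
        using Y v by (intro mult_right_mono vnorm_mult_le) auto
      finally have "(vnorm (Y *\<^sub>v v))\<^sup>2 \<le> (sqrt (opnorm (mat_adjoint Y * Y)) * vnorm v)\<^sup>2"
        by (simp add: power_mult_distrib opnorm_nonneg) (simp add: power2_eq_square)
      then show "vnorm (Y *\<^sub>v v) \<le> sqrt (opnorm (mat_adjoint Y * Y)) * vnorm v"
        by (rule power2_le_imp_le) (simp add: opnorm_nonneg)
    qed (simp add: opnorm_nonneg)
    then have "(opnorm Y)\<^sup>2 \<le> (sqrt (opnorm (mat_adjoint Y * Y)))\<^sup>2"
      by (intro power_mono opnorm_nonneg)
    then show ?thesis by (simp add: opnorm_nonneg)
  qed
  have le: "opnorm Y \<le> opnorm (mat_adjoint Y)" if Y: "Y \<in> carrier_mat d d" for Y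
  proof (cases "opnorm Y = 0")
    case False
    have "opnorm Y * opnorm Y \<le> opnorm (mat_adjoint Y) * opnorm Y"
      using ge[OF Y] opnorm_mult[of "mat_adjoint Y" d Y] Y by (simp add: power2_eq_square)
    then show ?thesis using False opnorm_nonneg[of Y] by simp
  qed (simp add: opnorm_nonneg)
  have "opnorm (mat_adjoint X) = opnorm X"
    using le[OF X] le[of "mat_adjoint X"] X by simp
  then show ?thesis
    using ge[OF X] opnorm_mult[of "mat_adjoint X" d X] X by (simp add: power2_eq_square)
qed

section \<open>*-algebras of matrices as abstract C*-algebras\<close>

lemma matrix_algebra_simps [simp]:
  "carrier (matrix_algebra d S) = S" "azero (matrix_algebra d S) = 0\<^sub>m d d"
  "aadd (matrix_algebra d S) = (+)" "ascale (matrix_algebra d S) = (\<cdot>\<^sub>m)"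
  "amult (matrix_algebra d S) = (*)" "astar (matrix_algebra d S) = mat_adjoint"
  by (simp_all add: matrix_algebra_def)

lemma star_subalgebraD:
  assumes "star_subalgebra d S"
  shows "S \<subseteq> carrier_mat d d" "0\<^sub>m d d \<in> S" "S \<noteq> {0\<^sub>m d d}"
    "X \<in> S \<Longrightarrow> Y \<in> S \<Longrightarrow> X + Y \<in> S" "X \<in> S \<Longrightarrow> Y \<in> S \<Longrightarrow> X * Y \<in> S"
    "X \<in> S \<Longrightarrow> c \<cdot>\<^sub>m X \<in> S" "X \<in> S \<Longrightarrow> mat_adjoint X \<in> S"
  using assms unfolding star_subalgebra_def by blast+

lemma star_algebra_matrix_algebra:
  assumes S: "star_subalgebra d S"
  shows "star_algebra (matrix_algebra d S)"
proof -
  note D = star_subalgebraD[OF S]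
  have c: "X \<in> carrier_mat d d" if "X \<in> S" for X using D(1) that by blast
  show ?thesis
    apply unfold_locales
                        apply (simp_all add: D(2,4-7) mat_adjoint_smult mat_adjoint_add[OF c c] mat_adjoint_mult[OF c c]
          add_mult_distrib_mat[OF c c c] mult_add_distrib_mat[OF c c c] assoc_mult_mat[OF c c c]
          assoc_add_mat[OF c c c] mult_smult_distrib[OF c c] mult_smult_assoc_mat[OF c c]
          add_smult_distrib_left_mat[OF c c] add_smult_distrib_right_mat[OF c] left_add_zero_mat[OF c])
    by (use c comm_add_mat in blast) (auto intro!: eq_matI dest!: c)
qed

text \<open>Eliminating one matrix position at a time, as in the reduction to row echelon form.\<close>

lemma subspace_finite_span:
  assumes "finite P" and "\<And>X. X \<in> S \<Longrightarrow> X \<in> carrier_mat d d"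
    and "0\<^sub>m d d \<in> S" and "\<And>X Y. X \<in> S \<Longrightarrow> Y \<in> S \<Longrightarrow> X + Y \<in> S" and "\<And>c X. X \<in> S \<Longrightarrow> c \<cdot>\<^sub>m X \<in> S"
    and "\<And>X p. X \<in> S \<Longrightarrow> p \<in> {..<d} \<times> {..<d} - P \<Longrightarrow> X $$ p = 0"
  shows "\<exists>B. finite B \<and> B \<subseteq> S \<and> S \<subseteq> lin_span (matrix_algebra d U) B"
  using assms
proof (induction P arbitrary: S)
  case empty
  have "X = 0\<^sub>m d d" if "X \<in> S" for X
    using empty(1)[OF that] empty(5)[OF that] by (intro eq_matI) auto
  then show ?case
    using lin_span.span_zero[of "matrix_algebra d U" "{}"] by (intro exI[of _ "{}"]) auto
next
  case (insert p P)
  \<comment> \<open>\<open>P\<close> is an arbitrary finite set, so a position outside the square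
    imposes no condition.\<close>
  let ?S = "{X \<in> S. p \<in> {..<d} \<times> {..<d} \<longrightarrow> X $$ p = 0}"
  have "\<exists>B. finite B \<and> B \<subseteq> ?S \<and> ?S \<subseteq> lin_span (matrix_algebra d U) B"
  proof (rule insert.IH)
    show "\<And>X p. X \<in> ?S \<Longrightarrow> p \<in> {..<d} \<times> {..<d} - P \<Longrightarrow> X $$ p = 0"
      using insert.prems(5) by blast
    show "X + Y \<in> ?S" if "X \<in> ?S" "Y \<in> ?S" for X Y
      using that insert.prems(1)[of X] insert.prems(1)[of Y] insert.prems(3) by auto
    show "c \<cdot>\<^sub>m X \<in> ?S" if "X \<in> ?S" for X c
      using that insert.prems(1)[of X] insert.prems(4) by auto
  qed (use insert.prems in auto)
  then obtain B where B: "finite B" "B \<subseteq> ?S" "?S \<subseteq> lin_span (matrix_algebra d U) B" by blast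
  show ?case
  proof (cases "S \<subseteq> ?S")
    case True
    then show ?thesis using B by blast
  next
    case False
    then obtain X0 where X0: "X0 \<in> S" "p \<in> {..<d} \<times> {..<d}" "X0 $$ p \<noteq> 0" by blast
    have mono: "Y \<in> lin_span (matrix_algebra d U) (insert X0 B)" if "Y \<in> lin_span (matrix_algebra d U) B" for Y
      using that by induction (blast intro: lin_span.intros)+
    have "X \<in> lin_span (matrix_algebra d U) (insert X0 B)" if X: "X \<in> S" for X
    proof -
      let ?c = "X $$ p / X0 $$ p"
      \<comment> \<open>The entry at the pivot position \<open>p\<close> is cleared with
        \<open>X0\<close>, which puts the remainder into \<open>?S\<close>.\<close>
      let ?Y = "X + (- ?c) \<cdot>\<^sub>m X0"
      note cX = insert.prems(1)[OF X] and cX0 = insert.prems(1)[OF X0(1)]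
      have "?Y $$ p = 0" using X0 cX cX0 by (cases p) auto
      then have "?Y \<in> ?S" using X X0 insert.prems(3,4) by auto
      then have "?Y \<in> lin_span (matrix_algebra d U) (insert X0 B)"
        using B(3) mono by blast
      then have "?c \<cdot>\<^sub>m X0 + ?Y \<in> lin_span (matrix_algebra d U) (insert X0 B)"
        using lin_span.span_step[of X0 "insert X0 B" ?Y "matrix_algebra d U" ?c] by simp
      moreover have "?c \<cdot>\<^sub>m X0 + ?Y = X" using cX cX0 by (intro eq_matI) auto
      ultimately show ?thesis by simp
    qed
    then show ?thesis using B X0 by (intro exI[of _ "insert X0 B"]) auto
  qed
qed

text \<open>Makes a correctable matrix algebra an admissible competitor in
  \<open>maximal_transmittable\<close>: transmittable algebras have to be C*-algebras, and here the
  C*-norm is the operator norm.\<close>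

lemma fd_cstar_matrix_algebra:
  assumes S: "star_subalgebra d S"
  shows "fd_cstar_algebra (matrix_algebra d S)"
proof -
  note D = star_subalgebraD[OF S]
  have c: "X \<in> carrier_mat d d" if "X \<in> S" for X using D(1) that by blast
  have "\<exists>B. finite B \<and> B \<subseteq> S \<and> S \<subseteq> lin_span (matrix_algebra d S) B"
    using D by (intro subspace_finite_span[of "{..<d} \<times> {..<d}"]) (auto simp: c)
  then obtain B where B: "finite B" "B \<subseteq> S" "S \<subseteq> lin_span (matrix_algebra d S) B" by blast
  have "X \<in> S" if "X \<in> lin_span (matrix_algebra d S) B" for X
    using that B(2) by induction (auto intro: D)
  moreover have "cstar_norm (matrix_algebra d S) opnorm"
    unfolding cstar_norm_def
    by (simp add: c D opnorm_nonneg opnorm_eq_0_iff[of _ d] opnorm_triangle[of _ d] opnorm_smult[of _ d]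
        opnorm_mult[of _ d] opnorm_cstar[of _ d])
  moreover have "lin_span (matrix_algebra d S) B = S"
    using calculation(1) B(3) by blast
  ultimately show ?thesis
    using B(1,2) D(3) star_algebra_matrix_algebra[OF S]
    unfolding fd_cstar_algebra_def fd_cstar_algebra_axioms_def matrix_algebra_simps by metis
qed

section \<open>Tensor products of channels\<close>

text \<open>Positivity over an arbitrary finite index set, so that tensor factors can be permuted by
  reindexing.\<close>

definition psd_form :: "'i set \<Rightarrow> ('i \<Rightarrow> 'i \<Rightarrow> complex) \<Rightarrow> bool" where
  "psd_form I x \<longleftrightarrow> (\<forall>f. 0 \<le> (\<Sum>i\<in>I. \<Sum>j\<in>I. x i j * f j * cnj (f i)))"

lemma psd_form_cong:
  "(\<And>i j. i \<in> I \<Longrightarrow> j \<in> I \<Longrightarrow> x i j = y i j) \<Longrightarrow> psd_form I x \<longleftrightarrow> psd_form I y"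
  unfolding psd_form_def by (simp cong: sum.cong)

lemma psd_form_reindex:
  assumes h: "bij_betw h J I"
  shows "psd_form J (\<lambda>i j. x (h i) (h j)) \<longleftrightarrow> psd_form I x"
proof -
  have sum: "(\<Sum>i\<in>I. \<Sum>j\<in>I. x i j * f j * cnj (f i))
      = (\<Sum>i\<in>J. \<Sum>j\<in>J. x (h i) (h j) * f (h j) * cnj (f (h i)))" for f
    by (simp add: sum.reindex_bij_betw[OF h, symmetric])
  show ?thesis
  proof
    assume L: "psd_form J (\<lambda>i j. x (h i) (h j))"
    show "psd_form I x"
      unfolding psd_form_def
    proof
      fix f :: "_ \<Rightarrow> complex"
      show "0 \<le> (\<Sum>i\<in>I. \<Sum>j\<in>I. x i j * f j * cnj (f i))"
        unfolding sum using L[unfolded psd_form_def, rule_format, of "\<lambda>i. f (h i)"] by simp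
    qed
  next
    assume R: "psd_form I x"
    show "psd_form J (\<lambda>i j. x (h i) (h j))"
      unfolding psd_form_def
    proof
      fix f :: "_ \<Rightarrow> complex"
      \<comment> \<open>The test vector \<open>f\<close> is prescribed on \<open>J\<close>; it is
        transported to \<open>I\<close> along the inverse of \<open>h\<close>.\<close>
      have "f j = f (inv_into J h (h j))" if "j \<in> J" for j
        using h that by (simp add: bij_betw_inv_into_left)
      then have "(\<Sum>i\<in>J. \<Sum>j\<in>J. x (h i) (h j) * f j * cnj (f i))
        = (\<Sum>i\<in>I. \<Sum>j\<in>I. x i j * f (inv_into J h j) * cnj (f (inv_into J h i)))"
        unfolding sum by (intro sum.cong refl) (metis (no_types))
      then show "0 \<le> (\<Sum>i\<in>J. \<Sum>j\<in>J. x (h i) (h j) * f j * cnj (f i))"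
        using R by (simp add: psd_form_def)
    qed
  qed
qed

lemma psd_iff_psd_form:
  "psd n X \<longleftrightarrow> X \<in> carrier_mat n n \<and> psd_form {..<n} (\<lambda>i j. X $$ (i, j))"
proof (cases "X \<in> carrier_mat n n")
  case True
  have form: "(X *\<^sub>v v) \<bullet>c v = (\<Sum>i<n. \<Sum>j<n. X $$ (i, j) * v $ j * cnj (v $ i))"
    if "v \<in> carrier_vec n" for v
    using that True
    by (simp add: cscalar_prod_sum) (simp add: scalar_prod_def atLeast0LessThan sum_distrib_right)
  have "psd_form {..<n} (\<lambda>i j. X $$ (i, j))" if "psd n X"
    unfolding psd_form_def
  proof
    fix f :: "_ \<Rightarrow> complex"
    have "0 \<le> (X *\<^sub>v vec n f) \<bullet>c vec n f"
      using that by (simp only: psd_def) simp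
    also have "\<dots> = (\<Sum>i<n. \<Sum>j<n. X $$ (i, j) * f j * cnj (f i))"
      by (subst form) simp_all
    finally show "0 \<le> (\<Sum>i<n. \<Sum>j<n. X $$ (i, j) * f j * cnj (f i))" .
  qed
  moreover have "psd n X" if "psd_form {..<n} (\<lambda>i j. X $$ (i, j))"
    unfolding psd_def
  proof (intro conjI ballI True)
    fix v :: "complex vec" assume "v \<in> carrier_vec n"
    then show "0 \<le> (X *\<^sub>v v) \<bullet>c v"
      using that[unfolded psd_form_def, rule_format, of "\<lambda>i. v $ i"] by (simp add: form)
  qed
  ultimately show ?thesis using True by blast
qed (simp add: psd_def)

section \<open>Linear maps between matrix spaces and their tensor products\<close>

lemma linear_mapD:
  assumes "linear_map d k \<Phi>"
  shows "X \<in> carrier_mat d d \<Longrightarrow> \<Phi> X \<in> carrier_mat k k"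
    "X \<in> carrier_mat d d \<Longrightarrow> Y \<in> carrier_mat d d \<Longrightarrow> \<Phi> (X + Y) = \<Phi> X + \<Phi> Y"
    "X \<in> carrier_mat d d \<Longrightarrow> \<Phi> (c \<cdot>\<^sub>m X) = c \<cdot>\<^sub>m \<Phi> X"
  using assms by (auto simp: linear_map_def)

lemma linear_map_zero:
  assumes "linear_map d k \<Phi>"
  shows "\<Phi> (0\<^sub>m d d) = 0\<^sub>m k k"
proof -
  have "\<Phi> (0 \<cdot>\<^sub>m 0\<^sub>m d d) = 0 \<cdot>\<^sub>m \<Phi> (0\<^sub>m d d)"
    by (rule linear_mapD(3)[OF assms]) simp
  also have "\<dots> = 0\<^sub>m k k"
    using linear_mapD(1)[OF assms, of "0\<^sub>m d d"] by (intro eq_matI) auto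
  finally show ?thesis by simp
qed

lemma linear_map_id: "linear_map d d (\<lambda>Y. Y)"
  by (simp add: linear_map_def)

lemma linear_map_eqI_kron:
  assumes F: "linear_map (m * n) k F" and G: "linear_map (m * n) k G"
    and eq: "\<And>A B. A \<in> carrier_mat m m \<Longrightarrow> B \<in> carrier_mat n n \<Longrightarrow> F (kron A B) = G (kron A B)"
    and X: "X \<in> carrier_mat (m * n) (m * n)"
  shows "F X = G X"
  using X
  by (induction rule: kron_induct)
    (simp_all add: eq linear_map_zero[OF F] linear_map_zero[OF G] linear_mapD[OF F] linear_mapD[OF G])

lemma tensor_map_carrier [simp, intro]:
  "tensor_map d\<^sub>1 k\<^sub>1 \<Phi> d\<^sub>2 k\<^sub>2 \<Psi> Z \<in> carrier_mat (k\<^sub>1 * k\<^sub>2) (k\<^sub>1 * k\<^sub>2)"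
  by (simp add: tensor_map_def)

text \<open>By definition \<open>tensor_map\<close> is a combination of fixed matrices with entries
  of \<open>Z\<close> as coefficients, so it is linear whatever \<open>\<Phi>\<close> and
  \<open>\<Psi>\<close> are.\<close>

lemma linear_map_tensor: "linear_map (d\<^sub>1 * d\<^sub>2) (k\<^sub>1 * k\<^sub>2) (tensor_map d\<^sub>1 k\<^sub>1 \<Phi> d\<^sub>2 k\<^sub>2 \<Psi>)"
proof -
  have "tensor_map d\<^sub>1 k\<^sub>1 \<Phi> d\<^sub>2 k\<^sub>2 \<Psi> (X + Y)
      = tensor_map d\<^sub>1 k\<^sub>1 \<Phi> d\<^sub>2 k\<^sub>2 \<Psi> X + tensor_map d\<^sub>1 k\<^sub>1 \<Phi> d\<^sub>2 k\<^sub>2 \<Psi> Y"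
    if "X \<in> carrier_mat (d\<^sub>1 * d\<^sub>2) (d\<^sub>1 * d\<^sub>2)" "Y \<in> carrier_mat (d\<^sub>1 * d\<^sub>2) (d\<^sub>1 * d\<^sub>2)" for X Y
    using that by (intro eq_matI)
      (simp_all add: tensor_map_def pair_index_less distrib_right sum.distrib cong: sum.cong_simp)
  moreover have "tensor_map d\<^sub>1 k\<^sub>1 \<Phi> d\<^sub>2 k\<^sub>2 \<Psi> (c \<cdot>\<^sub>m X) = c \<cdot>\<^sub>m tensor_map d\<^sub>1 k\<^sub>1 \<Phi> d\<^sub>2 k\<^sub>2 \<Psi> X"
    if "X \<in> carrier_mat (d\<^sub>1 * d\<^sub>2) (d\<^sub>1 * d\<^sub>2)" for X c
    using that by (intro eq_matI)
      (simp_all add: tensor_map_def pair_index_less sum_distrib_left mult.assoc cong: sum.cong_simp)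
  ultimately show ?thesis by (simp add: linear_map_def)
qed

lemma index_tensor_map:
  assumes L: "linear_map d\<^sub>1 k\<^sub>1 \<Phi>" "linear_map d\<^sub>2 k\<^sub>2 \<Psi>"
    and ij: "i < k\<^sub>1" "i' < k\<^sub>2" "j < k\<^sub>1" "j' < k\<^sub>2"
  shows "tensor_map d\<^sub>1 k\<^sub>1 \<Phi> d\<^sub>2 k\<^sub>2 \<Psi> Z $$ (i * k\<^sub>2 + i', j * k\<^sub>2 + j')
    = (\<Sum>a<d\<^sub>1. \<Sum>b<d\<^sub>1. \<Sum>c<d\<^sub>2. \<Sum>e<d\<^sub>2. Z $$ (a * d\<^sub>2 + c, b * d\<^sub>2 + e) *
        (\<Phi> (mat_unit d\<^sub>1 a b) $$ (i, j) * \<Psi> (mat_unit d\<^sub>2 c e) $$ (i', j')))"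
  using ij by (simp add: tensor_map_def pair_index_less
      index_kron[OF linear_mapD(1)[OF L(1) mat_unit_carrier] linear_mapD(1)[OF L(2) mat_unit_carrier]])

section \<open>Complete positivity of tensor products\<close>

text \<open>The identity on an ancilla tensored with \<open>\<Phi>\<close>, with (ancilla, system)
  indices kept as pairs. The ancilla index has an arbitrary type, so it can itself be a pair that
  contains another tensor factor.\<close>

definition ampliation ::
    "nat \<Rightarrow> (complex mat \<Rightarrow> complex mat) \<Rightarrow> ('i \<times> nat \<Rightarrow> 'i \<times> nat \<Rightarrow> complex) \<Rightarrow> 'i \<times> nat \<Rightarrow> 'i \<times> nat \<Rightarrow> complex"
  where "ampliation d \<Phi> x p q =
    (\<Sum>c<d. \<Sum>e<d. x (fst p, c) (fst q, e) * \<Phi> (mat_unit d c e) $$ (snd p, snd q))"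

lemma index_ampliation:
  assumes L: "linear_map d k \<Phi>"
    and "a < m" "b < m" "i < k" "j < k"
  shows "tensor_map m m (\<lambda>Y. Y) d k \<Phi> X $$ (a * k + i, b * k + j)
    = ampliation d \<Phi> (\<lambda>(a, c) (b, e). X $$ (a * d + c, b * d + e)) (a, i) (b, j)"
proof -
  let ?f = "\<lambda>a' b'. \<Sum>c<d. \<Sum>e<d. X $$ (a' * d + c, b' * d + e) * \<Phi> (mat_unit d c e) $$ (i, j)"
  have "tensor_map m m (\<lambda>Y. Y) d k \<Phi> X $$ (a * k + i, b * k + j)
    = (\<Sum>a'<m. \<Sum>b'<m. \<Sum>c<d. \<Sum>e<d. X $$ (a' * d + c, b' * d + e) *
        (mat_unit m a' b' $$ (a, b) * \<Phi> (mat_unit d c e) $$ (i, j)))"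
    by (rule index_tensor_map[OF linear_map_id L assms(2,4,3,5)])
  also have "\<dots> = (\<Sum>a'<m. \<Sum>b'<m. if b' = b then if a' = a then ?f a b else 0 else 0)"
    using assms(2-) by (intro sum.cong refl) auto
  also have "\<dots> = ?f a b"
    using assms(2-) by simp
  finally show ?thesis by (simp add: ampliation_def)
qed

lemma bij_betw_map_prod_left: "bij_betw h J I \<Longrightarrow> bij_betw (\<lambda>(a, c). (h a, c)) (J \<times> K) (I \<times> K)"
  by (auto simp: bij_betw_def inj_on_def image_iff)

lemma bij_betw_map_prod_right: "bij_betw h J I \<Longrightarrow> bij_betw (\<lambda>(c, a). (c, h a)) (K \<times> J) (K \<times> I)"
  by (auto simp: bij_betw_def inj_on_def image_iff)

text \<open>Enumerating \<open>I\<close> by \<open>h\<close> reduces an arbitrary finite ancilla to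
  the ancilla \<open>{..<m}\<close> in \<open>completely_positive\<close>.\<close>

lemma psd_form_ampliation:
  assumes cp: "completely_positive d k \<Phi>" and L: "linear_map d k \<Phi>"
    and I: "finite I" and x: "psd_form (I \<times> {..<d}) x"
  shows "psd_form (I \<times> {..<k}) (ampliation d \<Phi> x)"
proof -
  let ?m = "card I"
  obtain h where h: "bij_betw h {..<?m} I"
    using ex_bij_betw_nat_finite[OF I] by (auto simp: atLeast0LessThan)
  let ?y = "\<lambda>p q. x (h (fst p), snd p) (h (fst q), snd q)"
  define X where "X = mat (?m * d) (?m * d) (\<lambda>(p, q). ?y (p div d, p mod d) (q div d, q mod d))"
  have X: "X $$ (a * d + c, b * d + e) = ?y (a, c) (b, e)"
    if "a < ?m" "b < ?m" "c < d" "e < d" for a b c e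
    using that by (simp add: X_def pair_index_less)
  have X_carrier: "X \<in> carrier_mat (?m * d) (?m * d)" by (simp add: X_def)
  have "psd_form ({..<?m} \<times> {..<d}) ?y"
    using x psd_form_reindex[OF bij_betw_map_prod_left[OF h], of "{..<d}" x] by (simp add: case_prod_unfold)
  then have "psd_form ({..<?m} \<times> {..<d}) (\<lambda>p q. X $$ (case p of (a, c) \<Rightarrow> a * d + c, case q of (a, c) \<Rightarrow> a * d + c))"
    by (rule psd_form_cong[THEN iffD1, rotated]) (auto simp: X)
  then have "psd_form {..<?m * d} (\<lambda>i j. X $$ (i, j))"
    by (subst (asm) psd_form_reindex[OF bij_betw_pair_index, where x = "\<lambda>i j. X $$ (i, j)"])
  then have "psd (?m * d) X"
    by (simp add: psd_iff_psd_form X_carrier)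
  then have "psd (?m * k) (tensor_map ?m ?m (\<lambda>Y. Y) d k \<Phi> X)"
    using cp unfolding completely_positive_def by blast
  then have "psd_form {..<?m * k} (\<lambda>i j. tensor_map ?m ?m (\<lambda>Y. Y) d k \<Phi> X $$ (i, j))"
    by (simp only: psd_iff_psd_form)
  then have "psd_form ({..<?m} \<times> {..<k}) (\<lambda>p q. tensor_map ?m ?m (\<lambda>Y. Y) d k \<Phi> X $$
      (case p of (a, c) \<Rightarrow> a * k + c, case q of (a, c) \<Rightarrow> a * k + c))"
    by (subst psd_form_reindex[OF bij_betw_pair_index, where x = "\<lambda>i j. tensor_map ?m ?m (\<lambda>Y. Y) d k \<Phi> X $$ (i, j)"])
  also have "?this \<longleftrightarrow> psd_form ({..<?m} \<times> {..<k})
      (\<lambda>p q. ampliation d \<Phi> x (case p of (a, c) \<Rightarrow> (h a, c)) (case q of (a, c) \<Rightarrow> (h a, c)))"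
    by (intro psd_form_cong) (auto simp: index_ampliation[OF L] ampliation_def X intro!: sum.cong)
  finally show ?thesis
    by (subst (asm) psd_form_reindex[OF bij_betw_map_prod_left[OF h]])
qed

text \<open>The two maps act one after the other: \<open>\<Phi>\<close> with the ancilla enlarged by
  the input factor of \<open>\<Psi>\<close>, and \<open>\<Psi>\<close> with the ancilla enlarged by
  the output factor of \<open>\<Phi>\<close>. Each action preserves positivity by
  \<open>psd_form_ampliation\<close>.\<close>

lemma completely_positive_tensor:
  assumes cp1: "completely_positive d\<^sub>1 k\<^sub>1 \<Phi>" and L1: "linear_map d\<^sub>1 k\<^sub>1 \<Phi>"
    and cp2: "completely_positive d\<^sub>2 k\<^sub>2 \<Psi>" and L2: "linear_map d\<^sub>2 k\<^sub>2 \<Psi>"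
  shows "completely_positive (d\<^sub>1 * d\<^sub>2) (k\<^sub>1 * k\<^sub>2) (tensor_map d\<^sub>1 k\<^sub>1 \<Phi> d\<^sub>2 k\<^sub>2 \<Psi>)"
  unfolding completely_positive_def
proof (intro allI impI)
  fix m X
  assume "psd (m * (d\<^sub>1 * d\<^sub>2)) X"
  let ?T = "tensor_map m m (\<lambda>Y. Y) (d\<^sub>1 * d\<^sub>2) (k\<^sub>1 * k\<^sub>2) (tensor_map d\<^sub>1 k\<^sub>1 \<Phi> d\<^sub>2 k\<^sub>2 \<Psi>) X"
  \<comment> \<open>\<open>g d e\<close> numbers a triple (ancilla, first factor, second factor) as
    the nested tensor product does; \<open>s\<close> exchanges the two factors, so that the one
    acted on comes last.\<close>
  define g where "g d e = (\<lambda>((a :: nat, i :: nat), j :: nat). a * (d * e) + (i * e + j))" for d e :: nat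
  define s where "s = (\<lambda>((a :: nat, i :: nat), j :: nat). ((a, j), i))"
  have g: "bij_betw (g d e) (({..<m} \<times> {..<d}) \<times> {..<e}) {..<m * (d * e)}" for d e
  proof -
    have "bij_betw ((\<lambda>(a, c). a * (d * e) + c) \<circ> ((\<lambda>(c, a). (c, (\<lambda>(i, j). i * e + j) a)) \<circ> (\<lambda>((a, i), j). (a, (i, j)))))
      (({..<m} \<times> {..<d}) \<times> {..<e}) {..<m * (d * e)}"
    proof (rule bij_betw_trans[OF bij_betw_trans bij_betw_pair_index])
      show "bij_betw (\<lambda>((a, i), j). (a, (i, j))) (({..<m} \<times> {..<d}) \<times> {..<e}) ({..<m} \<times> ({..<d} \<times> {..<e}))"
        by (auto simp: bij_betw_def inj_on_def image_iff)
      show "bij_betw (\<lambda>(c, a). (c, (\<lambda>(i, j). i * e + j) a)) ({..<m} \<times> ({..<d} \<times> {..<e})) ({..<m} \<times> {..<d * e})"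
        by (rule bij_betw_map_prod_right[OF bij_betw_pair_index])
    qed
    then show ?thesis by (simp add: g_def comp_def case_prod_unfold)
  qed
  have s: "bij_betw s ((A \<times> B) \<times> C) ((A \<times> C) \<times> B)" for A B C
    by (auto simp: s_def bij_betw_def inj_on_def image_iff)
  let ?x0 = "\<lambda>p q. X $$ (g d\<^sub>1 d\<^sub>2 (s p), g d\<^sub>1 d\<^sub>2 (s q))"
  let ?x1 = "ampliation d\<^sub>1 \<Phi> ?x0"
  let ?x2 = "\<lambda>p q. ?x1 (s p) (s q)"
  let ?x3 = "ampliation d\<^sub>2 \<Psi> ?x2"
  have "psd_form {..<m * (d\<^sub>1 * d\<^sub>2)} (\<lambda>i j. X $$ (i, j))"
    using \<open>psd _ X\<close> by (simp add: psd_iff_psd_form)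
  then have "psd_form (({..<m} \<times> {..<d\<^sub>2}) \<times> {..<d\<^sub>1}) ?x0"
    using psd_form_reindex[OF bij_betw_trans[OF s g], where x = "\<lambda>i j. X $$ (i, j)"] by (simp add: comp_def)
  then have "psd_form (({..<m} \<times> {..<d\<^sub>2}) \<times> {..<k\<^sub>1}) ?x1"
    by (intro psd_form_ampliation cp1 L1) auto
  then have "psd_form (({..<m} \<times> {..<k\<^sub>1}) \<times> {..<d\<^sub>2}) ?x2"
    by (subst psd_form_reindex[OF s])
  then have "psd_form (({..<m} \<times> {..<k\<^sub>1}) \<times> {..<k\<^sub>2}) ?x3"
    by (intro psd_form_ampliation cp2 L2) auto
  moreover have "?x3 ((a, i), i') ((b, j), j') = ?T $$ (g k\<^sub>1 k\<^sub>2 ((a, i), i'), g k\<^sub>1 k\<^sub>2 ((b, j), j'))"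
    if ij: "a < m" "b < m" "i < k\<^sub>1" "j < k\<^sub>1" "i' < k\<^sub>2" "j' < k\<^sub>2" for a b i j i' j'
  proof -
    let ?t = "\<lambda>c c' e e'. X $$ (a * (d\<^sub>1 * d\<^sub>2) + (c * d\<^sub>2 + c'), b * (d\<^sub>1 * d\<^sub>2) + (e * d\<^sub>2 + e')) *
       (\<Phi> (mat_unit d\<^sub>1 c e) $$ (i, j) * \<Psi> (mat_unit d\<^sub>2 c' e') $$ (i', j'))"
    have U: "tensor_map d\<^sub>1 k\<^sub>1 \<Phi> d\<^sub>2 k\<^sub>2 \<Psi> (mat_unit (d\<^sub>1 * d\<^sub>2) (c * d\<^sub>2 + c') (e * d\<^sub>2 + e')) $$ (i * k\<^sub>2 + i', j * k\<^sub>2 + j')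
      = \<Phi> (mat_unit d\<^sub>1 c e) $$ (i, j) * \<Psi> (mat_unit d\<^sub>2 c' e') $$ (i', j')"
      if "c < d\<^sub>1" "e < d\<^sub>1" "c' < d\<^sub>2" "e' < d\<^sub>2" for c c' e e'
    proof -
      let ?v = "\<Phi> (mat_unit d\<^sub>1 c e) $$ (i, j) * \<Psi> (mat_unit d\<^sub>2 c' e') $$ (i', j')"
      \<comment> \<open>A matrix unit leaves a single term. The test on the innermost summation
        index is the outermost conditional, so the four sums collapse from the inside out.\<close>
      have "tensor_map d\<^sub>1 k\<^sub>1 \<Phi> d\<^sub>2 k\<^sub>2 \<Psi> (mat_unit (d\<^sub>1 * d\<^sub>2) (c * d\<^sub>2 + c') (e * d\<^sub>2 + e')) $$ (i * k\<^sub>2 + i', j * k\<^sub>2 + j')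
        = (\<Sum>x<d\<^sub>1. \<Sum>y<d\<^sub>1. \<Sum>x'<d\<^sub>2. \<Sum>y'<d\<^sub>2.
            if y' = e' then if x' = c' then if y = e then if x = c then ?v else 0 else 0 else 0 else 0)"
        using that ij
        by (subst index_tensor_map[OF L1 L2]; (intro sum.cong refl)?) (auto simp: pair_index_less pair_index_eq_iff)
      also have "\<dots> = ?v" using that by simp
      finally show ?thesis .
    qed
    have "?T $$ (g k\<^sub>1 k\<^sub>2 ((a, i), i'), g k\<^sub>1 k\<^sub>2 ((b, j), j')) = (\<Sum>c<d\<^sub>1. \<Sum>c'<d\<^sub>2. \<Sum>e<d\<^sub>1. \<Sum>e'<d\<^sub>2. ?t c c' e e')"
      using that by (simp add: g_def index_ampliation[OF linear_map_tensor] pair_index_less)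
        (simp add: ampliation_def sum_pair_index U)
    \<comment> \<open>The sums arrive grouped into row and column indices; \<open>?x3\<close> needs
      them grouped by tensor factor, that of \<open>\<Psi>\<close> outside.\<close>
    also have "\<dots> = (\<Sum>c<d\<^sub>1. \<Sum>c'<d\<^sub>2. \<Sum>e'<d\<^sub>2. \<Sum>e<d\<^sub>1. ?t c c' e e')"
      by (intro sum.cong refl sum.swap)
    also have "\<dots> = (\<Sum>c'<d\<^sub>2. \<Sum>e'<d\<^sub>2. \<Sum>c<d\<^sub>1. \<Sum>e<d\<^sub>1. ?t c c' e e')"
      by (subst sum.swap) (intro sum.cong refl sum.swap)
    also have "\<dots> = ?x3 ((a, i), i') ((b, j), j')"
      by (simp add: ampliation_def g_def s_def sum_distrib_right mult.assoc)
    finally show ?thesis ..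
  qed
  ultimately have "psd_form (({..<m} \<times> {..<k\<^sub>1}) \<times> {..<k\<^sub>2}) (\<lambda>p q. ?T $$ (g k\<^sub>1 k\<^sub>2 p, g k\<^sub>1 k\<^sub>2 q))"
    by (subst (asm) psd_form_cong) auto
  then have "psd_form {..<m * (k\<^sub>1 * k\<^sub>2)} (\<lambda>i j. ?T $$ (i, j))"
    by (subst (asm) psd_form_reindex[OF g, where x = "\<lambda>i j. ?T $$ (i, j)"])
  then show "psd (m * (k\<^sub>1 * k\<^sub>2)) ?T"
    by (simp add: psd_iff_psd_form)
qed

lemma channel_tensor:
  assumes 1: "channel d\<^sub>1 k\<^sub>1 \<Phi>" and 2: "channel d\<^sub>2 k\<^sub>2 \<Psi>"
  shows "channel (d\<^sub>1 * d\<^sub>2) (k\<^sub>1 * k\<^sub>2) (tensor_map d\<^sub>1 k\<^sub>1 \<Phi> d\<^sub>2 k\<^sub>2 \<Psi>)"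
proof -
  have L: "linear_map d\<^sub>1 k\<^sub>1 \<Phi>" "linear_map d\<^sub>2 k\<^sub>2 \<Psi>"
    using 1 2 by (auto simp: channel_def)
  note T = linear_map_tensor[of d\<^sub>1 d\<^sub>2 k\<^sub>1 k\<^sub>2 \<Phi> \<Psi>]
  have "mtrace (tensor_map d\<^sub>1 k\<^sub>1 \<Phi> d\<^sub>2 k\<^sub>2 \<Psi> X) = mtrace X"
    if "X \<in> carrier_mat (d\<^sub>1 * d\<^sub>2) (d\<^sub>1 * d\<^sub>2)" for X
    using that
  proof (induction rule: kron_induct)
    case (kron A B)
    then show ?case
      using 1 2 linear_mapD(1)[OF L(1), of A] linear_mapD(1)[OF L(2), of B]
      by (simp add: tensor_map_kron[OF L] mtrace_kron[of _ d\<^sub>1 _ d\<^sub>2] mtrace_kron[of _ k\<^sub>1 _ k\<^sub>2] channel_def)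
  qed (simp_all add: linear_map_zero[OF T] linear_mapD[OF T] mtrace_add[of _ "d\<^sub>1 * d\<^sub>2"]
      mtrace_add[of _ "k\<^sub>1 * k\<^sub>2"] mtrace_smult[of _ "d\<^sub>1 * d\<^sub>2"] mtrace_smult[of _ "k\<^sub>1 * k\<^sub>2"])
  then show ?thesis
    using 1 2 T completely_positive_tensor[OF _ L(1) _ L(2)] by (simp add: channel_def)
qed

section \<open>Correctability of tensor products\<close>

text \<open>Uniqueness in the definite description: pairing with the matrix units determines every
  entry.\<close>

lemma map_adjoint_eqI:
  assumes Z: "Z \<in> carrier_mat d d"
    and eq: "\<And>X. X \<in> carrier_mat d d \<Longrightarrow> mtrace (Y * F X) = mtrace (Z * X)"
  shows "map_adjoint d F Y = Z"
  unfolding map_adjoint_def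
proof (rule the_equality)
  fix Z' assume Z': "Z' \<in> carrier_mat d d \<and> (\<forall>X\<in>carrier_mat d d. mtrace (Y * F X) = mtrace (Z' * X))"
  then have "mtrace (Z' * X) = mtrace (Z * X)" if "X \<in> carrier_mat d d" for X
    using eq that by metis
  then have "mtrace (Z' * mat_unit d a b) = mtrace (Z * mat_unit d a b)" for a b
    by blast
  then have "Z' $$ (b, a) = Z $$ (b, a)" if "a < d" "b < d" for a b
    using that Z Z' by (metis mtrace_mult_unit)
  then show "Z' = Z"
    using Z Z' by (intro eq_matI) auto
qed (use assms in auto)

lemma mtrace_mult_right:
  assumes "Y \<in> carrier_mat d d"
  shows "mtrace (Y * 0\<^sub>m d d) = 0"
    and "X \<in> carrier_mat d d \<Longrightarrow> X' \<in> carrier_mat d d \<Longrightarrow> mtrace (Y * (X + X')) = mtrace (Y * X) + mtrace (Y * X')"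
    and "X \<in> carrier_mat d d \<Longrightarrow> mtrace (Y * (c \<cdot>\<^sub>m X)) = c * mtrace (Y * X)"
  using assms by (simp_all add: mult_add_distrib_mat[of _ d d] mult_smult_distrib[of _ d d]
      mtrace_add[of _ d] mtrace_smult[of _ d])

lemma mtrace_mult_left:
  assumes "Y \<in> carrier_mat d d"
  shows "mtrace (0\<^sub>m d d * Y) = 0"
    and "X \<in> carrier_mat d d \<Longrightarrow> X' \<in> carrier_mat d d \<Longrightarrow> mtrace ((X + X') * Y) = mtrace (X * Y) + mtrace (X' * Y)"
    and "X \<in> carrier_mat d d \<Longrightarrow> mtrace ((c \<cdot>\<^sub>m X) * Y) = c * mtrace (X * Y)"
  using assms by (simp_all add: add_mult_distrib_mat[of _ d d] mult_smult_assoc_mat[of _ d d]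
      mtrace_add[of _ d] mtrace_smult[of _ d])

lemma linear_map_comp: "linear_map d k F \<Longrightarrow> linear_map k l G \<Longrightarrow> linear_map d l (\<lambda>X. G (F X))"
  by (simp add: linear_map_def Pi_iff)

lemma linear_map_sandwich:
  assumes A: "A \<in> carrier_mat k d" and B: "B \<in> carrier_mat d k"
  shows "linear_map d k (\<lambda>X. A * X * B)"
  unfolding linear_map_def
proof (intro conjI ballI allI)
  show "(\<lambda>X. A * X * B) \<in> carrier_mat d d \<rightarrow> carrier_mat k k"
    using A B by (intro Pi_I mult_carrier_mat)
  fix X :: "complex mat" assume X: "X \<in> carrier_mat d d"
  show "A * (c \<cdot>\<^sub>m X) * B = c \<cdot>\<^sub>m (A * X * B)" for c
    using mult_smult_distrib[OF A X] mult_smult_assoc_mat[OF mult_carrier_mat[OF A X] B] by simp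
  fix Y :: "complex mat" assume Y: "Y \<in> carrier_mat d d"
  show "A * (X + Y) * B = A * X * B + A * Y * B"
    using mult_add_distrib_mat[OF A X Y]
      add_mult_distrib_mat[OF mult_carrier_mat[OF A X] mult_carrier_mat[OF A Y] B] by simp
qed

lemma map_adjoint_exists:
  assumes F: "linear_map d k F" and Y: "Y \<in> carrier_mat k k"
  obtains Z where "Z \<in> carrier_mat d d" "\<And>X. X \<in> carrier_mat d d \<Longrightarrow> mtrace (Y * F X) = mtrace (Z * X)"
proof
  \<comment> \<open>Pairing \<open>Z\<close> with \<open>mat_unit d a b\<close> reads the entry at
    \<open>(b, a)\<close>, which forces this matrix.\<close>
  define Z where "Z = mat d d (\<lambda>(b, a). mtrace (Y * F (mat_unit d a b)))"
  show Z: "Z \<in> carrier_mat d d" by (simp add: Z_def)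
  fix X :: "complex mat" assume "X \<in> carrier_mat d d"
  then show "mtrace (Y * F X) = mtrace (Z * X)"
  proof (induction rule: mat_unit_induct)
    case (unit a b)
    then show ?case by (simp add: mtrace_mult_unit[OF Z]) (simp add: Z_def)
  qed (simp_all add: linear_map_zero[OF F] linear_mapD[OF F] mtrace_mult_right[OF Y] mtrace_mult_right[OF Z])
qed

text \<open>A definite description says something only if a witness exists. The forward direction
  therefore starts from \<open>map_adjoint_exists\<close>, where linearity of \<open>E\<close>
  enters.\<close>

lemma map_adjoint_fixed_iff:
  assumes E: "linear_map d d E" and Y: "Y \<in> carrier_mat d d"
  shows "map_adjoint d E Y = Y \<longleftrightarrow> (\<forall>X\<in>carrier_mat d d. mtrace (Y * E X) = mtrace (Y * X))"
proof
  obtain Z where Z: "Z \<in> carrier_mat d d" "\<And>X. X \<in> carrier_mat d d \<Longrightarrow> mtrace (Y * E X) = mtrace (Z * X)"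
    using map_adjoint_exists[OF E Y] by blast
  assume "map_adjoint d E Y = Y"
  then show "\<forall>X\<in>carrier_mat d d. mtrace (Y * E X) = mtrace (Y * X)"
    using map_adjoint_eqI[OF Z] Z(2) by simp
next
  assume "\<forall>X\<in>carrier_mat d d. mtrace (Y * E X) = mtrace (Y * X)"
  then show "map_adjoint d E Y = Y"
    using Y by (intro map_adjoint_eqI) auto
qed

text \<open>The condition on the adjoint map, read in the Schroedinger picture. In this form it is bilinear in
  observable and state, so it extends from elementary tensors to their span.\<close>

definition recovers :: "nat \<Rightarrow> nat \<Rightarrow> (complex mat \<Rightarrow> complex mat) \<Rightarrow> complex mat set \<Rightarrow> complex mat \<Rightarrow>
    nat \<Rightarrow> complex mat \<Rightarrow> (complex mat \<Rightarrow> complex mat) \<Rightarrow> bool" where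
  "recovers d k \<Phi> S P r V D \<longleftrightarrow>
     P \<in> S \<and> (\<forall>X\<in>S. P * X = X \<and> X * P = X) \<and> V \<in> carrier_mat d r \<and>
     mat_adjoint V * V = 1\<^sub>m r \<and> V * mat_adjoint V = P \<and> channel k r D \<and>
     (\<forall>X\<in>S. \<forall>Y\<in>carrier_mat r r.
       mtrace (mat_adjoint V * X * V * D (\<Phi> (V * Y * mat_adjoint V))) = mtrace (mat_adjoint V * X * V * Y))"

lemma correctable_iff:
  assumes L: "linear_map d k \<Phi>"
  shows "correctable d k \<Phi> S \<longleftrightarrow> star_subalgebra d S \<and> (\<exists>P r V D. recovers d k \<Phi> S P r V D)"
proof -
  have lin: "linear_map r r (\<lambda>Y. D (\<Phi> (V * Y * mat_adjoint V)))"
    if V: "V \<in> carrier_mat d r" and D: "channel k r D" for V r D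
    by (rule linear_map_comp[OF linear_map_comp[OF linear_map_sandwich[OF V mat_adjoint_carrier[OF V]] L]])
      (use D in \<open>simp add: channel_def\<close>)
  have carr: "mat_adjoint V * X * V \<in> carrier_mat r r"
    if "V \<in> carrier_mat d r" "X \<in> S" "star_subalgebra d S" for V r X
    using that star_subalgebraD(1) by (intro mult_carrier_mat) auto
  show ?thesis
  proof
    assume C: "correctable d k \<Phi> S"
    then obtain P r V D where *: "P \<in> S" "\<forall>X\<in>S. P * X = X \<and> X * P = X" "V \<in> carrier_mat d r"
      "mat_adjoint V * V = 1\<^sub>m r" "V * mat_adjoint V = P" "channel k r D"
      "\<forall>X\<in>S. map_adjoint r (\<lambda>Y. D (\<Phi> (V * Y * mat_adjoint V))) (mat_adjoint V * X * V) = mat_adjoint V * X * V"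
      unfolding correctable_def by blast
    moreover have S: "star_subalgebra d S" using C by (simp add: correctable_def)
    ultimately have "recovers d k \<Phi> S P r V D"
      unfolding recovers_def using map_adjoint_fixed_iff[OF lin[OF *(3,6)] carr[OF *(3) _ S]] by simp
    then show "star_subalgebra d S \<and> (\<exists>P r V D. recovers d k \<Phi> S P r V D)" using S by blast
  next
    assume A: "star_subalgebra d S \<and> (\<exists>P r V D. recovers d k \<Phi> S P r V D)"
    then obtain P r V D where R: "recovers d k \<Phi> S P r V D" by blast
    have V: "V \<in> carrier_mat d r" and D: "channel k r D" using R by (auto simp: recovers_def)
    have "\<forall>X\<in>S. map_adjoint r (\<lambda>Y. D (\<Phi> (V * Y * mat_adjoint V))) (mat_adjoint V * X * V) = mat_adjoint V * X * V"
      using R map_adjoint_fixed_iff[OF lin[OF V D] carr[OF V]] A by (simp add: recovers_def)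
    then show "correctable d k \<Phi> S"
      using A R unfolding correctable_def recovers_def by blast
  qed
qed

lemma recovers_cong:
  assumes "\<And>X. X \<in> carrier_mat d d \<Longrightarrow> \<Phi> X = \<Psi> X"
  shows "recovers d k \<Phi> S P r V D \<longleftrightarrow> recovers d k \<Psi> S P r V D"
proof -
  have "\<Phi> (V * Y * mat_adjoint V) = \<Psi> (V * Y * mat_adjoint V)"
    if "V \<in> carrier_mat d r" "Y \<in> carrier_mat r r" for Y
    using that by (intro assms mult_carrier_mat) auto
  then show ?thesis unfolding recovers_def by auto
qed

section \<open>Linear spans of matrices\<close>

text \<open>\<open>lin_span\<close> uses only the zero, the sum and the scaling of its algebra, so
  the full matrix algebra can always be the ambient one.\<close>

abbreviation mspan :: "nat \<Rightarrow> complex mat set \<Rightarrow> complex mat set" where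
  "mspan d \<equiv> lin_span (matrix_algebra d (carrier_mat d d))"

lemma mspan_zero: "0\<^sub>m d d \<in> mspan d B"
  using lin_span.span_zero[of "matrix_algebra d (carrier_mat d d)" B] by simp

lemma mspan_step: "X \<in> B \<Longrightarrow> Y \<in> mspan d B \<Longrightarrow> c \<cdot>\<^sub>m X + Y \<in> mspan d B"
  using lin_span.span_step[of X B Y "matrix_algebra d (carrier_mat d d)" c] by simp

lemma mspan_induct [consumes 1, case_names zero step]:
  assumes "X \<in> mspan d B" "P (0\<^sub>m d d)"
    and "\<And>X Y c. X \<in> B \<Longrightarrow> Y \<in> mspan d B \<Longrightarrow> P Y \<Longrightarrow> P (c \<cdot>\<^sub>m X + Y)"
  shows "P X"
  using assms(1) by induction (use assms(2,3) in auto)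

lemma mspan_carrier: "X \<in> mspan d B \<Longrightarrow> B \<subseteq> carrier_mat d d \<Longrightarrow> X \<in> carrier_mat d d"
  by (induction rule: mspan_induct) auto

lemma mspan_add:
  assumes X: "X \<in> mspan d B" and Y: "Y \<in> mspan d B" and B: "B \<subseteq> carrier_mat d d"
  shows "X + Y \<in> mspan d B"
  using X
proof (induction rule: mspan_induct)
  case zero
  then show ?case using Y mspan_carrier[OF Y B] by simp
next
  case (step X X' c)
  then have "c \<cdot>\<^sub>m X + X' + Y = c \<cdot>\<^sub>m X + (X' + Y)"
    using B mspan_carrier[OF step(2) B] mspan_carrier[OF Y B] by (intro assoc_add_mat) auto
  then show ?case using step mspan_step by simp
qed

lemma mspan_base:
  assumes "X \<in> B" "B \<subseteq> carrier_mat d d"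
  shows "X \<in> mspan d B"
proof -
  have "1 \<cdot>\<^sub>m X + 0\<^sub>m d d = X" using assms by (intro eq_matI) auto
  then show ?thesis using mspan_step[OF assms(1) mspan_zero, where c = 1 and d = d] by simp
qed

lemma mspan_smult:
  assumes "X \<in> mspan d B" and B: "B \<subseteq> carrier_mat d d"
  shows "c \<cdot>\<^sub>m X \<in> mspan d B"
  using assms(1)
proof (induction rule: mspan_induct)
  case zero
  then show ?case by (simp add: mspan_zero)
next
  case (step X Y e)
  have "c \<cdot>\<^sub>m (e \<cdot>\<^sub>m X + Y) = (c * e) \<cdot>\<^sub>m X + c \<cdot>\<^sub>m Y"
    using step(1) B mspan_carrier[OF step(2) B] by (intro eq_matI) (auto simp: algebra_simps)
  then show ?case using step mspan_step by simp
qed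

lemma mspan_mult:
  assumes X: "X \<in> mspan d B" and Y: "Y \<in> mspan d B" and B: "B \<subseteq> carrier_mat d d"
    and mult: "\<And>X Y. X \<in> B \<Longrightarrow> Y \<in> B \<Longrightarrow> X * Y \<in> B"
  shows "X * Y \<in> mspan d B"
  using X
proof (induction rule: mspan_induct)
  case zero
  then show ?case using mspan_carrier[OF Y B] by (simp add: mspan_zero)
next
  case (step X X' c)
  have c: "X \<in> carrier_mat d d" "X' \<in> carrier_mat d d" "Y \<in> carrier_mat d d"
    using step B mspan_carrier[OF _ B] Y by auto
  have "X * Y \<in> mspan d B"
    using Y
  proof (induction rule: mspan_induct)
    case zero
    then show ?case using c by (simp add: mspan_zero)
  next
    case (step Z Z' e)
    have Z: "Z \<in> carrier_mat d d" "Z' \<in> carrier_mat d d"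
      using step B mspan_carrier[OF _ B] by auto
    have "X * (e \<cdot>\<^sub>m Z + Z') = e \<cdot>\<^sub>m (X * Z) + X * Z'"
      using c Z by (simp add: mult_add_distrib_mat[of _ d d _ d] mult_smult_distrib[of _ d d _ d])
    then show ?case using step mspan_step mult[OF \<open>X \<in> B\<close>] by simp
  qed
  moreover have "(c \<cdot>\<^sub>m X + X') * Y = c \<cdot>\<^sub>m (X * Y) + X' * Y"
    using c by (simp add: add_mult_distrib_mat[of _ d d _ _ d] mult_smult_assoc_mat[of _ d d _ d])
  ultimately show ?case
    using step.IH by (simp add: mspan_add mspan_smult B)
qed

lemma mspan_adjoint:
  assumes X: "X \<in> mspan d B" and B: "B \<subseteq> carrier_mat d d"
    and adj: "\<And>X. X \<in> B \<Longrightarrow> mat_adjoint X \<in> B"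
  shows "mat_adjoint X \<in> mspan d B"
  using X
proof (induction rule: mspan_induct)
  case zero
  then show ?case by (simp add: mspan_zero)
next
  case (step X Y c)
  have "mat_adjoint (c \<cdot>\<^sub>m X + Y) = cnj c \<cdot>\<^sub>m mat_adjoint X + mat_adjoint Y"
    using step(1) B mspan_carrier[OF step(2) B]
    by (subst mat_adjoint_add[of _ d d]) (auto simp: mat_adjoint_smult)
  then show ?case using step adj mspan_step by simp
qed

section \<open>Tensor products of correctable algebras\<close>

text \<open>For subspaces \<open>S\<close> and \<open>T\<close> and \<open>d\<close> the product of
  their dimensions of action, this is their tensor product, realised as operators on the product
  space.\<close>

definition kron_span :: "nat \<Rightarrow> complex mat set \<Rightarrow> complex mat set \<Rightarrow> complex mat set" where
  "kron_span d S T = mspan d {kron X Y | X Y. X \<in> S \<and> Y \<in> T}"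

lemma kron_set_carrier:
  "S \<subseteq> carrier_mat m m \<Longrightarrow> T \<subseteq> carrier_mat n n \<Longrightarrow>
    {kron X Y | X Y. X \<in> S \<and> Y \<in> T} \<subseteq> carrier_mat (m * n) (m * n)"
  by auto

text \<open>A nonzero entry of each factor gives a nonzero entry of the product. This keeps the
  tensor product of two algebras nonzero, as \<open>star_subalgebra\<close> demands.\<close>

lemma kron_eq_0:
  assumes X: "X \<in> carrier_mat m m" and Y: "Y \<in> carrier_mat n n" and 0: "kron X Y = 0\<^sub>m (m * n) (m * n)"
  shows "X = 0\<^sub>m m m \<or> Y = 0\<^sub>m n n"
proof (rule ccontr)
  assume "\<not> ?thesis"
  then obtain i j where ij: "i < m" "j < m" "X $$ (i, j) \<noteq> 0"
    using X by (metis (no_types, lifting) carrier_matD eq_matI index_zero_mat)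
  from \<open>\<not> ?thesis\<close> obtain i' j' where ij': "i' < n" "j' < n" "Y $$ (i', j') \<noteq> 0"
    using Y by (metis (no_types, lifting) carrier_matD eq_matI index_zero_mat)
  have "kron X Y $$ (i * n + i', j * n + j') \<noteq> 0"
    using ij ij' by (simp add: index_kron[OF X Y])
  then show False
    using 0 ij ij' by (simp add: pair_index_less)
qed

text \<open>The set of elementary tensors is closed under products and adjoints because both act
  factorwise; the span inherits these closures.\<close>

lemma star_subalgebra_kron_span:
  assumes S: "star_subalgebra m S" and T: "star_subalgebra n T"
  shows "star_subalgebra (m * n) (kron_span (m * n) S T)"
proof -
  note DS = star_subalgebraD[OF S] and DT = star_subalgebraD[OF T]
  let ?B = "{kron X Y | X Y. X \<in> S \<and> Y \<in> T}"
  note B = kron_set_carrier[OF DS(1) DT(1)]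
  obtain X where X: "X \<in> S" "X \<noteq> 0\<^sub>m m m" using DS(2,3) by blast
  obtain Y where Y: "Y \<in> T" "Y \<noteq> 0\<^sub>m n n" using DT(2,3) by blast
  have "kron X Y \<noteq> 0\<^sub>m (m * n) (m * n)"
    using kron_eq_0[of X m Y n] X Y DS(1) DT(1) by blast
  moreover have "kron X Y \<in> mspan (m * n) ?B"
    using X Y by (intro mspan_base B) blast
  ultimately have "mspan (m * n) ?B \<noteq> {0\<^sub>m (m * n) (m * n)}" by blast
  moreover have "A * B \<in> ?B" if AB: "A \<in> ?B" "B \<in> ?B" for A B
  proof -
    obtain X Y X' Y' where *: "A = kron X Y" "B = kron X' Y'" "X \<in> S" "X' \<in> S" "Y \<in> T" "Y' \<in> T"
      using AB by blast
    then have c: "X \<in> carrier_mat m m" "X' \<in> carrier_mat m m" "Y \<in> carrier_mat n n" "Y' \<in> carrier_mat n n"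
      using DS(1) DT(1) by blast+
    have "A * B = kron (X * X') (Y * Y')"
      using * kron_mult[OF c] by simp
    then show ?thesis using DS(5)[OF *(3,4)] DT(5)[OF *(5,6)] by blast
  qed
  moreover have "mat_adjoint A \<in> ?B" if "A \<in> ?B" for A
  proof -
    obtain X Y where "A = kron X Y" "X \<in> S" "Y \<in> T" using \<open>A \<in> ?B\<close> by blast
    then show ?thesis using kron_adjoint[of X Y] DS(7) DT(7) by blast
  qed
  ultimately show ?thesis
    unfolding star_subalgebra_def kron_span_def
    by (intro conjI subsetI ballI allI mspan_carrier[OF _ B] mspan_add[OF _ _ B] mspan_smult[OF _ B] mspan_zero
        mspan_mult[OF _ _ B] mspan_adjoint[OF _ B])
qed

lemma recovers_tensor:
  assumes S: "S \<subseteq> carrier_mat d\<^sub>1 d\<^sub>1" and T: "T \<subseteq> carrier_mat d\<^sub>2 d\<^sub>2"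
    and L1: "linear_map d\<^sub>1 k\<^sub>1 \<Phi>" and L2: "linear_map d\<^sub>2 k\<^sub>2 \<Psi>"
    and R1: "recovers d\<^sub>1 k\<^sub>1 \<Phi> S P p V D" and R2: "recovers d\<^sub>2 k\<^sub>2 \<Psi> T Q q W E"
  shows "recovers (d\<^sub>1 * d\<^sub>2) (k\<^sub>1 * k\<^sub>2) (tensor_map d\<^sub>1 k\<^sub>1 \<Phi> d\<^sub>2 k\<^sub>2 \<Psi>) (kron_span (d\<^sub>1 * d\<^sub>2) S T)
    (kron P Q) (p * q) (kron V W) (tensor_map k\<^sub>1 p D k\<^sub>2 q E)"
proof -
  let ?B = "{kron X Y | X Y. X \<in> S \<and> Y \<in> T}"
  \<comment> \<open>\<open>?F\<close> encodes a state, sends it through both maps and decodes it;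
    \<open>?C\<close> compresses an observable to the code.\<close>
  let ?F = "\<lambda>Z. tensor_map k\<^sub>1 p D k\<^sub>2 q E (tensor_map d\<^sub>1 k\<^sub>1 \<Phi> d\<^sub>2 k\<^sub>2 \<Psi> (kron V W * Z * mat_adjoint (kron V W)))"
  let ?C = "\<lambda>X. mat_adjoint (kron V W) * X * kron V W"
  note B = kron_set_carrier[OF S T]
  from R1 have P: "P \<in> S" "\<And>X. X \<in> S \<Longrightarrow> P * X = X" "\<And>X. X \<in> S \<Longrightarrow> X * P = X"
    and V: "V \<in> carrier_mat d\<^sub>1 p" "mat_adjoint V * V = 1\<^sub>m p" "V * mat_adjoint V = P"
    and D: "channel k\<^sub>1 p D"
    and tr1: "\<And>X Y. X \<in> S \<Longrightarrow> Y \<in> carrier_mat p p \<Longrightarrow>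
      mtrace (mat_adjoint V * X * V * D (\<Phi> (V * Y * mat_adjoint V))) = mtrace (mat_adjoint V * X * V * Y)"
    by (auto simp: recovers_def)
  from R2 have Q: "Q \<in> T" "\<And>X. X \<in> T \<Longrightarrow> Q * X = X" "\<And>X. X \<in> T \<Longrightarrow> X * Q = X"
    and W: "W \<in> carrier_mat d\<^sub>2 q" "mat_adjoint W * W = 1\<^sub>m q" "W * mat_adjoint W = Q"
    and E: "channel k\<^sub>2 q E"
    and tr2: "\<And>X Y. X \<in> T \<Longrightarrow> Y \<in> carrier_mat q q \<Longrightarrow>
      mtrace (mat_adjoint W * X * W * E (\<Psi> (W * Y * mat_adjoint W))) = mtrace (mat_adjoint W * X * W * Y)"
    by (auto simp: recovers_def)
  have V': "mat_adjoint V \<in> carrier_mat p d\<^sub>1" and W': "mat_adjoint W \<in> carrier_mat q d\<^sub>2"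
    using V W by auto
  have c: "P \<in> carrier_mat d\<^sub>1 d\<^sub>1" "Q \<in> carrier_mat d\<^sub>2 d\<^sub>2" using P Q S T by auto
  have LD: "linear_map k\<^sub>1 p D" and LE: "linear_map k\<^sub>2 q E" using D E by (auto simp: channel_def)
  have KV: "kron V W \<in> carrier_mat (d\<^sub>1 * d\<^sub>2) (p * q)"
    and KV': "mat_adjoint (kron V W) \<in> carrier_mat (p * q) (d\<^sub>1 * d\<^sub>2)" using V W by auto
  note LT = linear_map_tensor[of d\<^sub>1 d\<^sub>2 k\<^sub>1 k\<^sub>2 \<Phi> \<Psi>] and LTD = linear_map_tensor[of k\<^sub>1 k\<^sub>2 p q D E]
  have unit: "kron P Q * X = X \<and> X * kron P Q = X" if X: "X \<in> kron_span (d\<^sub>1 * d\<^sub>2) S T" for X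
    using X unfolding kron_span_def
  proof (induction rule: mspan_induct)
    case zero
    then show ?case using c by auto
  next
    case (step X Y e)
    obtain X1 X2 where X: "X = kron X1 X2" "X1 \<in> S" "X2 \<in> T" using step(1) by blast
    then have cX: "X1 \<in> carrier_mat d\<^sub>1 d\<^sub>1" "X2 \<in> carrier_mat d\<^sub>2 d\<^sub>2" using S T by auto
    have k: "kron P Q * X = X" "X * kron P Q = X"
      using P(2,3) Q(2,3) X kron_mult[OF c(1) cX(1) c(2) cX(2)] kron_mult[OF cX(1) c(1) cX(2) c(2)] by auto
    have cc: "kron P Q \<in> carrier_mat (d\<^sub>1 * d\<^sub>2) (d\<^sub>1 * d\<^sub>2)" "X \<in> carrier_mat (d\<^sub>1 * d\<^sub>2) (d\<^sub>1 * d\<^sub>2)"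
      "Y \<in> carrier_mat (d\<^sub>1 * d\<^sub>2) (d\<^sub>1 * d\<^sub>2)"
      using c X cX mspan_carrier[OF step(2) B] by auto
    show ?case
      using step(3) mult_add_distrib_mat[OF cc(1) smult_carrier_mat[OF cc(2), of e] cc(3)]
        add_mult_distrib_mat[OF smult_carrier_mat[OF cc(2), of e] cc(3) cc(1)]
        mult_smult_distrib[OF cc(1,2), of e] mult_smult_assoc_mat[OF cc(2,1), of e] k by simp
  qed
  \<comment> \<open>Two nested inductions: over the state for a fixed elementary observable in
    \<open>base\<close>, and over the span of the observables outside. On elementary tensors the
    trace factors into \<open>tr1\<close> and \<open>tr2\<close>.\<close>
  have tr: "mtrace (?C X * ?F Y) = mtrace (?C X * Y)"
    if X: "X \<in> kron_span (d\<^sub>1 * d\<^sub>2) S T" and Y: "Y \<in> carrier_mat (p * q) (p * q)" for X Y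
  proof -
    have C: "linear_map (d\<^sub>1 * d\<^sub>2) (p * q) ?C"
      by (rule linear_map_sandwich[OF KV' KV])
    have F: "linear_map (p * q) (p * q) ?F"
      by (rule linear_map_comp[OF linear_map_comp[OF linear_map_sandwich[OF KV KV'] LT] LTD])
    have CX: "?C X \<in> carrier_mat (p * q) (p * q)" if "X \<in> ?B" for X
      using linear_mapD(1)[OF C] B that by blast
    have base: "mtrace (?C X * ?F Y) = mtrace (?C X * Y)" if XB: "X \<in> ?B" for X
      using Y
    proof (induction rule: kron_induct)
      case (kron Y1 Y2)
      obtain X1 X2 where X: "X = kron X1 X2" "X1 \<in> S" "X2 \<in> T" using XB by blast
      then have cX: "X1 \<in> carrier_mat d\<^sub>1 d\<^sub>1" "X2 \<in> carrier_mat d\<^sub>2 d\<^sub>2" using S T by auto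
      let ?Z1 = "V * Y1 * mat_adjoint V" and ?Z2 = "W * Y2 * mat_adjoint W"
      let ?C1 = "mat_adjoint V * X1 * V" and ?C2 = "mat_adjoint W * X2 * W"
      have c1: "?Z1 \<in> carrier_mat d\<^sub>1 d\<^sub>1" "?C1 \<in> carrier_mat p p" "D (\<Phi> ?Z1) \<in> carrier_mat p p"
        using linear_mapD(1)[OF linear_map_sandwich[OF V(1) V']] linear_mapD(1)[OF linear_map_sandwich[OF V' V(1)]]
          linear_mapD(1)[OF LD linear_mapD(1)[OF L1]] kron cX by blast+
      have c2: "?Z2 \<in> carrier_mat d\<^sub>2 d\<^sub>2" "?C2 \<in> carrier_mat q q" "E (\<Psi> ?Z2) \<in> carrier_mat q q"
        using linear_mapD(1)[OF linear_map_sandwich[OF W(1) W']] linear_mapD(1)[OF linear_map_sandwich[OF W' W(1)]]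
          linear_mapD(1)[OF LE linear_mapD(1)[OF L2]] kron cX by blast+
      have "?C X = kron ?C1 ?C2"
        unfolding X kron_adjoint
        using kron_mult[OF V' cX(1) W' cX(2)] kron_mult[OF mult_carrier_mat[OF V' cX(1)] V(1) mult_carrier_mat[OF W' cX(2)] W(1)]
        by simp
      moreover have "kron V W * kron Y1 Y2 * mat_adjoint (kron V W) = kron ?Z1 ?Z2"
        unfolding kron_adjoint
        using kron_mult[OF V(1) kron(1) W(1) kron(2)]
          kron_mult[OF mult_carrier_mat[OF V(1) kron(1)] V' mult_carrier_mat[OF W(1) kron(2)] W'] by simp
      then have "?F (kron Y1 Y2) = kron (D (\<Phi> ?Z1)) (E (\<Psi> ?Z2))"
        using tensor_map_kron[OF L1 L2 c1(1) c2(1)]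
          tensor_map_kron[OF LD LE linear_mapD(1)[OF L1 c1(1)] linear_mapD(1)[OF L2 c2(1)]] by simp
      ultimately have "mtrace (?C X * ?F (kron Y1 Y2)) = mtrace (?C1 * D (\<Phi> ?Z1)) * mtrace (?C2 * E (\<Psi> ?Z2))"
        using kron_mult[OF c1(2,3) c2(2,3)] mtrace_kron[OF mult_carrier_mat[OF c1(2,3)] mult_carrier_mat[OF c2(2,3)]]
        by simp
      also have "\<dots> = mtrace (?C1 * Y1) * mtrace (?C2 * Y2)"
        using tr1[OF X(2) kron(1)] tr2[OF X(3) kron(2)] by simp
      also have "\<dots> = mtrace (?C X * kron Y1 Y2)"
        using \<open>?C X = _\<close> kron_mult[OF c1(2) kron(1) c2(2) kron(2)]
          mtrace_kron[OF mult_carrier_mat[OF c1(2) kron(1)] mult_carrier_mat[OF c2(2) kron(2)]] by simp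
      finally show ?case .
    next
      case zero
      show ?case by (simp only: linear_map_zero[OF F])
    next
      case (add Y Z)
      show ?case
        using add(3,4)
        by (simp only: linear_mapD(2)[OF F add(1,2)] mtrace_mult_right(2)[OF CX[OF XB] add(1,2)]
            mtrace_mult_right(2)[OF CX[OF XB] linear_mapD(1)[OF F add(1)] linear_mapD(1)[OF F add(2)]])
    next
      case (smult c Y)
      show ?case
        using smult(2)
        by (simp only: linear_mapD(3)[OF F smult(1)] mtrace_mult_right(3)[OF CX[OF XB] smult(1)]
            mtrace_mult_right(3)[OF CX[OF XB] linear_mapD(1)[OF F smult(1)]])
    qed
    note FY = linear_mapD(1)[OF F Y]
    show ?thesis
      using X unfolding kron_span_def
    proof (induction rule: mspan_induct)
      case zero
      show ?case
        by (simp only: linear_map_zero[OF C] mtrace_mult_left(1)[OF Y] mtrace_mult_left(1)[OF FY])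
    next
      case (step X Z e)
      have c: "X \<in> carrier_mat (d\<^sub>1 * d\<^sub>2) (d\<^sub>1 * d\<^sub>2)" "Z \<in> carrier_mat (d\<^sub>1 * d\<^sub>2) (d\<^sub>1 * d\<^sub>2)"
        using step(1) B mspan_carrier[OF step(2) B] by auto
      note CX = linear_mapD(1)[OF C c(1)] and CZ = linear_mapD(1)[OF C c(2)]
      note eX = smult_carrier_mat[OF c(1), of e] and eCX = smult_carrier_mat[OF CX, of e]
      show ?case
        by (simp only: linear_mapD(2)[OF C eX c(2)] linear_mapD(3)[OF C c(1)]
            mtrace_mult_left(2)[OF Y eCX CZ] mtrace_mult_left(3)[OF Y CX]
            mtrace_mult_left(2)[OF FY eCX CZ] mtrace_mult_left(3)[OF FY CX] base[OF step(1)] step(3))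
    qed
  qed
  show ?thesis
    unfolding recovers_def
  proof (intro conjI ballI)
    show "kron P Q \<in> kron_span (d\<^sub>1 * d\<^sub>2) S T"
      unfolding kron_span_def using P Q by (intro mspan_base B) blast
    show "mat_adjoint (kron V W) * kron V W = 1\<^sub>m (p * q)"
      using kron_mult[OF V' V(1) W' W(1)] V(2) W(2) by (simp add: kron_adjoint kron_one)
    show "kron V W * mat_adjoint (kron V W) = kron P Q"
      using kron_mult[OF V(1) V' W(1) W'] V(3) W(3) by (simp add: kron_adjoint)
  qed (use unit tr KV channel_tensor[OF D E] in auto)
qed

lemma correctable_tensor:
  assumes L1: "linear_map d\<^sub>1 k\<^sub>1 \<Phi>" and L2: "linear_map d\<^sub>2 k\<^sub>2 \<Psi>"
    and S: "correctable d\<^sub>1 k\<^sub>1 \<Phi> S" and T: "correctable d\<^sub>2 k\<^sub>2 \<Psi> T"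
  shows "correctable (d\<^sub>1 * d\<^sub>2) (k\<^sub>1 * k\<^sub>2) (tensor_map d\<^sub>1 k\<^sub>1 \<Phi> d\<^sub>2 k\<^sub>2 \<Psi>) (kron_span (d\<^sub>1 * d\<^sub>2) S T)"
proof -
  obtain P p V D Q q W E where R: "recovers d\<^sub>1 k\<^sub>1 \<Phi> S P p V D" "recovers d\<^sub>2 k\<^sub>2 \<Psi> T Q q W E"
    and sub: "star_subalgebra d\<^sub>1 S" "star_subalgebra d\<^sub>2 T"
    using S T unfolding correctable_iff[OF L1] correctable_iff[OF L2] by blast
  show ?thesis
    unfolding correctable_iff[OF linear_map_tensor]
    using recovers_tensor[OF star_subalgebraD(1)[OF sub(1)] star_subalgebraD(1)[OF sub(2)] L1 L2 R]
      star_subalgebra_kron_span[OF sub] by blast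
qed

text \<open>Maps are functions on matrices of every size, while \<open>tensor_power_map_add\<close>
  is an equality only on the relevant carrier; correctability does not see the difference.\<close>

lemma correctable_cong:
  assumes L: "linear_map d k \<Phi>" "linear_map d k \<Psi>"
    and eq: "\<And>X. X \<in> carrier_mat d d \<Longrightarrow> \<Phi> X = \<Psi> X"
  shows "correctable d k \<Phi> S \<longleftrightarrow> correctable d k \<Psi> S"
proof -
  have "recovers d k \<Phi> S = recovers d k \<Psi> S"
    by (intro ext recovers_cong eq)
  then show ?thesis unfolding correctable_iff[OF L(1)] correctable_iff[OF L(2)] by simp
qed

text \<open>Start of the iterated tensor product: zero uses of the channel transmit the scalars.
  Exponents equal to 0 are covered by this case.\<close>

lemma correctable_scalars: "correctable 1 1 (\<lambda>X. X) (carrier_mat 1 1)"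
proof -
  have one: "1\<^sub>m 1 \<noteq> (0\<^sub>m 1 1 :: complex mat)"
  proof
    assume "1\<^sub>m 1 = (0\<^sub>m 1 1 :: complex mat)"
    then have "(1\<^sub>m 1 :: complex mat) $$ (0, 0) = 0\<^sub>m 1 1 $$ (0, 0)" by simp
    then show False by simp
  qed
  then have "carrier_mat 1 1 \<noteq> {0\<^sub>m 1 1 :: complex mat}"
    using one_carrier_mat[of 1] by blast
  then have sub: "star_subalgebra 1 (carrier_mat 1 1)"
    by (auto simp: star_subalgebra_def)
  have "tensor_map m m (\<lambda>Y. Y) 1 1 (\<lambda>Y. Y) X = X" if "X \<in> carrier_mat (m * 1) (m * 1)" for m and X :: "complex mat"
    using that by (intro linear_map_eqI_kron[OF linear_map_tensor linear_map_id _ that])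
      (simp add: tensor_map_kron[OF linear_map_id linear_map_id])
  then have "completely_positive 1 1 (\<lambda>X. X)"
    unfolding completely_positive_def psd_def by auto
  then have "channel 1 1 (\<lambda>X. X)"
    by (simp add: channel_def linear_map_id)
  then have "recovers 1 1 (\<lambda>X. X) (carrier_mat 1 1) (1\<^sub>m 1) 1 (1\<^sub>m 1) (\<lambda>X. X)"
    by (auto simp: recovers_def)
  then show ?thesis
    using sub unfolding correctable_iff[OF linear_map_id] by blast
qed

section \<open>Tensor powers of a linear map\<close>

lemma linear_map_tensor_power: "linear_map d k \<Phi> \<Longrightarrow> linear_map (d ^ n) (k ^ n) (tensor_power_map d k \<Phi> n)"
proof (cases n)
  case 0
  then show ?thesis by (simp add: linear_map_def)
next
  case (Suc m)
  then show ?thesis using linear_map_tensor[of d "d ^ m" k "k ^ m"] by simp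
qed

text \<open>Both sides are linear, and on threefold elementary tensors they agree because
  \<open>kron\<close> is strictly associative.\<close>

lemma tensor_map_assoc:
  assumes L: "linear_map d\<^sub>1 k\<^sub>1 \<Phi>\<^sub>1" "linear_map d\<^sub>2 k\<^sub>2 \<Phi>\<^sub>2" "linear_map d\<^sub>3 k\<^sub>3 \<Phi>\<^sub>3"
    and X: "X \<in> carrier_mat (d\<^sub>1 * d\<^sub>2 * d\<^sub>3) (d\<^sub>1 * d\<^sub>2 * d\<^sub>3)"
  shows "tensor_map (d\<^sub>1 * d\<^sub>2) (k\<^sub>1 * k\<^sub>2) (tensor_map d\<^sub>1 k\<^sub>1 \<Phi>\<^sub>1 d\<^sub>2 k\<^sub>2 \<Phi>\<^sub>2) d\<^sub>3 k\<^sub>3 \<Phi>\<^sub>3 X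
    = tensor_map d\<^sub>1 k\<^sub>1 \<Phi>\<^sub>1 (d\<^sub>2 * d\<^sub>3) (k\<^sub>2 * k\<^sub>3) (tensor_map d\<^sub>2 k\<^sub>2 \<Phi>\<^sub>2 d\<^sub>3 k\<^sub>3 \<Phi>\<^sub>3) X"
    (is "?F X = ?G X")
proof (rule linear_map_eqI_kron[OF linear_map_tensor _ _ X])
  note T12 = linear_map_tensor[of d\<^sub>1 d\<^sub>2 k\<^sub>1 k\<^sub>2 \<Phi>\<^sub>1 \<Phi>\<^sub>2] and T23 = linear_map_tensor[of d\<^sub>2 d\<^sub>3 k\<^sub>2 k\<^sub>3 \<Phi>\<^sub>2 \<Phi>\<^sub>3]
  have F: "linear_map (d\<^sub>1 * d\<^sub>2 * d\<^sub>3) (k\<^sub>1 * k\<^sub>2 * k\<^sub>3) ?F"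
    by (rule linear_map_tensor)
  show G: "linear_map (d\<^sub>1 * d\<^sub>2 * d\<^sub>3) (k\<^sub>1 * k\<^sub>2 * k\<^sub>3) ?G"
    using linear_map_tensor[of d\<^sub>1 "d\<^sub>2 * d\<^sub>3" k\<^sub>1 "k\<^sub>2 * k\<^sub>3"] by (simp only: mult.assoc)
  fix A C :: "complex mat" assume A: "A \<in> carrier_mat (d\<^sub>1 * d\<^sub>2) (d\<^sub>1 * d\<^sub>2)" and C: "C \<in> carrier_mat d\<^sub>3 d\<^sub>3"
  show "?F (kron A C) = ?G (kron A C)"
    using A
  proof (induction rule: kron_induct)
    case zero
    show ?case by (simp only: kron_zero_left[OF C] linear_map_zero[OF F] linear_map_zero[OF G])
  next
    case (add Y Z)
    then show ?case
      by (simp only: kron_add_left[OF add(1,2) C] linear_mapD(2)[OF F kron_carrier[OF add(1) C] kron_carrier[OF add(2) C]]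
          linear_mapD(2)[OF G kron_carrier[OF add(1) C] kron_carrier[OF add(2) C]])
  next
    case (smult c Y)
    then show ?case
      by (simp only: kron_smult_left linear_mapD(3)[OF F kron_carrier[OF smult(1) C]]
          linear_mapD(3)[OF G kron_carrier[OF smult(1) C]])
  next
    case (kron A B)
    note c = linear_mapD(1)[OF L(1) kron(1)] linear_mapD(1)[OF L(2) kron(2)]
    have "?F (kron (kron A B) C) = kron (kron (\<Phi>\<^sub>1 A) (\<Phi>\<^sub>2 B)) (\<Phi>\<^sub>3 C)"
      by (simp only: tensor_map_kron[OF T12 L(3) kron_carrier[OF kron] C] tensor_map_kron[OF L(1,2) kron])
    moreover have "?G (kron A (kron B C)) = kron (\<Phi>\<^sub>1 A) (kron (\<Phi>\<^sub>2 B) (\<Phi>\<^sub>3 C))"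
      by (simp only: tensor_map_kron[OF L(1) T23 kron(1) kron_carrier[OF kron(2) C]] tensor_map_kron[OF L(2,3) kron(2) C])
    ultimately show ?case by (simp add: kron_assoc)
  qed
qed

lemma tensor_map_cong_right:
  assumes "\<And>X. X \<in> carrier_mat d\<^sub>2 d\<^sub>2 \<Longrightarrow> \<Psi> X = \<Psi>' X"
  shows "tensor_map d\<^sub>1 k\<^sub>1 \<Phi> d\<^sub>2 k\<^sub>2 \<Psi> = tensor_map d\<^sub>1 k\<^sub>1 \<Phi> d\<^sub>2 k\<^sub>2 \<Psi>'"
  by (simp add: tensor_map_def assms fun_eq_iff)

text \<open>The recursion splits off a factor on the left, hence the induction on \<open>m\<close>,
  with regrouping by \<open>tensor_map_assoc\<close>. For \<open>m = 0\<close> the left factor is a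
  1 by 1 matrix and acts as a scalar.\<close>

lemma tensor_power_map_add:
  assumes L: "linear_map d k \<Phi>" and X: "X \<in> carrier_mat (d ^ m * d ^ n) (d ^ m * d ^ n)"
  shows "tensor_power_map d k \<Phi> (m + n) X
    = tensor_map (d ^ m) (k ^ m) (tensor_power_map d k \<Phi> m) (d ^ n) (k ^ n) (tensor_power_map d k \<Phi> n) X"
  using X
proof (induction m arbitrary: X)
  case 0
  note Ln = linear_map_tensor_power[OF L, of n]
  have "tensor_power_map d k \<Phi> n X = tensor_map 1 1 (\<lambda>X. X) (d ^ n) (k ^ n) (tensor_power_map d k \<Phi> n) X"
  proof (rule linear_map_eqI_kron[where m = 1 and n = "d ^ n" and k = "k ^ n" and F = "tensor_power_map d k \<Phi> n"
        and G = "tensor_map 1 1 (\<lambda>X. X) (d ^ n) (k ^ n) (tensor_power_map d k \<Phi> n)"])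
    show "linear_map (1 * d ^ n) (k ^ n) (tensor_power_map d k \<Phi> n)" using Ln by simp
    show "linear_map (1 * d ^ n) (k ^ n) (tensor_map 1 1 (\<lambda>X. X) (d ^ n) (k ^ n) (tensor_power_map d k \<Phi> n))"
      using linear_map_tensor[of 1 "d ^ n" 1 "k ^ n"] by simp
    fix A B :: "complex mat" assume A: "A \<in> carrier_mat 1 1" and B: "B \<in> carrier_mat (d ^ n) (d ^ n)"
    have A1: "A = A $$ (0, 0) \<cdot>\<^sub>m 1\<^sub>m 1" using A by (intro eq_matI) auto
    have kron: "kron A B' = A $$ (0, 0) \<cdot>\<^sub>m B'" for B'
      by (subst A1) (simp only: kron_smult_left kron_one_left)
    have "tensor_map 1 1 (\<lambda>X. X) (d ^ n) (k ^ n) (tensor_power_map d k \<Phi> n) (kron A B)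
        = kron A (tensor_power_map d k \<Phi> n B)"
      by (rule tensor_map_kron[OF linear_map_id Ln A B])
    also have "\<dots> = tensor_power_map d k \<Phi> n (kron A B)"
      by (simp only: kron linear_mapD(3)[OF Ln B])
    finally show "tensor_power_map d k \<Phi> n (kron A B)
        = tensor_map 1 1 (\<lambda>X. X) (d ^ n) (k ^ n) (tensor_power_map d k \<Phi> n) (kron A B)" ..
  qed (use 0 in simp)
  then show ?case by simp
next
  case (Suc m)
  let ?P = "tensor_power_map d k \<Phi>"
  have "?P (Suc m + n) X = tensor_map d k \<Phi> (d ^ m * d ^ n) (k ^ m * k ^ n) (?P (m + n)) X"
    by (simp add: power_add)
  also have "\<dots> = tensor_map d k \<Phi> (d ^ m * d ^ n) (k ^ m * k ^ n)
      (tensor_map (d ^ m) (k ^ m) (?P m) (d ^ n) (k ^ n) (?P n)) X"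
    by (rule fun_cong[OF tensor_map_cong_right]) (rule Suc.IH)
  also have "\<dots> = tensor_map (d * d ^ m) (k * k ^ m) (tensor_map d k \<Phi> (d ^ m) (k ^ m) (?P m)) (d ^ n) (k ^ n) (?P n) X"
    using Suc.prems by (intro tensor_map_assoc[symmetric] L linear_map_tensor_power[OF L]) simp
  finally show ?case by simp
qed

lemma correctable_tensor_power_add:
  assumes L: "linear_map d k \<Phi>"
    and S: "correctable (d ^ m) (k ^ m) (tensor_power_map d k \<Phi> m) S"
    and T: "correctable (d ^ n) (k ^ n) (tensor_power_map d k \<Phi> n) T"
  shows "correctable (d ^ (m + n)) (k ^ (m + n)) (tensor_power_map d k \<Phi> (m + n)) (kron_span (d ^ (m + n)) S T)"
proof -
  note Lm = linear_map_tensor_power[OF L, of m] and Ln = linear_map_tensor_power[OF L, of n]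
  have "correctable (d ^ m * d ^ n) (k ^ m * k ^ n) (tensor_power_map d k \<Phi> (m + n)) U
      \<longleftrightarrow> correctable (d ^ m * d ^ n) (k ^ m * k ^ n)
        (tensor_map (d ^ m) (k ^ m) (tensor_power_map d k \<Phi> m) (d ^ n) (k ^ n) (tensor_power_map d k \<Phi> n)) U" for U
  proof (rule correctable_cong)
    show "linear_map (d ^ m * d ^ n) (k ^ m * k ^ n) (tensor_power_map d k \<Phi> (m + n))"
      using linear_map_tensor_power[OF L, of "m + n"] by (simp add: power_add)
  qed (auto intro: linear_map_tensor tensor_power_map_add[OF L])
  then show ?thesis
    using correctable_tensor[OF Lm Ln S T] by (simp add: power_add)
qed

section \<open>Matrix representations of tensor products of *-algebras\<close>

fun krons :: "nat \<Rightarrow> (nat \<Rightarrow> complex mat) \<Rightarrow> complex mat" where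
  "krons 0 X = 1\<^sub>m 1"
| "krons (Suc N) X = kron (krons N X) (X N)"

lemma krons_carrier:
  "(\<And>i. i < N \<Longrightarrow> X i \<in> carrier_mat (D i) (D i)) \<Longrightarrow>
    krons N X \<in> carrier_mat (\<Prod>i<N. D i) (\<Prod>i<N. D i)"
  by (induction N) (auto intro!: kron_carrier)

lemma krons_cong: "(\<And>i. i < N \<Longrightarrow> X i = Y i) \<Longrightarrow> krons N X = krons N Y"
  by (induction N) auto

lemma krons_mult:
  assumes "\<And>i. i < N \<Longrightarrow> X i \<in> carrier_mat (D i) (D i)" "\<And>i. i < N \<Longrightarrow> Y i \<in> carrier_mat (D i) (D i)"
  shows "krons N (\<lambda>i. X i * Y i) = krons N X * krons N Y"
  using assms
proof (induction N)
  case (Suc N)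
  have "krons N X \<in> carrier_mat (\<Prod>i<N. D i) (\<Prod>i<N. D i)" "krons N Y \<in> carrier_mat (\<Prod>i<N. D i) (\<Prod>i<N. D i)"
    using Suc.prems by (auto intro!: krons_carrier)
  then show ?case
    using Suc.IH Suc.prems kron_mult[of "krons N X" _ _ "krons N Y" _ "X N" "D N" "D N" "Y N" "D N"] by simp
qed simp

lemma krons_adjoint: "krons N (\<lambda>i. mat_adjoint (X i)) = mat_adjoint (krons N X)"
  by (induction N) (simp_all add: kron_adjoint)

lemma krons_update_add:
  assumes X: "\<And>j. j < N \<Longrightarrow> X j \<in> carrier_mat (D j) (D j)" and i: "i < N"
    and A: "A \<in> carrier_mat (D i) (D i)" and B: "B \<in> carrier_mat (D i) (D i)"
  shows "krons N (X(i := A + B)) = krons N (X(i := A)) + krons N (X(i := B))"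
  using X i
proof (induction N)
  case (Suc N)
  show ?case
  proof (cases "i = N")
    case True
    have "krons N (X(N := C)) = krons N X" for C by (rule krons_cong) simp
    moreover have "krons N X \<in> carrier_mat (\<Prod>i<N. D i) (\<Prod>i<N. D i)"
      using Suc.prems by (intro krons_carrier) simp
    ultimately show ?thesis
      using True A B by (simp add: kron_add_right fun_upd_same del: fun_upd_apply)
  next
    case False
    then have i: "i < N" using Suc.prems by simp
    have c: "krons N (X(i := C)) \<in> carrier_mat (\<Prod>i<N. D i) (\<Prod>i<N. D i)" if "C \<in> carrier_mat (D i) (D i)" for C
      using Suc.prems that by (intro krons_carrier) auto
    have N: "X N \<in> carrier_mat (D N) (D N)" using Suc.prems by simp
    show ?thesis
      using False Suc.IH[OF _ i] Suc.prems by (simp add: kron_add_left[OF c[OF A] c[OF B] N] fun_upd_other del: fun_upd_apply)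
  qed
qed simp

lemma krons_update_smult:
  assumes "i < N"
  shows "krons N (X(i := c \<cdot>\<^sub>m A)) = c \<cdot>\<^sub>m krons N (X(i := A))"
  using assms
proof (induction N)
  case (Suc N)
  show ?case
  proof (cases "i = N")
    case True
    have "krons N (X(N := C)) = krons N X" for C by (rule krons_cong) simp
    then show ?thesis using True by (simp add: kron_smult_right fun_upd_same del: fun_upd_apply)
  next
    case False
    then show ?thesis using Suc by (simp add: kron_smult_left fun_upd_other del: fun_upd_apply)
  qed
qed simp

section \<open>Linear functionals and multilinear forms\<close>

definition linear_functional :: "'a star_algebra \<Rightarrow> ('a \<Rightarrow> complex) \<Rightarrow> bool" where
  "linear_functional A \<phi> \<longleftrightarrow>
     (\<forall>x\<in>carrier A. \<forall>y\<in>carrier A. \<phi> (aadd A x y) = \<phi> x + \<phi> y) \<and>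
     (\<forall>x\<in>carrier A. \<forall>c. \<phi> (ascale A c x) = c * \<phi> x)"

lemma linear_functional_zero:
  assumes "star_algebra A" "linear_functional A \<phi>"
  shows "\<phi> (azero A) = 0"
proof -
  have z: "azero A \<in> carrier A" by (rule star_algebra.zero_closed[OF assms(1)])
  have "\<phi> (aadd A (azero A) (azero A)) = \<phi> (azero A) + \<phi> (azero A)"
    using assms(2) z by (simp add: linear_functional_def)
  then show ?thesis by (simp add: star_algebra.add_zero[OF assms(1) z])
qed

text \<open>The combination is described by its values under all linear functionals. This is all
  that \<open>dual_basis\<close> uses, and it avoids iterated sums inside the algebra.\<close>

lemma linear_combination_exists:
  assumes A: "star_algebra A" and "finite P" and x: "x \<in> carrier A" and "\<And>r. r \<in> P \<Longrightarrow> e r \<in> carrier A"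
  obtains w where "w \<in> carrier A"
    "\<And>\<phi>. linear_functional A \<phi> \<Longrightarrow> \<phi> w = \<phi> x + (\<Sum>r\<in>P. c r * \<phi> (e r))"
proof -
  interpret star_algebra A by (rule A)
  have "\<exists>w\<in>carrier A. \<forall>\<phi>. linear_functional A \<phi> \<longrightarrow> \<phi> w = \<phi> x + (\<Sum>r\<in>P. c r * \<phi> (e r))"
    using assms(2,4)
  proof induction
    case empty
    then show ?case using x by auto
  next
    case (insert p P)
    then obtain w where w: "w \<in> carrier A"
      "\<And>\<phi>. linear_functional A \<phi> \<Longrightarrow> \<phi> w = \<phi> x + (\<Sum>r\<in>P. c r * \<phi> (e r))" by auto
    then show ?case
      using insert by (intro bexI[of _ "aadd A w (ascale A (c p) (e p))"])
        (auto simp: linear_functional_def scale_closed add_closed)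
  qed
  then show thesis using that by blast
qed

text \<open>A basis dual to jointly injective coordinates, by Gaussian elimination. It is independent of
  the functional, so the expansion can be applied to one slot of a multilinear form.\<close>

lemma dual_basis:
  assumes A: "star_algebra A" and "finite P"
    and \<xi>: "\<And>p. p \<in> P \<Longrightarrow> linear_functional A (\<xi> p)"
    and "W \<subseteq> carrier A"
    and "\<And>x y. x \<in> W \<Longrightarrow> y \<in> W \<Longrightarrow> aadd A x y \<in> W" "\<And>x c. x \<in> W \<Longrightarrow> ascale A c x \<in> W"
    and "\<And>x. x \<in> W \<Longrightarrow> (\<And>p. p \<in> P \<Longrightarrow> \<xi> p x = 0) \<Longrightarrow> x = azero A"
  shows "\<exists>e. (\<forall>p\<in>P. e p \<in> carrier A) \<and>
    (\<forall>\<phi> x. linear_functional A \<phi> \<longrightarrow> x \<in> W \<longrightarrow> \<phi> x = (\<Sum>p\<in>P. \<xi> p x * \<phi> (e p)))"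
  using assms(2-)
proof (induction P arbitrary: W)
  case empty
  then show ?case using linear_functional_zero[OF A] by auto
next
  case (insert p P)
  interpret star_algebra A by (rule A)
  have lin: "x \<in> W \<Longrightarrow> y \<in> W \<Longrightarrow> \<xi> p (aadd A x y) = \<xi> p x + \<xi> p y"
    "x \<in> W \<Longrightarrow> \<xi> p (ascale A c x) = c * \<xi> p x" for x y c
    using insert.prems(1)[of p] subsetD[OF insert.prems(2)] by (simp_all add: linear_functional_def)
  let ?W = "{x \<in> W. \<xi> p x = 0}"
  have "\<exists>e. (\<forall>p\<in>P. e p \<in> carrier A) \<and>
    (\<forall>\<phi> x. linear_functional A \<phi> \<longrightarrow> x \<in> ?W \<longrightarrow> \<phi> x = (\<Sum>p\<in>P. \<xi> p x * \<phi> (e p)))"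
  proof (rule insert.IH)
    show "linear_functional A (\<xi> r)" if "r \<in> P" for r using insert.prems(1) that by simp
    show "?W \<subseteq> carrier A" using insert.prems(2) by blast
    show "aadd A x y \<in> ?W" if "x \<in> ?W" "y \<in> ?W" for x y using that insert.prems(3) by (simp add: lin)
    show "ascale A c x \<in> ?W" if "x \<in> ?W" for x c using that insert.prems(4) by (simp add: lin)
    show "x = azero A" if "x \<in> ?W" "\<And>r. r \<in> P \<Longrightarrow> \<xi> r x = 0" for x
      using that by (intro insert.prems(5)) auto
  qed
  then obtain e where e: "\<And>r. r \<in> P \<Longrightarrow> e r \<in> carrier A"
    "\<And>\<phi> x. linear_functional A \<phi> \<Longrightarrow> x \<in> ?W \<Longrightarrow> \<phi> x = (\<Sum>p\<in>P. \<xi> p x * \<phi> (e p))" by blast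
  show ?case
  proof (cases "W \<subseteq> ?W")
    case True
    \<comment> \<open>Here \<open>\<xi> p\<close> vanishes on all of \<open>W\<close>, so the vector
      attached to \<open>p\<close> does not matter; zero is taken.\<close>
    have "\<phi> x = (\<Sum>r\<in>insert p P. \<xi> r x * \<phi> ((e(p := azero A)) r))" if "linear_functional A \<phi>" "x \<in> W" for \<phi> x
    proof -
      have "(\<Sum>r\<in>P. \<xi> r x * \<phi> ((e(p := azero A)) r)) = (\<Sum>r\<in>P. \<xi> r x * \<phi> (e r))"
        using insert.hyps by (intro sum.cong) auto
      then show ?thesis
        using insert.hyps e(2)[OF that(1), of x] True that linear_functional_zero[OF A that(1)] by auto
    qed
    then show ?thesis
      using e(1) zero_closed by (intro exI[of _ "e(p := azero A)"]) auto
  next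
    case False
    then obtain y where y: "y \<in> W" "\<xi> p y \<noteq> 0" by blast
    \<comment> \<open>Normalised to \<open>\<xi> p x0 = 1\<close>. The vector \<open>w\<close> is
      \<open>x0\<close> minus its expansion along \<open>e\<close>; subtracting
      \<open>\<xi> p x\<close> times \<open>x0\<close> from \<open>x\<close> lands in
      \<open>?W\<close>, and the expansion available there rearranges to the one required.\<close>
    define x0 where "x0 = ascale A (1 / \<xi> p y) y"
    have x0: "x0 \<in> W" "\<xi> p x0 = 1" "x0 \<in> carrier A"
      using y insert.prems by (auto simp: x0_def lin)
    obtain w where w: "w \<in> carrier A"
      "\<And>\<phi>. linear_functional A \<phi> \<Longrightarrow> \<phi> w = \<phi> x0 + (\<Sum>r\<in>P. - \<xi> r x0 * \<phi> (e r))"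
      using linear_combination_exists[OF A insert.hyps(1) x0(3), of e "\<lambda>r. - \<xi> r x0"] e(1) by blast
    have "\<phi> x = (\<Sum>r\<in>insert p P. \<xi> r x * \<phi> ((e(p := w)) r))" if \<phi>: "linear_functional A \<phi>" and x: "x \<in> W" for \<phi> x
    proof -
      let ?z = "aadd A x (ascale A (- \<xi> p x) x0)"
      have xc: "x \<in> carrier A" using x insert.prems by auto
      have add: "\<psi> ?z = \<psi> x - \<xi> p x * \<psi> x0" if "linear_functional A \<psi>" for \<psi>
        using that xc x0(3) scale_closed[OF x0(3), of "- \<xi> p x"] by (simp add: linear_functional_def)
      have "?z \<in> ?W"
        using x x0 insert.prems(3,4) add[OF insert.prems(1)[of p]] by auto
      then have "\<phi> x - \<xi> p x * \<phi> x0 = (\<Sum>r\<in>P. \<xi> r ?z * \<phi> (e r))"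
        using e(2)[OF \<phi>] add[OF \<phi>] by metis
      also have "\<dots> = (\<Sum>r\<in>P. \<xi> r x * \<phi> (e r)) - \<xi> p x * (\<Sum>r\<in>P. \<xi> r x0 * \<phi> (e r))"
        using insert.prems(1) by (simp add: add algebra_simps sum_subtractf sum_distrib_left)
      finally have "\<phi> x = \<xi> p x * \<phi> w + (\<Sum>r\<in>P. \<xi> r x * \<phi> (e r))"
        by (simp add: w(2)[OF \<phi>] sum_negf algebra_simps)
      moreover have "(\<Sum>r\<in>P. \<xi> r x * \<phi> ((e(p := w)) r)) = (\<Sum>r\<in>P. \<xi> r x * \<phi> (e r))"
        using insert.hyps by (intro sum.cong) auto
      ultimately show ?thesis using insert.hyps by simp
    qed
    then show ?thesis
      using e(1) w(1) by (intro exI[of _ "e(p := w)"]) auto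
  qed
qed

lemma star_homD:
  assumes "star_hom A B \<pi>"
  shows "x \<in> carrier A \<Longrightarrow> \<pi> x \<in> carrier B"
    "x \<in> carrier A \<Longrightarrow> y \<in> carrier A \<Longrightarrow> \<pi> (aadd A x y) = aadd B (\<pi> x) (\<pi> y)"
    "x \<in> carrier A \<Longrightarrow> \<pi> (ascale A c x) = ascale B c (\<pi> x)"
    "x \<in> carrier A \<Longrightarrow> y \<in> carrier A \<Longrightarrow> \<pi> (amult A x y) = amult B (\<pi> x) (\<pi> y)"
    "x \<in> carrier A \<Longrightarrow> \<pi> (astar A x) = astar B (\<pi> x)"
  using assms by (auto simp: star_hom_def)

lemma tuplesD: "x \<in> tuples N A \<Longrightarrow> i < N \<Longrightarrow> x i \<in> carrier (A i)"
  by (auto simp: tuples_def)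

lemma multilinear_formD:
  assumes "multilinear_form N A \<beta>" "x \<in> tuples N A" "i < N" "u \<in> carrier (A i)"
  shows "v \<in> carrier (A i) \<Longrightarrow> \<beta> (x(i := aadd (A i) u v)) = \<beta> (x(i := u)) + \<beta> (x(i := v))"
    "\<beta> (x(i := ascale (A i) c u)) = c * \<beta> (x(i := u))"
  using assms unfolding multilinear_form_def by blast+

lemma multilinear_formI:
  assumes "\<And>x i u v. x \<in> tuples N A \<Longrightarrow> i < N \<Longrightarrow> u \<in> carrier (A i) \<Longrightarrow> v \<in> carrier (A i) \<Longrightarrow>
      \<beta> (x(i := aadd (A i) u v)) = \<beta> (x(i := u)) + \<beta> (x(i := v))"
    and "\<And>x i u c. x \<in> tuples N A \<Longrightarrow> i < N \<Longrightarrow> u \<in> carrier (A i) \<Longrightarrow>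
      \<beta> (x(i := ascale (A i) c u)) = c * \<beta> (x(i := u))"
  shows "multilinear_form N A \<beta>"
  using assms unfolding multilinear_form_def by blast

lemma multilinear_form_cong:
  assumes A: "\<And>i. i < N \<Longrightarrow> star_algebra (A i)"
    and \<beta>: "multilinear_form N A \<beta>" and eq: "\<And>x. x \<in> tuples N A \<Longrightarrow> \<gamma> x = \<beta> x"
  shows "multilinear_form N A \<gamma>"
  by (rule multilinear_formI)
    (simp_all add: eq tuples_upd star_algebra.add_closed[OF A] star_algebra.scale_closed[OF A] multilinear_formD[OF \<beta>]
      del: fun_upd_apply)

lemma multilinear_form_sum:
  assumes "\<And>y. y \<in> F \<Longrightarrow> multilinear_form N A (f y)"
  shows "multilinear_form N A (\<lambda>x. \<Sum>y\<in>F. c y * f y x)"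
  by (rule multilinear_formI)
    (simp_all add: multilinear_formD[OF assms] distrib_left sum.distrib sum_distrib_left mult.left_commute
      del: fun_upd_apply cong: sum.cong)

lemma linear_functional_entry:
  assumes "star_hom A (matrix_algebra d (carrier_mat d d)) \<pi>" "s < d" "t < d"
  shows "linear_functional A (\<lambda>x. \<pi> x $$ (s, t))"
proof -
  have c: "\<pi> x \<in> carrier_mat d d" if "x \<in> carrier A" for x
    using star_homD(1)[OF assms(1) that] by simp
  show ?thesis
    using assms(2,3) star_homD(2,3)[OF assms(1)] by (simp add: linear_functional_def carrier_matD[OF c])
qed

text \<open>The entries of a faithful representation separate the points of each factor, so by
  \<open>dual_basis\<close> every linear functional on the factor is a combination of them.
  Induction on \<open>N\<close> expands the last slot this way and applies the hypothesis to the
  forms with that slot frozen at a dual vector.\<close>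

lemma multilinear_form_expand:
  assumes "\<And>i. i < N \<Longrightarrow> star_algebra (A i)"
    and "\<And>i. i < N \<Longrightarrow> star_hom (A i) (matrix_algebra (D i) (carrier_mat (D i) (D i))) (\<pi> i)"
    and "\<And>i. i < N \<Longrightarrow> inj_on (\<pi> i) (carrier (A i))"
    and "multilinear_form N A \<beta>"
  shows "\<exists>c. \<forall>x\<in>tuples N A.
    \<beta> x = (\<Sum>p<(\<Prod>i<N. D i). \<Sum>q<(\<Prod>i<N. D i). c p q * krons N (\<lambda>i. \<pi> i (x i)) $$ (p, q))"
  using assms
proof (induction N arbitrary: \<beta>)
  case 0
  have "tuples 0 A = {\<lambda>_. undefined}" by (simp add: tuples_def)
  then show ?case by (auto intro!: exI[of _ "\<lambda>_ _. \<beta> (\<lambda>_. undefined)"])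
next
  case (Suc N)
  let ?d = "\<Prod>i<N. D i"
  note AN = Suc.prems(1)[of N, simplified] and \<pi>N = Suc.prems(2)[of N, simplified]
  let ?P = "{..<D N} \<times> {..<D N}"
  have "\<exists>e. (\<forall>p\<in>?P. e p \<in> carrier (A N)) \<and> (\<forall>\<phi> x. linear_functional (A N) \<phi> \<longrightarrow> x \<in> carrier (A N) \<longrightarrow>
      \<phi> x = (\<Sum>p\<in>?P. \<pi> N x $$ p * \<phi> (e p)))"
  proof (rule dual_basis[OF AN])
    show "linear_functional (A N) (\<lambda>x. \<pi> N x $$ p)" if "p \<in> ?P" for p
      using that by (cases p) (auto intro: linear_functional_entry[OF \<pi>N])
    fix x assume x: "x \<in> carrier (A N)" and 0: "\<And>p. p \<in> ?P \<Longrightarrow> \<pi> N x $$ p = 0"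
    have z: "azero (A N) \<in> carrier (A N)" by (rule star_algebra.zero_closed[OF AN])
    have "\<pi> N (azero (A N)) $$ (s, t) = 0" if "s < D N" "t < D N" for s t
      using linear_functional_zero[OF AN linear_functional_entry[OF \<pi>N that]] .
    then have "\<pi> N x = \<pi> N (azero (A N))"
      using 0 star_homD(1)[OF \<pi>N x] star_homD(1)[OF \<pi>N z] by (intro eq_matI) auto
    then show "x = azero (A N)"
      using Suc.prems(3)[of N] x z by (simp add: inj_on_def)
  qed (auto intro: star_algebra.add_closed[OF AN] star_algebra.scale_closed[OF AN])
  then obtain e where *: "(\<forall>p\<in>?P. e p \<in> carrier (A N)) \<and> (\<forall>\<phi> x. linear_functional (A N) \<phi> \<longrightarrow>
      x \<in> carrier (A N) \<longrightarrow> \<phi> x = (\<Sum>p\<in>?P. \<pi> N x $$ p * \<phi> (e p)))" by (rule exE)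
  note e = *[THEN conjunct1, rule_format] *[THEN conjunct2, rule_format]
  have extend: "x(N := u) \<in> tuples (Suc N) A" if "x \<in> tuples N A" "u \<in> carrier (A N)" for x u
    using that by (auto simp: tuples_def PiE_iff extensional_def less_Suc_eq)
  have ex: "\<exists>c. \<forall>x\<in>tuples N A. \<beta> (x(N := e r)) = (\<Sum>p<?d. \<Sum>q<?d. c p q * krons N (\<lambda>i. \<pi> i (x i)) $$ (p, q))"
    if r: "r \<in> ?P" for r
  proof (rule Suc.IH)
    show "multilinear_form N A (\<lambda>x. \<beta> (x(N := e r)))"
    proof (rule multilinear_formI)
      fix x i u v c assume x: "x \<in> tuples N A" and i: "i < N" and u: "u \<in> carrier (A i)"
      have sw: "x(i := u, N := e r) = (x(N := e r))(i := u)" for u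
        using i by (simp add: fun_upd_twist)
      note D = multilinear_formD[OF Suc.prems(4) extend[OF x e(1)[OF r]] _ u]
      show "\<beta> (x(i := ascale (A i) c u, N := e r)) = c * \<beta> (x(i := u, N := e r))"
        using D(2) i by (simp add: sw del: fun_upd_apply)
      show "\<beta> (x(i := aadd (A i) u v, N := e r)) = \<beta> (x(i := u, N := e r)) + \<beta> (x(i := v, N := e r))"
        if "v \<in> carrier (A i)"
        using D(1)[OF _ that] i by (simp add: sw del: fun_upd_apply)
    qed
  qed (use Suc.prems in auto)
  have "\<exists>c. \<forall>r\<in>?P. \<forall>x\<in>tuples N A.
      \<beta> (x(N := e r)) = (\<Sum>p<?d. \<Sum>q<?d. c r p q * krons N (\<lambda>i. \<pi> i (x i)) $$ (p, q))"
    by (rule bchoice) (use ex in blast)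
  then obtain c where *: "\<forall>r\<in>?P. \<forall>x\<in>tuples N A.
      \<beta> (x(N := e r)) = (\<Sum>p<?d. \<Sum>q<?d. c r p q * krons N (\<lambda>i. \<pi> i (x i)) $$ (p, q))" by (rule exE)
  note c = *[rule_format]
  \<comment> \<open>Quotients by \<open>D N\<close> are the indices of the first \<open>N\<close>
    factors, remainders those of the last.\<close>
  let ?c = "\<lambda>p q. c (p mod D N, q mod D N) (p div D N) (q div D N)"
  have "\<beta> x = (\<Sum>p<?d * D N. \<Sum>q<?d * D N. ?c p q * krons (Suc N) (\<lambda>i. \<pi> i (x i)) $$ (p, q))"
    if x: "x \<in> tuples (Suc N) A" for x
  proof -
    \<comment> \<open>Tuples are extensional, so slot \<open>N\<close> has to be reset to
      \<open>undefined\<close> to obtain a tuple of length \<open>N\<close>.\<close>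
    let ?x = "x(N := undefined)" and ?K = "krons N (\<lambda>i. \<pi> i (x i))"
    have x': "?x \<in> tuples N A"
      using x by (auto simp: tuples_def PiE_iff extensional_def less_Suc_eq)
    have xN: "x N \<in> carrier (A N)" using tuplesD[OF x] by simp
    have K': "krons N (\<lambda>i. \<pi> i (?x i)) = ?K" by (rule krons_cong) simp
    have K: "?K \<in> carrier_mat ?d ?d"
      using star_homD(1)[OF Suc.prems(2) tuplesD[OF x]] by (intro krons_carrier) auto
    have piN: "\<pi> N (x N) \<in> carrier_mat (D N) (D N)" using star_homD(1)[OF \<pi>N xN] by simp
    have "linear_functional (A N) (\<lambda>u. \<beta> (x(N := u)))"
      unfolding linear_functional_def using multilinear_formD[OF Suc.prems(4) x, of N] by (simp del: fun_upd_apply)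
    from e(2)[OF this xN] have "\<beta> x = (\<Sum>r\<in>?P. \<pi> N (x N) $$ r * \<beta> (?x(N := e r)))"
      by simp
    also have "\<dots> = (\<Sum>r\<in>?P. \<Sum>p<?d. \<Sum>q<?d. \<pi> N (x N) $$ r * (c r p q * ?K $$ (p, q)))"
      by (intro sum.cong refl) (simp only: c[OF _ x'] K' sum_distrib_left)
    also have "\<dots> = (\<Sum>s<D N. \<Sum>t<D N. \<Sum>p<?d. \<Sum>q<?d. c (s, t) p q * (?K $$ (p, q) * \<pi> N (x N) $$ (s, t)))"
      by (rule trans[OF _ sum.cartesian_product[symmetric]]) (simp add: case_prod_unfold mult_ac)
    also have "\<dots> = (\<Sum>s<D N. \<Sum>p<?d. \<Sum>t<D N. \<Sum>q<?d. c (s, t) p q * (?K $$ (p, q) * \<pi> N (x N) $$ (s, t)))"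
      by (intro sum.cong refl sum.swap)
    also have "\<dots> = (\<Sum>p<?d. \<Sum>s<D N. \<Sum>t<D N. \<Sum>q<?d. c (s, t) p q * (?K $$ (p, q) * \<pi> N (x N) $$ (s, t)))"
      by (rule sum.swap)
    also have "\<dots> = (\<Sum>p<?d. \<Sum>s<D N. \<Sum>q<?d. \<Sum>t<D N. c (s, t) p q * (?K $$ (p, q) * \<pi> N (x N) $$ (s, t)))"
      by (intro sum.cong refl sum.swap)
    also have "\<dots> = (\<Sum>p<?d * D N. \<Sum>q<?d * D N. ?c p q * krons (Suc N) (\<lambda>i. \<pi> i (x i)) $$ (p, q))"
      by (simp add: sum_pair_index index_kron[OF K piN])
    finally show ?thesis .
  qed
  then show ?case by auto
qed

section \<open>A faithful matrix representation of the tensor product\<close>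

locale represented_tensor =
  fixes N :: nat and A :: "nat \<Rightarrow> 'a star_algebra" and D :: "nat \<Rightarrow> nat"
    and \<pi> :: "nat \<Rightarrow> 'a \<Rightarrow> complex mat"
  assumes A: "i < N \<Longrightarrow> star_algebra (A i)"
    and \<pi>: "i < N \<Longrightarrow> star_hom (A i) (matrix_algebra (D i) (carrier_mat (D i) (D i))) (\<pi> i)"
    and inj: "i < N \<Longrightarrow> inj_on (\<pi> i) (carrier (A i))"
begin

abbreviation "tdim \<equiv> \<Prod>i<N. D i"

definition K :: "(nat \<Rightarrow> 'a) \<Rightarrow> complex mat" where
  "K x = krons N (\<lambda>i. \<pi> i (x i))"

definition mul :: "(nat \<Rightarrow> 'a) \<Rightarrow> (nat \<Rightarrow> 'a) \<Rightarrow> nat \<Rightarrow> 'a" where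
  "mul x y = (\<lambda>i\<in>{..<N}. amult (A i) (x i) (y i))"

definition adj :: "(nat \<Rightarrow> 'a) \<Rightarrow> nat \<Rightarrow> 'a" where
  "adj x = (\<lambda>i\<in>{..<N}. astar (A i) (x i))"

text \<open>Tensors are functionals on multilinear forms, so a tensor is represented by its values at the
  matrix coefficients of the tensor product of the representations \<open>\<pi> i\<close>. Faithfulness
  holds since every multilinear form is a combination of these coefficients.\<close>

definition rep :: "(((nat \<Rightarrow> 'a) \<Rightarrow> complex) \<Rightarrow> complex) \<Rightarrow> complex mat" where
  "rep T = mat tdim tdim (\<lambda>(p, q). T (\<lambda>x. K x $$ (p, q)))"

lemma \<pi>_carrier: "x \<in> tuples N A \<Longrightarrow> i < N \<Longrightarrow> \<pi> i (x i) \<in> carrier_mat (D i) (D i)"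
  using star_homD(1)[OF \<pi>] tuplesD by fastforce

lemma K_carrier: "x \<in> tuples N A \<Longrightarrow> K x \<in> carrier_mat tdim tdim"
  unfolding K_def by (intro krons_carrier \<pi>_carrier)

lemma mul_tuples: "x \<in> tuples N A \<Longrightarrow> y \<in> tuples N A \<Longrightarrow> mul x y \<in> tuples N A"
  by (auto simp: mul_def tuples_def intro!: star_algebra.mult_closed[OF A])

lemma adj_tuples: "x \<in> tuples N A \<Longrightarrow> adj x \<in> tuples N A"
  by (auto simp: adj_def tuples_def intro!: star_algebra.star_closed[OF A])

lemma K_mul:
  assumes "x \<in> tuples N A" "y \<in> tuples N A"
  shows "K (mul x y) = K x * K y"
proof -
  have "K (mul x y) = krons N (\<lambda>i. \<pi> i (x i) * \<pi> i (y i))"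
    unfolding K_def using assms
    by (intro krons_cong) (simp add: mul_def star_homD(4)[OF \<pi>] tuplesD)
  then show ?thesis
    unfolding K_def using assms by (simp add: krons_mult[where D = D] \<pi>_carrier)
qed

lemma K_adj:
  assumes "x \<in> tuples N A"
  shows "K (adj x) = mat_adjoint (K x)"
  unfolding K_def krons_adjoint[symmetric] using assms
  by (intro krons_cong) (simp add: adj_def star_homD(5)[OF \<pi>] tuplesD)

lemma K_update: "K (x(i := u)) = krons N ((\<lambda>j. \<pi> j (x j))(i := \<pi> i u))"
  unfolding K_def by (intro krons_cong) simp

text \<open>Elementary tensors are 0 off the multilinear forms, so \<open>rep\<close> reads their
  true values only because the coordinates are multilinear.\<close>

lemma multilinear_coordinate:
  assumes "p < tdim" "q < tdim"
  shows "multilinear_form N A (\<lambda>x. K x $$ (p, q))"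
proof (rule multilinear_formI)
  fix x i u v c assume x: "x \<in> tuples N A" and i: "i < N" and u: "u \<in> carrier (A i)"
  have K: "K (x(i := u)) \<in> carrier_mat tdim tdim" if "u \<in> carrier (A i)" for u
    using x i that by (intro K_carrier tuples_upd)
  show "K (x(i := ascale (A i) c u)) $$ (p, q) = c * K (x(i := u)) $$ (p, q)"
    using assms K[OF u] i u by (simp add: K_update star_homD(3)[OF \<pi>] krons_update_smult)
  assume v: "v \<in> carrier (A i)"
  have c: "\<pi> i u \<in> carrier_mat (D i) (D i)" "\<pi> i v \<in> carrier_mat (D i) (D i)"
    using star_homD(1)[OF \<pi>[OF i]] u v by auto
  have "K (x(i := aadd (A i) u v)) = K (x(i := u)) + K (x(i := v))"
    using star_homD(2)[OF \<pi>[OF i] u v] krons_update_add[where D = D and X = "\<lambda>j. \<pi> j (x j)", OF \<pi>_carrier[OF x] i c] by (simp add: K_update)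
  then show "K (x(i := aadd (A i) u v)) $$ (p, q) = K (x(i := u)) $$ (p, q) + K (x(i := v)) $$ (p, q)"
    using assms K[OF u] K[OF v] by simp
qed

text \<open>The product of tensors evaluates one functional inside the other; for elementary tensors
  both evaluations need a form that is multilinear in the remaining argument.\<close>

lemma multilinear_mul:
  assumes \<beta>: "multilinear_form N A \<beta>"
  shows "y \<in> tuples N A \<Longrightarrow> multilinear_form N A (\<lambda>x. \<beta> (mul x y))"
    and "x \<in> tuples N A \<Longrightarrow> multilinear_form N A (\<lambda>y. \<beta> (mul x y))"
proof -
  have u1: "mul (x(i := u)) y = (mul x y)(i := amult (A i) u (y i))" if "i < N" for x y i u
    using that by (auto simp: mul_def fun_eq_iff)
  have u2: "mul x (y(i := u)) = (mul x y)(i := amult (A i) (x i) u)" if "i < N" for x y i u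
    using that by (auto simp: mul_def fun_eq_iff)
  show "multilinear_form N A (\<lambda>x. \<beta> (mul x y))" if y: "y \<in> tuples N A"
    by (rule multilinear_formI)
      (simp_all add: u1 star_algebra.mult_add_left[OF A] star_algebra.mult_scale_left[OF A] tuplesD[OF y]
        star_algebra.mult_closed[OF A] multilinear_formD[OF \<beta>] mul_tuples y del: fun_upd_apply)
  show "multilinear_form N A (\<lambda>y. \<beta> (mul x y))" if x: "x \<in> tuples N A"
    by (rule multilinear_formI)
      (simp_all add: u2 star_algebra.mult_add_right[OF A] star_algebra.mult_scale_right[OF A] tuplesD[OF x]
        star_algebra.mult_closed[OF A] multilinear_formD[OF \<beta>] mul_tuples x del: fun_upd_apply)
qed

lemma multilinear_adj:
  assumes \<beta>: "multilinear_form N A \<beta>"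
  shows "multilinear_form N A (\<lambda>x. cnj (\<beta> (adj x)))"
proof -
  have u: "adj (x(i := u)) = (adj x)(i := astar (A i) u)" if "i < N" for x i u
    using that by (auto simp: adj_def fun_eq_iff)
  show ?thesis
    by (rule multilinear_formI)
      (simp_all add: u star_algebra.star_add[OF A] star_algebra.star_scale[OF A] star_algebra.star_closed[OF A]
        multilinear_formD[OF \<beta>] adj_tuples del: fun_upd_apply)
qed

abbreviation "TA \<equiv> tensor_algebra N A"

lemma tensor_simps:
  "azero TA = (\<lambda>\<beta>. 0)" "aadd TA S T = (\<lambda>\<beta>. S \<beta> + T \<beta>)" "ascale TA c T = (\<lambda>\<beta>. c * T \<beta>)"
  "amult TA S T = (\<lambda>\<beta>. if multilinear_form N A \<beta> then S (\<lambda>x. T (\<lambda>y. \<beta> (mul x y))) else 0)"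
  "astar TA T = (\<lambda>\<beta>. if multilinear_form N A \<beta> then cnj (T (\<lambda>x. cnj (\<beta> (adj x)))) else 0)"
  unfolding mul_def adj_def tensor_algebra_def by simp_all

lemma tensor_carrierE:
  assumes "T \<in> carrier TA"
  obtains F c where "finite F" "F \<subseteq> tuples N A" "T = (\<lambda>\<beta>. \<Sum>x\<in>F. c x * elem_tensor N A x \<beta>)"
  using assms by (auto simp: tensor_algebra_def)

lemma elem_tensor_apply: "multilinear_form N A \<beta> \<Longrightarrow> elem_tensor N A x \<beta> = \<beta> x"
  by (simp add: elem_tensor_def)

lemma elem_tensor_0: "\<not> multilinear_form N A \<beta> \<Longrightarrow> elem_tensor N A x \<beta> = 0"
  by (simp add: elem_tensor_def)

lemma zero_in_carrier: "(\<lambda>\<beta>. 0) \<in> carrier TA"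
  by (auto simp: tensor_algebra_def intro!: exI[of _ "{}"])

lemma add_in_carrier:
  assumes "S \<in> carrier TA" "T \<in> carrier TA"
  shows "(\<lambda>\<beta>. S \<beta> + T \<beta>) \<in> carrier TA"
proof -
  obtain F c where F: "finite F" "F \<subseteq> tuples N A" "S = (\<lambda>\<beta>. \<Sum>x\<in>F. c x * elem_tensor N A x \<beta>)"
    using assms(1) by (rule tensor_carrierE)
  obtain G e where G: "finite G" "G \<subseteq> tuples N A" "T = (\<lambda>\<beta>. \<Sum>x\<in>G. e x * elem_tensor N A x \<beta>)"
    using assms(2) by (rule tensor_carrierE)
  \<comment> \<open>The index sets may overlap, so both coefficient families are extended by zero
    and added on the union.\<close>
  let ?c = "\<lambda>x. (if x \<in> F then c x else 0) + (if x \<in> G then e x else 0)"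
  have "(\<Sum>x\<in>F \<union> G. ?c x * E x) = (\<Sum>x\<in>F. c x * E x) + (\<Sum>x\<in>G. e x * E x)" for E :: "(nat \<Rightarrow> 'a) \<Rightarrow> complex"
  proof -
    have "(\<Sum>x\<in>F \<union> G. ?c x * E x) = (\<Sum>x\<in>F \<union> G. if x \<in> F then c x * E x else 0) + (\<Sum>x\<in>F \<union> G. if x \<in> G then e x * E x else 0)"
      unfolding sum.distrib[symmetric] by (intro sum.cong) (auto simp: distrib_right)
    also have "\<dots> = (\<Sum>x\<in>F. c x * E x) + (\<Sum>x\<in>G. e x * E x)"
      using F(1) G(1) by (simp add: sum.inter_restrict[symmetric] Int_absorb1)
    finally show ?thesis .
  qed
  then have "(\<lambda>\<beta>. S \<beta> + T \<beta>) = (\<lambda>\<beta>. \<Sum>x\<in>F \<union> G. ?c x * elem_tensor N A x \<beta>)"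
    using F(3) G(3) by simp
  then show ?thesis
    using F(1,2) G(1,2) unfolding tensor_algebra_def by (auto intro!: exI[of _ "F \<union> G"] exI[of _ ?c])
qed

lemma scale_in_carrier:
  assumes "T \<in> carrier TA"
  shows "(\<lambda>\<beta>. c * T \<beta>) \<in> carrier TA"
proof -
  obtain F e where F: "finite F" "F \<subseteq> tuples N A" "T = (\<lambda>\<beta>. \<Sum>x\<in>F. e x * elem_tensor N A x \<beta>)"
    using assms by (rule tensor_carrierE)
  then have "(\<lambda>\<beta>. c * T \<beta>) = (\<lambda>\<beta>. \<Sum>x\<in>F. (c * e x) * elem_tensor N A x \<beta>)"
    by (simp add: sum_distrib_left mult.assoc)
  then show ?thesis
    using F(1,2) unfolding tensor_algebra_def by (auto intro!: exI[of _ F] exI[of _ "\<lambda>x. c * e x"])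
qed

lemma elem_in_carrier: "x \<in> tuples N A \<Longrightarrow> elem_tensor N A x \<in> carrier TA"
  unfolding tensor_algebra_def by (auto intro!: exI[of _ "{x}"] exI[of _ "\<lambda>_. 1"])

lemma sum_in_carrier:
  "finite I \<Longrightarrow> (\<And>i. i \<in> I \<Longrightarrow> f i \<in> carrier TA) \<Longrightarrow> (\<lambda>\<beta>. \<Sum>i\<in>I. f i \<beta>) \<in> carrier TA"
  by (induction rule: finite_induct) (auto intro: zero_in_carrier add_in_carrier)

lemma amult_sum:
  assumes F: "F \<subseteq> tuples N A" and G: "G \<subseteq> tuples N A"
  shows "amult TA (\<lambda>\<beta>. \<Sum>x\<in>F. c x * elem_tensor N A x \<beta>) (\<lambda>\<beta>. \<Sum>y\<in>G. e y * elem_tensor N A y \<beta>)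
    = (\<lambda>\<beta>. \<Sum>x\<in>F. \<Sum>y\<in>G. c x * (e y * elem_tensor N A (mul x y) \<beta>))"
proof
  fix \<beta> :: "(nat \<Rightarrow> 'a) \<Rightarrow> complex"
  let ?\<gamma> = "\<lambda>x. \<Sum>y\<in>G. e y * elem_tensor N A y (\<lambda>y. \<beta> (mul x y))"
  show "amult TA (\<lambda>\<beta>. \<Sum>x\<in>F. c x * elem_tensor N A x \<beta>) (\<lambda>\<beta>. \<Sum>y\<in>G. e y * elem_tensor N A y \<beta>) \<beta>
    = (\<Sum>x\<in>F. \<Sum>y\<in>G. c x * (e y * elem_tensor N A (mul x y) \<beta>))"
  proof (cases "multilinear_form N A \<beta>")
    case True
    have \<gamma>: "?\<gamma> x = (\<Sum>y\<in>G. e y * \<beta> (mul x y))" if "x \<in> tuples N A" for x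
      using that by (simp add: elem_tensor_apply[OF multilinear_mul(2)[OF True]])
    have "multilinear_form N A (\<lambda>x. \<Sum>y\<in>G. e y * \<beta> (mul x y))"
    proof (rule multilinear_form_sum)
      show "multilinear_form N A (\<lambda>x. \<beta> (mul x y))" if "y \<in> G" for y
        using that G by (intro multilinear_mul(1)[OF True]) auto
    qed
    \<comment> \<open>\<open>?\<gamma>\<close> is given by the explicit sum only at tuples, which is
      enough for multilinearity.\<close>
    then have "multilinear_form N A ?\<gamma>"
      by (rule multilinear_form_cong[rotated]) (simp_all only: \<gamma> A)
    then have "elem_tensor N A x ?\<gamma> = (\<Sum>y\<in>G. e y * \<beta> (mul x y))" if "x \<in> F" for x
      using that F \<gamma> by (subst elem_tensor_apply) auto
    then show ?thesis
      using True by (simp add: tensor_simps elem_tensor_apply[OF True] sum_distrib_left)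
  qed (simp add: tensor_simps elem_tensor_0)
qed

lemma astar_sum:
  "astar TA (\<lambda>\<beta>. \<Sum>x\<in>F. c x * elem_tensor N A x \<beta>) = (\<lambda>\<beta>. \<Sum>x\<in>F. cnj (c x) * elem_tensor N A (adj x) \<beta>)"
proof
  fix \<beta> :: "(nat \<Rightarrow> 'a) \<Rightarrow> complex"
  show "astar TA (\<lambda>\<beta>. \<Sum>x\<in>F. c x * elem_tensor N A x \<beta>) \<beta> = (\<Sum>x\<in>F. cnj (c x) * elem_tensor N A (adj x) \<beta>)"
  proof (cases "multilinear_form N A \<beta>")
    case True
    then show ?thesis
      by (simp add: tensor_simps elem_tensor_apply[OF True] elem_tensor_apply[OF multilinear_adj[OF True]])
  qed (simp add: tensor_simps elem_tensor_0)
qed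

lemma rep_carrier: "rep T \<in> carrier_mat tdim tdim"
  by (simp add: rep_def)

lemma index_rep_sum:
  assumes "p < tdim" "q < tdim"
  shows "rep (\<lambda>\<beta>. \<Sum>x\<in>F. c x * elem_tensor N A x \<beta>) $$ (p, q) = (\<Sum>x\<in>F. c x * K x $$ (p, q))"
  using assms by (simp add: rep_def elem_tensor_apply[OF multilinear_coordinate])

lemma rep_mult:
  assumes "S \<in> carrier TA" "T \<in> carrier TA"
  shows "rep (amult TA S T) = rep S * rep T"
proof -
  obtain F c where F: "finite F" "F \<subseteq> tuples N A" "S = (\<lambda>\<beta>. \<Sum>x\<in>F. c x * elem_tensor N A x \<beta>)"
    using assms(1) by (rule tensor_carrierE)
  obtain G e where G: "finite G" "G \<subseteq> tuples N A" "T = (\<lambda>\<beta>. \<Sum>x\<in>G. e x * elem_tensor N A x \<beta>)"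
    using assms(2) by (rule tensor_carrierE)
  show ?thesis
  proof (rule eq_matI)
    fix p q assume "p < dim_row (rep S * rep T)" "q < dim_col (rep S * rep T)"
    then have pq: "p < tdim" "q < tdim" by (simp_all add: rep_def)
    have "rep (amult TA S T) $$ (p, q) = (\<Sum>x\<in>F. \<Sum>y\<in>G. c x * (e y * K (mul x y) $$ (p, q)))"
      using pq unfolding F(3) G(3) amult_sum[OF F(2) G(2)]
      by (simp add: rep_def elem_tensor_apply[OF multilinear_coordinate])
    also have "\<dots> = (\<Sum>x\<in>F. \<Sum>y\<in>G. \<Sum>t<tdim. (c x * K x $$ (p, t)) * (e y * K y $$ (t, q)))"
    proof (intro sum.cong refl)
      fix x y assume "x \<in> F" "y \<in> G"
      then have xy: "x \<in> tuples N A" "y \<in> tuples N A" using F(2) G(2) by auto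
      show "c x * (e y * K (mul x y) $$ (p, q)) = (\<Sum>t<tdim. (c x * K x $$ (p, t)) * (e y * K y $$ (t, q)))"
        unfolding K_mul[OF xy] index_mult_mat_sum[OF K_carrier[OF xy(1)] K_carrier[OF xy(2)] pq] sum_distrib_left
        by (simp add: algebra_simps)
    qed
    also have "\<dots> = (\<Sum>x\<in>F. \<Sum>t<tdim. \<Sum>y\<in>G. (c x * K x $$ (p, t)) * (e y * K y $$ (t, q)))"
      by (intro sum.cong refl sum.swap)
    also have "\<dots> = (\<Sum>t<tdim. \<Sum>x\<in>F. \<Sum>y\<in>G. (c x * K x $$ (p, t)) * (e y * K y $$ (t, q)))"
      by (rule sum.swap)
    also have "\<dots> = (\<Sum>t<tdim. rep S $$ (p, t) * rep T $$ (t, q))"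
      using pq unfolding F(3) G(3) by (simp add: index_rep_sum sum_product)
    also have "\<dots> = (rep S * rep T) $$ (p, q)"
      using pq by (simp only: index_mult_mat_sum[OF rep_carrier rep_carrier])
    finally show "rep (amult TA S T) $$ (p, q) = (rep S * rep T) $$ (p, q)" .
  qed (simp_all add: rep_def)
qed

lemma rep_star:
  assumes "T \<in> carrier TA"
  shows "rep (astar TA T) = mat_adjoint (rep T)"
proof -
  obtain F c where F: "finite F" "F \<subseteq> tuples N A" "T = (\<lambda>\<beta>. \<Sum>x\<in>F. c x * elem_tensor N A x \<beta>)"
    using assms(1) by (rule tensor_carrierE)
  show ?thesis
  proof (rule eq_matI)
    fix p q assume "p < dim_row (mat_adjoint (rep T))" "q < dim_col (mat_adjoint (rep T))"
    then have pq: "p < tdim" "q < tdim" by (simp_all add: rep_def)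
    have "rep (astar TA T) $$ (p, q) = (\<Sum>x\<in>F. cnj (c x) * K (adj x) $$ (p, q))"
      using pq unfolding F(3) astar_sum
      by (simp add: rep_def elem_tensor_apply[OF multilinear_coordinate])
    also have "\<dots> = (\<Sum>x\<in>F. cnj (c x * K x $$ (q, p)))"
    proof (intro sum.cong refl)
      fix x assume "x \<in> F"
      then have x: "x \<in> tuples N A" using F(2) by auto
      show "cnj (c x) * K (adj x) $$ (p, q) = cnj (c x * K x $$ (q, p))"
        using K_carrier[OF x] pq by (simp add: K_adj[OF x])
    qed
    also have "\<dots> = mat_adjoint (rep T) $$ (p, q)"
      using pq rep_carrier[of T] unfolding F(3) by (simp add: index_rep_sum del: cnj.simps)
    finally show "rep (astar TA T) $$ (p, q) = mat_adjoint (rep T) $$ (p, q)" .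
  qed (simp_all add: rep_def)
qed

lemma tensor_closed:
  shows "azero TA \<in> carrier TA"
    and "S \<in> carrier TA \<Longrightarrow> T \<in> carrier TA \<Longrightarrow> aadd TA S T \<in> carrier TA"
    and "T \<in> carrier TA \<Longrightarrow> ascale TA c T \<in> carrier TA"
    and "S \<in> carrier TA \<Longrightarrow> T \<in> carrier TA \<Longrightarrow> amult TA S T \<in> carrier TA"
    and "T \<in> carrier TA \<Longrightarrow> astar TA T \<in> carrier TA"
proof -
  show "azero TA \<in> carrier TA" by (simp add: tensor_simps zero_in_carrier)
  show "aadd TA S T \<in> carrier TA" if "S \<in> carrier TA" "T \<in> carrier TA"
    using that by (simp add: tensor_simps add_in_carrier)
  show "ascale TA c T \<in> carrier TA" if "T \<in> carrier TA"
    using that by (simp add: tensor_simps scale_in_carrier)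
  show "amult TA S T \<in> carrier TA" if ST: "S \<in> carrier TA" "T \<in> carrier TA"
  proof -
    obtain F c where F: "finite F" "F \<subseteq> tuples N A" "S = (\<lambda>\<beta>. \<Sum>x\<in>F. c x * elem_tensor N A x \<beta>)"
      using ST(1) by (rule tensor_carrierE)
    obtain G e where G: "finite G" "G \<subseteq> tuples N A" "T = (\<lambda>\<beta>. \<Sum>x\<in>G. e x * elem_tensor N A x \<beta>)"
      using ST(2) by (rule tensor_carrierE)
    show ?thesis
      unfolding F(3) G(3) amult_sum[OF F(2) G(2)]
      using F(1,2) G(1,2) by (intro sum_in_carrier scale_in_carrier elem_in_carrier mul_tuples) auto
  qed
  show "astar TA T \<in> carrier TA" if T: "T \<in> carrier TA"
  proof -
    obtain F c where F: "finite F" "F \<subseteq> tuples N A" "T = (\<lambda>\<beta>. \<Sum>x\<in>F. c x * elem_tensor N A x \<beta>)"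
      using T by (rule tensor_carrierE)
    show ?thesis
      unfolding F(3) astar_sum
      using F(1,2) by (intro sum_in_carrier scale_in_carrier elem_in_carrier adj_tuples) auto
  qed
qed

lemma star_hom_rep: "star_hom TA (matrix_algebra tdim (carrier_mat tdim tdim)) rep"
  unfolding star_hom_def
  by (auto simp: rep_carrier rep_mult rep_star) (auto simp: tensor_simps rep_def intro!: eq_matI)

text \<open>Tensors are combinations of evaluations, so they respect an expansion of
  \<open>\<beta>\<close> that holds at tuples only. Hence the matrix \<open>rep T\<close> determines
  \<open>T\<close> at every expandable form.\<close>

lemma tensor_expand:
  assumes \<beta>: "multilinear_form N A \<beta>"
    and c: "\<And>x. x \<in> tuples N A \<Longrightarrow> \<beta> x = (\<Sum>p<tdim. \<Sum>q<tdim. c p q * K x $$ (p, q))"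
    and T: "T \<in> carrier TA"
  shows "T \<beta> = (\<Sum>p<tdim. \<Sum>q<tdim. c p q * rep T $$ (p, q))"
proof -
  obtain F e where F: "finite F" "F \<subseteq> tuples N A" "T = (\<lambda>\<beta>. \<Sum>x\<in>F. e x * elem_tensor N A x \<beta>)"
    using T by (rule tensor_carrierE)
  have "T \<beta> = (\<Sum>x\<in>F. \<Sum>p<tdim. \<Sum>q<tdim. c p q * (e x * K x $$ (p, q)))"
    unfolding F(3) using F(2)
    by (auto simp: elem_tensor_apply[OF \<beta>] c sum_distrib_left mult.left_commute intro!: sum.cong)
  also have "\<dots> = (\<Sum>p<tdim. \<Sum>x\<in>F. \<Sum>q<tdim. c p q * (e x * K x $$ (p, q)))"
    by (rule sum.swap)
  also have "\<dots> = (\<Sum>p<tdim. \<Sum>q<tdim. \<Sum>x\<in>F. c p q * (e x * K x $$ (p, q)))"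
    by (intro sum.cong refl sum.swap)
  also have "\<dots> = (\<Sum>p<tdim. \<Sum>q<tdim. c p q * rep T $$ (p, q))"
    unfolding F(3) by (simp add: index_rep_sum sum_distrib_left)
  finally show ?thesis .
qed

lemma inj_rep: "inj_on rep (carrier TA)"
proof (rule inj_onI, rule ext)
  fix S T \<beta> assume ST: "S \<in> carrier TA" "T \<in> carrier TA" "rep S = rep T"
  show "S \<beta> = T \<beta>"
  proof (cases "multilinear_form N A \<beta>")
    case True
    then obtain c where "\<And>x. x \<in> tuples N A \<Longrightarrow> \<beta> x = (\<Sum>p<tdim. \<Sum>q<tdim. c p q * K x $$ (p, q))"
      using multilinear_form_expand[where N = N and A = A and D = D and \<pi> = \<pi> and \<beta> = \<beta>] A \<pi> inj unfolding K_def by blast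
    from tensor_expand[OF True this ST(1)] tensor_expand[OF True this ST(2)] ST(3) show ?thesis by simp
  next
    case False
    \<comment> \<open>Tensors are zero by convention off the multilinear forms, so no information is
      lost there.\<close>
    have "X \<beta> = 0" if X: "X \<in> carrier TA" for X
    proof -
      obtain F c where "X = (\<lambda>\<beta>. \<Sum>x\<in>F. c x * elem_tensor N A x \<beta>)"
        using X by (rule tensor_carrierE)
      then show ?thesis using False by (simp add: elem_tensor_0)
    qed
    from this[OF ST(1)] this[OF ST(2)] show ?thesis by simp
  qed
qed

lemma rep_in_subalgebra:
  assumes S: "star_subalgebra tdim S" and K: "\<And>x. x \<in> tuples N A \<Longrightarrow> K x \<in> S" and T: "T \<in> carrier TA"
  shows "rep T \<in> S"
proof -
  note DS = star_subalgebraD[OF S]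
  obtain F c where F: "finite F" "F \<subseteq> tuples N A" "T = (\<lambda>\<beta>. \<Sum>x\<in>F. c x * elem_tensor N A x \<beta>)"
    using T by (rule tensor_carrierE)
  have "rep (\<lambda>\<beta>. \<Sum>x\<in>F. c x * elem_tensor N A x \<beta>) \<in> S"
    using F(1,2)
  proof induction
    case empty
    have "rep (\<lambda>\<beta>. \<Sum>x\<in>{}. c x * elem_tensor N A x \<beta>) = 0\<^sub>m tdim tdim"
      by (intro eq_matI) (simp_all add: rep_def)
    then show ?case using DS(2) by simp
  next
    case (insert x F)
    have "rep (\<lambda>\<beta>. \<Sum>x\<in>insert x F. c x * elem_tensor N A x \<beta>)
      = c x \<cdot>\<^sub>m K x + rep (\<lambda>\<beta>. \<Sum>x\<in>F. c x * elem_tensor N A x \<beta>)"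
    proof (rule eq_matI)
      fix i j assume "i < dim_row (c x \<cdot>\<^sub>m K x + rep (\<lambda>\<beta>. \<Sum>x\<in>F. c x * elem_tensor N A x \<beta>))"
        "j < dim_col (c x \<cdot>\<^sub>m K x + rep (\<lambda>\<beta>. \<Sum>x\<in>F. c x * elem_tensor N A x \<beta>))"
      then have ij: "i < tdim" "j < tdim" by (simp_all add: rep_def)
      then show "rep (\<lambda>\<beta>. \<Sum>x\<in>insert x F. c x * elem_tensor N A x \<beta>) $$ (i, j)
        = (c x \<cdot>\<^sub>m K x + rep (\<lambda>\<beta>. \<Sum>x\<in>F. c x * elem_tensor N A x \<beta>)) $$ (i, j)"
        using insert.hyps insert.prems K_carrier[of x]
        by (subst index_rep_sum) (simp_all add: index_rep_sum carrier_matD[OF rep_carrier])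
    qed (use insert.prems K_carrier[of x] in \<open>simp_all add: rep_def\<close>)
    moreover have "c x \<cdot>\<^sub>m K x \<in> S" using insert.prems by (intro DS(6) K) simp
    ultimately show ?case using insert DS(4) by simp
  qed
  then show ?thesis by (simp add: F(3))
qed

end

text \<open>All axioms beyond closure are equations, and an injective homomorphism reflects
  equations. In this way tensor powers become admissible factors of a further tensor
  product.\<close>

lemma star_algebra_pullback:
  assumes B: "star_algebra B" and f: "star_hom A B f" and inj: "inj_on f (carrier A)"
    and zero: "f (azero A) = azero B" "azero A \<in> carrier A"
    and closed: "\<And>x y. x \<in> carrier A \<Longrightarrow> y \<in> carrier A \<Longrightarrow> aadd A x y \<in> carrier A"
      "\<And>x c. x \<in> carrier A \<Longrightarrow> ascale A c x \<in> carrier A"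
      "\<And>x y. x \<in> carrier A \<Longrightarrow> y \<in> carrier A \<Longrightarrow> amult A x y \<in> carrier A"
      "\<And>x. x \<in> carrier A \<Longrightarrow> astar A x \<in> carrier A"
  shows "star_algebra A"
proof -
  interpret B: star_algebra B by (rule B)
  note eq = inj_onD[OF inj]
  note h = star_homD[OF f]
  show ?thesis
    apply unfold_locales
                        apply (simp_all add: closed zero(2))[5]
                   apply (rule eq; simp add: h zero closed B.add_assoc B.add_zero B.add_neg B.scale_one B.scale_scale
        B.scale_add_left B.scale_add_right B.mult_assoc B.mult_add_left B.mult_add_right B.mult_scale_left
        B.mult_scale_right B.star_star B.star_add B.star_scale B.star_mult B.add_comm)+
    done
qed

section \<open>Maximal transmittable algebras\<close>

fun kron_spans :: "(nat \<Rightarrow> nat) \<Rightarrow> (nat \<Rightarrow> complex mat set) \<Rightarrow> nat \<Rightarrow> complex mat set" where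
  "kron_spans D S 0 = carrier_mat 1 1"
| "kron_spans D S (Suc N) = kron_span (\<Prod>i<Suc N. D i) (kron_spans D S N) (S N)"

lemma correctable_kron_spans:
  assumes L: "linear_map d k \<Phi>"
    and S: "\<And>i. i < N \<Longrightarrow> correctable (d ^ n i) (k ^ n i) (tensor_power_map d k \<Phi> (n i)) (S i)"
  shows "correctable (d ^ (\<Sum>i<N. n i)) (k ^ (\<Sum>i<N. n i)) (tensor_power_map d k \<Phi> (\<Sum>i<N. n i))
    (kron_spans (\<lambda>i. d ^ n i) S N)"
  using S
proof (induction N)
  case 0
  then show ?case using correctable_scalars by simp
next
  case (Suc N)
  have "correctable (d ^ (\<Sum>i<N. n i)) (k ^ (\<Sum>i<N. n i)) (tensor_power_map d k \<Phi> (\<Sum>i<N. n i))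
    (kron_spans (\<lambda>i. d ^ n i) S N)"
    using Suc by simp
  from correctable_tensor_power_add[OF L this Suc.prems[of N]] show ?case
    by (simp add: power_sum power_add)
qed

lemma krons_in_kron_spans:
  assumes "\<And>i. i < N \<Longrightarrow> X i \<in> S i" "\<And>i. i < N \<Longrightarrow> S i \<subseteq> carrier_mat (D i) (D i)"
  shows "krons N X \<in> kron_spans D S N"
  using assms
proof (induction N)
  case (Suc N)
  have sub: "kron_spans D S m \<subseteq> carrier_mat (\<Prod>i<m. D i) (\<Prod>i<m. D i)" if "m \<le> Suc N" for m
    using that
  proof (induction m)
    case (Suc m)
    then have "{kron X Y | X Y. X \<in> kron_spans D S m \<and> Y \<in> S m} \<subseteq> carrier_mat (\<Prod>i<Suc m. D i) (\<Prod>i<Suc m. D i)"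
      using kron_set_carrier[of "kron_spans D S m" "\<Prod>i<m. D i" "S m" "D m"] Suc.prems
        \<open>\<And>i. i < Suc N \<Longrightarrow> S i \<subseteq> carrier_mat (D i) (D i)\<close>[of m] by simp
    then show ?case
      unfolding kron_spans.simps kron_span_def using mspan_carrier by blast
  qed simp
  have "krons N X \<in> kron_spans D S N" using Suc by simp
  then have "kron (krons N X) (X N) \<in> {kron X Y | X Y. X \<in> kron_spans D S N \<and> Y \<in> S N}"
    using Suc.prems(1)[of N] by auto
  moreover have "{kron X Y | X Y. X \<in> kron_spans D S N \<and> Y \<in> S N} \<subseteq> carrier_mat (\<Prod>i<Suc N. D i) (\<Prod>i<Suc N. D i)"
    using kron_set_carrier[OF sub[of N] Suc.prems(2)[of N]] by simp
  ultimately show ?case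
    unfolding krons.simps kron_spans.simps kron_span_def by (rule mspan_base)
qed simp

text \<open>Only an embedding into a correctable algebra is demanded. \<open>A\<close> may have
  elements of any type while \<open>S\<close> consists of matrices, so the notion can be iterated
  through nested tensor products.\<close>

definition embeds_correctably ::
    "nat \<Rightarrow> nat \<Rightarrow> (complex mat \<Rightarrow> complex mat) \<Rightarrow> nat \<Rightarrow> 'a star_algebra \<Rightarrow> bool" where
  "embeds_correctably d k \<Phi> n A \<longleftrightarrow>
     (\<exists>S. correctable (d ^ n) (k ^ n) (tensor_power_map d k \<Phi> n) S \<and> star_embeds A (matrix_algebra (d ^ n) S))"

text \<open>The first conclusion supplies the algebra axioms that the lemma requires of its factors,
  so that it can be applied to its own results, as is done for products of tensor powers.\<close>

lemma tensor_embeds_correctably: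
  assumes L: "linear_map d k \<Phi>"
    and A: "\<And>i. i < N \<Longrightarrow> star_algebra (A i)"
    and emb: "\<And>i. i < N \<Longrightarrow> embeds_correctably d k \<Phi> (n i) (A i)"
  shows "star_algebra (tensor_algebra N A)"
    and "embeds_correctably d k \<Phi> (\<Sum>i<N. n i) (tensor_algebra N A)"
proof -
  have "\<exists>S. \<forall>i\<in>{..<N}. correctable (d ^ n i) (k ^ n i) (tensor_power_map d k \<Phi> (n i)) (S i) \<and>
      star_embeds (A i) (matrix_algebra (d ^ n i) (S i))"
    by (rule bchoice) (use emb in \<open>simp add: embeds_correctably_def\<close>)
  then obtain S where S: "\<And>i. i < N \<Longrightarrow> correctable (d ^ n i) (k ^ n i) (tensor_power_map d k \<Phi> (n i)) (S i)"
    and "\<And>i. i < N \<Longrightarrow> star_embeds (A i) (matrix_algebra (d ^ n i) (S i))" by auto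
  then have "\<exists>\<pi>. \<forall>i\<in>{..<N}. star_hom (A i) (matrix_algebra (d ^ n i) (S i)) (\<pi> i) \<and> inj_on (\<pi> i) (carrier (A i))"
    by (intro bchoice) (simp add: star_embeds_def)
  then obtain \<pi> where hom_S: "\<And>i. i < N \<Longrightarrow> star_hom (A i) (matrix_algebra (d ^ n i) (S i)) (\<pi> i)"
    and inj: "\<And>i. i < N \<Longrightarrow> inj_on (\<pi> i) (carrier (A i))" by auto
  have sub: "S i \<subseteq> carrier_mat (d ^ n i) (d ^ n i)" if "i < N" for i
    using S[OF that] star_subalgebraD(1) by (auto simp: correctable_def)
  let ?D = "\<lambda>i. d ^ n i"
  have hom: "star_hom (A i) (matrix_algebra (?D i) (carrier_mat (?D i) (?D i))) (\<pi> i)" if "i < N" for i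
    using hom_S[OF that] sub[OF that] by (auto simp: star_hom_def)
  interpret represented_tensor N A ?D \<pi>
    by (rule represented_tensor.intro) (fact A hom inj)+
  have dim: "tdim = d ^ (\<Sum>i<N. n i)" by (simp add: power_sum)
  have C: "correctable (d ^ (\<Sum>i<N. n i)) (k ^ (\<Sum>i<N. n i)) (tensor_power_map d k \<Phi> (\<Sum>i<N. n i))
      (kron_spans ?D S N)"
    by (rule correctable_kron_spans[OF L S])
  then have sa: "star_subalgebra tdim (kron_spans ?D S N)"
    by (simp add: correctable_def dim)
  have "K x \<in> kron_spans ?D S N" if "x \<in> tuples N A" for x
    unfolding K_def using star_homD(1)[OF hom_S tuplesD[OF that]] sub by (intro krons_in_kron_spans) auto
  then have rep: "rep T \<in> kron_spans ?D S N" if "T \<in> carrier TA" for T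
    using rep_in_subalgebra[OF sa _ that] by blast
  then have TA: "star_hom TA (matrix_algebra tdim (kron_spans ?D S N)) rep"
    using star_hom_rep by (auto simp: star_hom_def)
  then have "star_embeds TA (matrix_algebra (d ^ (\<Sum>i<N. n i)) (kron_spans ?D S N))"
    using inj_rep unfolding star_embeds_def dim[symmetric] by blast
  then show "embeds_correctably d k \<Phi> (\<Sum>i<N. n i) TA"
    unfolding embeds_correctably_def using C by blast
  have zero: "rep (azero TA) = azero (matrix_algebra tdim (kron_spans ?D S N))"
    by (intro eq_matI) (simp_all add: tensor_simps rep_def)
  show "star_algebra TA"
  proof (rule star_algebra_pullback)
    show "star_algebra (matrix_algebra tdim (kron_spans ?D S N))" by (rule star_algebra_matrix_algebra[OF sa])
    show "star_hom TA (matrix_algebra tdim (kron_spans ?D S N)) rep" by (rule TA)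
    show "inj_on rep (carrier TA)" by (rule inj_rep)
    show "rep (azero TA) = azero (matrix_algebra tdim (kron_spans ?D S N))" by (rule zero)
  qed (rule tensor_closed; assumption)+
qed

section \<open>Embeddings, isomorphisms and maximality\<close>

lemma star_hom_comp: "star_hom A B f \<Longrightarrow> star_hom B C g \<Longrightarrow> star_hom A C (g \<circ> f)"
  by (auto simp: star_hom_def Pi_iff)

lemma star_embeds_trans: "star_embeds A B \<Longrightarrow> star_embeds B C \<Longrightarrow> star_embeds A C"
proof -
  assume "star_embeds A B" "star_embeds B C"
  then obtain f g where f: "star_hom A B f" "inj_on f (carrier A)" and g: "star_hom B C g" "inj_on g (carrier B)"
    by (auto simp: star_embeds_def)
  have "inj_on (g \<circ> f) (carrier A)"
    using f(2) star_homD(1)[OF f(1)] by (intro comp_inj_on inj_on_subset[OF g(2)]) auto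
  then show "star_embeds A C"
    using star_hom_comp[OF f(1) g(1)] by (auto simp: star_embeds_def)
qed

lemma star_iso_trans: "star_iso A B \<Longrightarrow> star_iso B C \<Longrightarrow> star_iso A C"
  unfolding star_iso_def using star_hom_comp bij_betw_trans by blast

lemma star_iso_sym:
  assumes A: "star_algebra A" and AB: "star_iso A B"
  shows "star_iso B A"
proof -
  interpret star_algebra A by (rule A)
  obtain f where f: "star_hom A B f" "bij_betw f (carrier A) (carrier B)"
    using AB by (auto simp: star_iso_def)
  let ?g = "inv_into (carrier A) f"
  have g: "bij_betw ?g (carrier B) (carrier A)" by (rule bij_betw_inv_into[OF f(2)])
  have gc: "?g y \<in> carrier A" "f (?g y) = y" if "y \<in> carrier B" for y
    using that g f(2) by (auto simp: bij_betw_apply bij_betw_inv_into_right)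
  have eq: "?g y = x" if "x \<in> carrier A" "f x = y" for x y
    using that f(2) bij_betw_inv_into_left by fastforce
  have "star_hom B A ?g"
    unfolding star_hom_def
  proof (intro conjI ballI allI)
    fix x y c assume x: "x \<in> carrier B"
    show "?g (ascale B c x) = ascale A c (?g x)" "?g (astar B x) = astar A (?g x)"
      using gc[OF x] by (auto intro!: eq scale_closed star_closed simp: star_homD(3,5)[OF f(1)])
    assume y: "y \<in> carrier B"
    show "?g (aadd B x y) = aadd A (?g x) (?g y)" "?g (amult B x y) = amult A (?g x) (?g y)"
      using gc[OF x] gc[OF y] by (auto intro!: eq add_closed mult_closed simp: star_homD(2,4)[OF f(1)])
  qed (auto simp: gc)
  then show ?thesis using g by (auto simp: star_iso_def)
qed

lemma transmittable_correctable:
  assumes "correctable d k \<Phi> S"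
  shows "transmittable d k \<Phi> (matrix_algebra d S)"
proof -
  have S: "star_subalgebra d S" using assms by (simp add: correctable_def)
  have "star_hom (matrix_algebra d S) (matrix_algebra d (carrier_mat d d)) (\<lambda>X. X)"
    using star_subalgebraD(1)[OF S] by (auto simp: star_hom_def)
  then show ?thesis
    using assms fd_cstar_matrix_algebra[OF S]
    unfolding transmittable_def by (intro conjI exI[of _ "\<lambda>X. X"]) auto
qed

text \<open>\<open>T\<close> only mediates: maximality is tested against the algebra
  \<open>S\<close> of matrices, whose type is the one quantified over in
  \<open>maximal_transmittable\<close>.\<close>

lemma maximal_transmittable_iso:
  assumes C: "maximal_transmittable (d ^ n) (k ^ n) (tensor_power_map d k \<Phi> n) C"
    and S: "correctable (d ^ n) (k ^ n) (tensor_power_map d k \<Phi> n) S"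
    and T: "star_embeds T (matrix_algebra (d ^ n) S)" and CT: "star_embeds C T"
  shows "star_iso C (matrix_algebra (d ^ n) S)"
  using C transmittable_correctable[OF S] star_embeds_trans[OF CT T]
  unfolding maximal_transmittable_def by blast

lemma transmittable_embeds_correctably:
  assumes "transmittable (d ^ n) (k ^ n) (tensor_power_map d k \<Phi> n) A"
  shows "embeds_correctably d k \<Phi> n A"
proof -
  obtain \<pi> where \<pi>: "star_hom A (matrix_algebra (d ^ n) (carrier_mat (d ^ n) (d ^ n))) \<pi>" "inj_on \<pi> (carrier A)"
    and C: "correctable (d ^ n) (k ^ n) (tensor_power_map d k \<Phi> n) (\<pi> ` carrier A)"
    using assms by (auto simp: transmittable_def)
  have "star_hom A (matrix_algebra (d ^ n) (\<pi> ` carrier A)) \<pi>"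
    using \<pi>(1) by (auto simp: star_hom_def)
  then show ?thesis
    using C \<pi>(2) by (auto simp: embeds_correctably_def star_embeds_def)
qed

text \<open>Allows exponent functions to be restricted to \<open>{..<R}\<close>, without which
  infinitely many of them would describe the same tensor product.\<close>

lemma tensor_algebra_cong:
  assumes "\<And>i. i < N \<Longrightarrow> A i = B i"
  shows "tensor_algebra N A = tensor_algebra N B"
proof -
  have t: "tuples N A = tuples N B"
    unfolding tuples_def using assms by (intro PiE_cong) simp
  have m: "multilinear_form N A = multilinear_form N B"
    by (simp add: fun_eq_iff multilinear_form_def t assms)
  have eqs: "(\<lambda>i\<in>{..<N}. amult (A i) (x i) (y i)) = (\<lambda>i\<in>{..<N}. amult (B i) (x i) (y i))"
    "(\<lambda>i\<in>{..<N}. astar (A i) (x i)) = (\<lambda>i\<in>{..<N}. astar (B i) (x i))" for x y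
    using assms by (auto intro!: restrict_ext)
  show ?thesis
    unfolding tensor_algebra_def elem_tensor_def t m eqs by (rule refl)
qed

text \<open>The slack \<open>n - \<Sum> a\<^sub>j\<close> turns the exponent vectors into weak compositions of \<open>n\<close> into
  \<open>R + 1\<close> parts.\<close>

lemma card_exponents:
  fixes l :: "nat \<Rightarrow> nat" and n :: nat
  assumes l: "\<And>j. j < R \<Longrightarrow> l j \<ge> 1"
  defines "E \<equiv> {a \<in> {..<R} \<rightarrow>\<^sub>E UNIV. (\<Sum>j<R. a j * l j) = n}"
  shows "finite E" "card E \<le> (n + R) choose R"
proof -
  let ?L = "{xs :: nat list. length xs = Suc R \<and> sum_list xs = n}"
  let ?f = "\<lambda>a. (n - (\<Sum>j<R. a j)) # map a [0..<R]"
  \<comment> \<open>Stars and bars gives \<open>(n + R) choose n\<close>; symmetry of the binomial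
    turns it into the stated form.\<close>
  have cardL: "card ?L = (n + R) choose R"
    using card_length_sum_list[of "Suc R" n] binomial_symmetric[of n "n + R"] by simp
  have finL: "finite ?L"
  proof (rule finite_subset)
    show "?L \<subseteq> {xs. set xs \<subseteq> {..n} \<and> length xs = Suc R}"
      using member_le_sum_list by fastforce
  qed (simp add: finite_lists_length_eq)
  have inj: "inj_on ?f E"
  proof (rule inj_onI)
    fix a b assume ab: "a \<in> E" "b \<in> E" "?f a = ?f b"
    then have "map a [0..<R] = map b [0..<R]" by simp
    then have "\<And>j. j < R \<Longrightarrow> a j = b j" by (simp add: map_eq_conv)
    then show "a = b" using ab(1,2) unfolding E_def by (auto intro: PiE_ext)
  qed
  have "?f ` E \<subseteq> ?L"
  proof
    fix xs assume "xs \<in> ?f ` E"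
    then obtain a where a: "a \<in> E" "xs = ?f a" by blast
    \<comment> \<open>Positivity of the \<open>l j\<close> bounds the sum of the exponents by
      \<open>n\<close>, so the subtraction in the slack is not truncated and the list sums to
      \<open>n\<close>.\<close>
    have "(\<Sum>j<R. a j) \<le> (\<Sum>j<R. a j * l j)"
      using l by (intro sum_mono) simp
    then have "(\<Sum>j<R. a j) \<le> n" using a(1) by (simp add: E_def)
    then show "xs \<in> ?L"
      using a(2) by (simp add: sum_list_distinct_conv_sum_set atLeast0LessThan)
  qed
  then show "finite E" "card E \<le> (n + R) choose R"
    using inj_on_finite[OF inj _ finL] card_inj_on_le[OF inj _ finL] cardL by simp_all
qed

text \<open>The binomial is at most \<open>(n + R) ^ R\<close>, and
  \<open>n + R \<le> Suc R * n\<close> for \<open>n \<ge> 1\<close>; hence the constant.\<close>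

lemma binomial_bigo: "(\<lambda>n. real ((n + R) choose R)) \<in> O(\<lambda>n. real n ^ R)"
proof (rule bigoI[where c = "real (Suc R ^ R)"])
  show "\<forall>\<^sub>F n in sequentially. norm (real ((n + R) choose R)) \<le> real (Suc R ^ R) * norm (real n ^ R)"
  proof (rule eventually_sequentiallyI)
    fix n :: nat assume n: "1 \<le> n"
    have "(n + R) choose R \<le> (n + R) ^ R"
      by (rule binomial_le_pow) simp
    also have "n + R \<le> Suc R * n" using n by simp
    then have "(n + R) ^ R \<le> Suc R ^ R * n ^ R"
      by (metis power_mono power_mult_distrib zero_le)
    finally show "norm (real ((n + R) choose R)) \<le> real (Suc R ^ R) * norm (real n ^ R)"
      by (simp only: norm_of_nat norm_power of_nat_mult[symmetric] of_nat_power[symmetric] of_nat_le_iff)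
  qed
qed

theorem lemma5p3:
  fixes d k R :: nat
    and \<Phi> :: "complex mat \<Rightarrow> complex mat"
    and G :: "nat \<Rightarrow> 'a star_algebra"
    and l :: "nat \<Rightarrow> nat"
  assumes "channel d k \<Phi>"
    and "\<And>j. j < R \<Longrightarrow> l j \<ge> 1"
    and "\<And>j. j < R \<Longrightarrow> fd_cstar_algebra (G j)"
    and "\<And>j. j < R \<Longrightarrow>
      maximal_transmittable (d ^ l j) (k ^ l j) (tensor_power_map d k \<Phi> (l j)) (G j)"
    and "\<And>n (C :: complex mat star_algebra). n \<ge> 1 \<Longrightarrow>
      maximal_transmittable (d ^ n) (k ^ n) (tensor_power_map d k \<Phi> n) C \<Longrightarrow>
      \<exists>a :: nat \<Rightarrow> nat. (\<Sum>j<R. a j * l j) = n \<and>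
        star_embeds C (tensor_algebra R (\<lambda>j. tensor_power (G j) (a j)))"
  shows "(\<forall>n\<ge>1. finite (max_classes (d ^ n) (k ^ n) (tensor_power_map d k \<Phi> n)) \<and>
            width d k \<Phi> n \<le> (n + R) choose R) \<and>
         (\<lambda>n. real ((n + R) choose R)) \<in> O(\<lambda>n. real n ^ R)"
proof (intro conjI allI impI binomial_bigo)
  fix n :: nat assume n: "1 \<le> n"
  let ?T = "\<lambda>a. tensor_algebra R (\<lambda>j. tensor_power (G j) (a j))"
  let ?max = "maximal_transmittable (d ^ n) (k ^ n) (tensor_power_map d k \<Phi> n) ::
    complex mat star_algebra \<Rightarrow> bool"
  let ?M = "max_classes (d ^ n) (k ^ n) (tensor_power_map d k \<Phi> n)"
  let ?E = "{a \<in> {..<R} \<rightarrow>\<^sub>E UNIV. (\<Sum>j<R. a j * l j) = n}"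
  have L: "linear_map d k \<Phi>" using assms(1) by (simp add: channel_def)
  have emb: "embeds_correctably d k \<Phi> n (?T a)" if "(\<Sum>j<R. a j * l j) = n" for a
  proof -
    have Gj: "star_algebra (G j)" "embeds_correctably d k \<Phi> (l j) (G j)" if "j < R" for j
      using assms(3,4)[OF that] by (auto simp: fd_cstar_algebra_def maximal_transmittable_def
          intro: transmittable_embeds_correctably)
    \<comment> \<open>The inner level: \<open>a j\<close> equal factors, each using the channel
      \<open>l j\<close> times. The outer level combines these powers over \<open>j\<close>.\<close>
    have Tj: "star_algebra (tensor_power (G j) (a j))"
      "embeds_correctably d k \<Phi> (a j * l j) (tensor_power (G j) (a j))" if "j < R" for j
      using tensor_embeds_correctably[OF L, of "a j" "\<lambda>_. G j" "\<lambda>_. l j"] Gj[OF that] by simp_all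
    have "embeds_correctably d k \<Phi> (\<Sum>j<R. a j * l j) (?T a)"
      by (rule tensor_embeds_correctably(2)[OF L]) (rule Tj; assumption)+
    then show ?thesis by (simp only: that)
  qed
  \<comment> \<open>The choice depends on \<open>a\<close> alone and not on the algebra that embeds,
    so equal exponents lead to one and the same class.\<close>
  define S where "S a = (SOME S. correctable (d ^ n) (k ^ n) (tensor_power_map d k \<Phi> n) S \<and>
    star_embeds (?T a) (matrix_algebra (d ^ n) S))" for a
  have S: "correctable (d ^ n) (k ^ n) (tensor_power_map d k \<Phi> n) (S a)"
    "star_embeds (?T a) (matrix_algebra (d ^ n) (S a))" if "(\<Sum>j<R. a j * l j) = n" for a
    using someI_ex[OF emb[OF that, unfolded embeds_correctably_def]] unfolding S_def by blast+
  let ?cls = "\<lambda>a. {B :: complex mat star_algebra. star_iso (matrix_algebra (d ^ n) (S a)) B}"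
  have sub: "?M \<subseteq> ?cls ` ?E"
  proof
    fix X assume "X \<in> ?M"
    then obtain C where C: "?max C" and "X = {(A, B). star_iso A B} `` {C}"
      unfolding max_classes_def quotient_def by blast
    \<comment> \<open>The relation in \<open>max_classes\<close> is not restricted to maximal
      algebras, so a class contains every isomorphic algebra of matrices and can equal
      \<open>?cls ?a\<close> as a set.\<close>
    then have X: "X = {B. star_iso C B}" by auto
    obtain a where a: "(\<Sum>j<R. a j * l j) = n" "star_embeds C (?T a)"
      using assms(5)[OF n C] by blast
    let ?a = "restrict a {..<R}"
    have r: "(\<Sum>j<R. ?a j * l j) = n" using a(1) by simp
    have T: "?T ?a = ?T a" by (rule tensor_algebra_cong) simp
    have iso: "star_iso C (matrix_algebra (d ^ n) (S ?a))"
      by (rule maximal_transmittable_iso[OF C S[OF r]]) (simp only: T a(2))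
    \<comment> \<open>\<open>star_iso\<close> relates bare records; reversing \<open>iso\<close>
      uses that \<open>C\<close> is closed under its operations.\<close>
    have "star_algebra C"
      using C by (simp add: maximal_transmittable_def transmittable_def fd_cstar_algebra_def)
    then have "X = ?cls ?a"
      unfolding X using star_iso_trans[OF iso] star_iso_trans[OF star_iso_sym[OF _ iso]] by blast
    moreover have "?a \<in> ?E" using r by simp
    ultimately show "X \<in> ?cls ` ?E" by (rule image_eqI)
  qed
  have E: "finite ?E" "card ?E \<le> (n + R) choose R"
    using card_exponents[of R l n] assms(2) by auto
  \<comment> \<open>Shown separately because \<open>card\<close> is 0 on infinite sets, where a
    bound on \<open>width\<close> would carry no information.\<close>
  show "finite ?M" using sub E(1) by (rule finite_surj[rotated])
  have "card ?M \<le> card ?E"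
    using surj_card_le[OF E(1) sub] .
  then show "width d k \<Phi> n \<le> (n + R) choose R"
    using E(2) by (simp add: width_def)
qed

end
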